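(* There is a constant $c>0$ such that, for every $n\ge1$, every $\delta\ge0$, every $b\in K(L^2(0,2\pi))$ and every $b^\delta\in L^2(0,2\pi)$ with $\|b^\delta-b\|_{L^2}\le\delta$, the dual least squares method satisfies $$\big\|K^{-1}b-(K_n^{DLS})^{-1}Q_n^{DLS}b^\delta\big\|_{L^2}\le c\,n\,\delta+2\min\{\|K^{-1}b-z_n\|_{L^2}: z_n\in K(Y_n^{DLS})\}.$$
   Context: Setting: $\Omega\subset\mathbb{R}^2$ is a bounded simply connected domain whose boundary $\partial\Omega$ is a closed curve of class $C^3$, i.e. it has a $2\pi$-periodic, three times continuously differentiable (simple closed) parametrization $\gamma(s)=(a(s),b(s))$, $s\in[0,2\pi]$, with $|\dot\gamma(s)|>0$ for all $s$. It is assumed that there exists $z_0\in\Omega$ with $|x-z_0|\neq1$ for all $x\in\partial\Omega$. Symm's integral operator is $K:L^2(0,2\pi)\to L^2(0,2\pi)$, $$(K\Psi)(t)=-\frac1\pi\int_0^{2\pi}\Psi(s)\ln|\gamma(t)-\gamma(s)|\,ds ;$$ it is injective and self-adjoint. Dual least squares method: $Y_n^{DLS}=\mathrm{span}\{e^{ikt}:-n\le k\le n\}$, $X_n^{DLS}=K^*(Y_n^{DLS})=K(Y_n^{DLS})$, $P_n^{DLS}$ and $Q_n^{DLS}$ are the orthogonal projections of $L^2(0,2\pi)$ onto $X_n^{DLS}$ and $Y_n^{DLS}$, and $K_n^{DLS}=Q_n^{DLS}KP_n^{DLS}:X_n^{DLS}\to Y_n^{DLS}$, which is invertible. *)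

theory Defs
  imports "HOL-Analysis.Analysis"
begin

abbreviation period_measure :: "real measure" where
  "period_measure \<equiv> restrict_space lborel {0..2 * pi}"

definition square_integrable :: "(real \<Rightarrow> complex) \<Rightarrow> bool" where
  "square_integrable f \<longleftrightarrow>
     f \<in> borel_measurable period_measure \<and>
     integrable period_measure (\<lambda>x. (cmod (f x))\<^sup>2)"

definition L2_rel :: "(real \<Rightarrow> complex) \<Rightarrow> (real \<Rightarrow> complex) \<Rightarrow> bool" where
  "L2_rel f g \<longleftrightarrow> square_integrable f \<and> square_integrable g \<and>
     (AE x in period_measure. f x = g x)"

lemma square_integrable_prod:
  assumes "square_integrable f" "square_integrable g"
  shows "integrable period_measure (\<lambda>x. f x * cnj (g x))"
proof (rule Bochner_Integration.integrable_bound)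
  show "integrable period_measure (\<lambda>x. (cmod (f x))\<^sup>2 + (cmod (g x))\<^sup>2)"
    using assms by (simp add: square_integrable_def)
  have [measurable]: "f \<in> borel_measurable period_measure" "g \<in> borel_measurable period_measure"
    using assms by (simp_all add: square_integrable_def)
  have "(\<lambda>x. cnj (g x)) \<in> borel_measurable period_measure"
    by (rule borel_measurable_continuous_on[where f = cnj]) (auto intro: continuous_intros)
  then show "(\<lambda>x. f x * cnj (g x)) \<in> borel_measurable period_measure" by simp
  have "norm (f x * cnj (g x)) \<le> norm ((cmod (f x))\<^sup>2 + (cmod (g x))\<^sup>2)" for x
  proof -
    have "0 \<le> (cmod (f x) - cmod (g x))\<^sup>2" by simp
    then have "2 * (cmod (f x) * cmod (g x)) \<le> (cmod (f x))\<^sup>2 + (cmod (g x))\<^sup>2"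
      by (simp add: power2_eq_square algebra_simps)
    moreover have "0 \<le> cmod (f x) * cmod (g x)" by simp
    ultimately have "cmod (f x) * cmod (g x) \<le> (cmod (f x))\<^sup>2 + (cmod (g x))\<^sup>2"
      by linarith
    then show ?thesis by (simp add: norm_mult)
  qed
  then show "AE x in period_measure. norm (f x * cnj (g x)) \<le> norm ((cmod (f x))\<^sup>2 + (cmod (g x))\<^sup>2)"
    by simp
qed

lemma square_integrable_zero: "square_integrable (\<lambda>_. 0)"
  by (simp add: square_integrable_def)

lemma square_integrable_mult:
  "square_integrable f \<Longrightarrow> square_integrable (\<lambda>x. c * f x)"
  by (auto simp: square_integrable_def norm_mult power_mult_distrib)

lemma square_integrable_add:
  assumes "square_integrable f" "square_integrable g"
  shows "square_integrable (\<lambda>x. f x + g x)"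
proof -
  have m [measurable]: "f \<in> borel_measurable period_measure" "g \<in> borel_measurable period_measure"
    using assms by (simp_all add: square_integrable_def)
  have "integrable period_measure (\<lambda>x. (cmod (f x + g x))\<^sup>2)"
  proof (rule Bochner_Integration.integrable_bound)
    show "integrable period_measure (\<lambda>x. 2 * (cmod (f x))\<^sup>2 + 2 * (cmod (g x))\<^sup>2)"
      using assms by (simp add: square_integrable_def)
    have "(cmod (f x + g x))\<^sup>2 \<le> 2 * (cmod (f x))\<^sup>2 + 2 * (cmod (g x))\<^sup>2" for x
    proof -
      have "(cmod (f x + g x))\<^sup>2 \<le> (cmod (f x) + cmod (g x))\<^sup>2"
        by (simp add: norm_triangle_ineq power_mono)
      moreover have "0 \<le> (cmod (f x) - cmod (g x))\<^sup>2" by simp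
      ultimately show ?thesis by (simp add: power2_eq_square algebra_simps)
    qed
    then show "AE x in period_measure.
        norm ((cmod (f x + g x))\<^sup>2) \<le> norm (2 * (cmod (f x))\<^sup>2 + 2 * (cmod (g x))\<^sup>2)"
      by simp
  qed simp
  then show ?thesis by (simp add: square_integrable_def)
qed

lemma square_integrable_uminus:
  "square_integrable f \<Longrightarrow> square_integrable (\<lambda>x. - f x)"
  by (auto simp: square_integrable_def)

lemma square_integrable_diff:
  "square_integrable f \<Longrightarrow> square_integrable g \<Longrightarrow> square_integrable (\<lambda>x. f x - g x)"
  using square_integrable_add[of f "\<lambda>x. - g x"] square_integrable_uminus by simp

lemma L2_rel_map:
  assumes "L2_rel f f'" "L2_rel g g'"
    and "square_integrable (\<lambda>x. h (f x) (g x))" "square_integrable (\<lambda>x. h (f' x) (g' x))"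
  shows "L2_rel (\<lambda>x. h (f x) (g x)) (\<lambda>x. h (f' x) (g' x))"
proof -
  have "AE x in period_measure. f x = f' x" "AE x in period_measure. g x = g' x"
    using assms by (simp_all add: L2_rel_def)
  then have "AE x in period_measure. h (f x) (g x) = h (f' x) (g' x)"
    by eventually_elim simp
  then show ?thesis using assms by (simp add: L2_rel_def)
qed

quotient_type L2 = "real \<Rightarrow> complex" / partial: L2_rel
proof (rule part_equivpI)
  show "\<exists>f. L2_rel f f"
    using square_integrable_zero by (auto simp: L2_rel_def)
  show "symp L2_rel"
    by (rule sympI) (simp add: L2_rel_def eq_commute)
  show "transp L2_rel"
  proof (rule transpI)
    fix f g h assume "L2_rel f g" "L2_rel g h"
    then have "AE x in period_measure. f x = g x" "AE x in period_measure. g x = h x"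
      by (simp_all add: L2_rel_def)
    then have "AE x in period_measure. f x = h x" by eventually_elim simp
    then show "L2_rel f h"
      using \<open>L2_rel f g\<close> \<open>L2_rel g h\<close> by (simp add: L2_rel_def)
  qed
qed

lemma L2_relI:
  "square_integrable f \<Longrightarrow> square_integrable g \<Longrightarrow> (\<And>x. f x = g x) \<Longrightarrow> L2_rel f g"
  by (simp add: L2_rel_def)

instantiation L2 :: real_vector
begin

lift_definition zero_L2 :: L2 is "\<lambda>_. 0"
  by (simp add: L2_rel_def square_integrable_zero)

lift_definition plus_L2 :: "L2 \<Rightarrow> L2 \<Rightarrow> L2" is "\<lambda>f g x. f x + g x"
  by (rule L2_rel_map) (simp_all add: L2_rel_def square_integrable_add)

lift_definition minus_L2 :: "L2 \<Rightarrow> L2 \<Rightarrow> L2" is "\<lambda>f g x. f x - g x"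
  by (rule L2_rel_map) (simp_all add: L2_rel_def square_integrable_diff)

lift_definition uminus_L2 :: "L2 \<Rightarrow> L2" is "\<lambda>f x. - f x"
  by (rule L2_rel_map[where h = "\<lambda>u _. - u"]) (simp_all add: L2_rel_def square_integrable_uminus)

lift_definition scaleR_L2 :: "real \<Rightarrow> L2 \<Rightarrow> L2" is "\<lambda>c f x. complex_of_real c * f x"
  by (rule L2_rel_map[where h = "\<lambda>u _. _ * u"]) (simp_all add: L2_rel_def square_integrable_mult)

instance
proof
  fix f g h :: L2 and a b :: real
  note closure = square_integrable_add square_integrable_diff square_integrable_uminus
    square_integrable_mult square_integrable_zero
  show "f + g + h = f + (g + h)"
    by transfer (rule L2_relI; simp add: L2_rel_def closure add.assoc)
  show "f + g = g + f"
    by transfer (rule L2_relI; simp add: L2_rel_def closure add.commute)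
  show "0 + f = f"
    by transfer (rule L2_relI; simp add: L2_rel_def)
  show "- f + f = 0"
    by transfer (rule L2_relI; simp add: L2_rel_def closure)
  show "f - g = f + - g"
    by transfer (rule L2_relI; simp add: L2_rel_def closure)
  show "a *\<^sub>R (f + g) = a *\<^sub>R f + a *\<^sub>R g"
    by transfer (rule L2_relI; simp add: L2_rel_def closure distrib_left)
  show "(a + b) *\<^sub>R f = a *\<^sub>R f + b *\<^sub>R f"
    by transfer (rule L2_relI; simp add: L2_rel_def closure distrib_right)
  show "a *\<^sub>R b *\<^sub>R f = (a * b) *\<^sub>R f"
    by transfer (rule L2_relI; simp add: L2_rel_def closure mult.assoc)
  show "1 *\<^sub>R f = f"
    by transfer (rule L2_relI; simp add: L2_rel_def)
qed

end

lift_definition scaleC :: "complex \<Rightarrow> L2 \<Rightarrow> L2" is "\<lambda>c f x. c * f x"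
  by (rule L2_rel_map[where h = "\<lambda>u _. _ * u"]) (simp_all add: L2_rel_def square_integrable_mult)

global_interpretation L2_complex: vector_space scaleC
  defines cspan = L2_complex.span
proof
  fix f g :: L2 and a b :: complex
  note closure = square_integrable_add square_integrable_mult
  show "scaleC a (f + g) = scaleC a f + scaleC a g"
    by transfer (rule L2_relI; simp add: L2_rel_def closure distrib_left)
  show "scaleC (a + b) f = scaleC a f + scaleC b f"
    by transfer (rule L2_relI; simp add: L2_rel_def closure distrib_right)
  show "scaleC a (scaleC b f) = scaleC (a * b) f"
    by transfer (rule L2_relI; simp add: L2_rel_def closure mult.assoc)
  show "scaleC 1 f = f"
    by transfer (rule L2_relI; simp add: L2_rel_def)
qed

lift_definition cinner :: "L2 \<Rightarrow> L2 \<Rightarrow> complex" is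
  "\<lambda>f g. \<integral>x. f x * cnj (g x) \<partial>period_measure"
proof -
  fix f f' g g' assume a: "L2_rel f f'" "L2_rel g g'"
  then have "AE x in period_measure. f x = f' x" "AE x in period_measure. g x = g' x"
    by (simp_all add: L2_rel_def)
  then have "AE x in period_measure. f x * cnj (g x) = f' x * cnj (g' x)"
    by eventually_elim simp
  moreover have "(\<lambda>x. f x * cnj (g x)) \<in> borel_measurable period_measure"
    "(\<lambda>x. f' x * cnj (g' x)) \<in> borel_measurable period_measure"
    using a square_integrable_prod by (simp_all add: L2_rel_def borel_measurable_integrable)
  ultimately show "(\<integral>x. f x * cnj (g x) \<partial>period_measure) = (\<integral>x. f' x * cnj (g' x) \<partial>period_measure)"
    by (intro integral_cong_AE)
qed

lemma cinner_cnj: "cinner f g = cnj (cinner g f)"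
proof (transfer)
  fix f g :: "real \<Rightarrow> complex"
  have "cnj (\<integral>x. g x * cnj (f x) \<partial>period_measure) = (\<integral>x. cnj (g x * cnj (f x)) \<partial>period_measure)"
    by (rule Bochner_Integration.integral_cnj[symmetric])
  then show "(\<integral>x. f x * cnj (g x) \<partial>period_measure) = cnj (\<integral>x. g x * cnj (f x) \<partial>period_measure)"
    by (simp add: mult.commute)
qed

lemma cinner_add_left: "cinner (f + g) h = cinner f h + cinner g h"
  by transfer (auto simp: L2_rel_def square_integrable_prod distrib_right)

lemma cinner_scaleC_left: "cinner (scaleC c f) g = c * cinner f g"
  by transfer (simp add: L2_rel_def mult.assoc)

lemma scaleR_scaleC: "scaleR r f = scaleC (complex_of_real r) f"
  by transfer (auto simp: L2_rel_def intro: square_integrable_mult)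

lemma cinner_self:
  "Im (cinner f f) = 0" "0 \<le> Re (cinner f f)" "Re (cinner f f) = 0 \<longleftrightarrow> f = 0"
proof -
  have *: "(\<integral>x. f x * cnj (f x) \<partial>period_measure) =
      complex_of_real (\<integral>x. (cmod (f x))\<^sup>2 \<partial>period_measure)" for f
    by (simp only: complex_norm_square[symmetric] integral_complex_of_real)
  show "Im (cinner f f) = 0" by transfer (simp only: * Im_complex_of_real)
  show "0 \<le> Re (cinner f f)" by transfer (simp only: * Re_complex_of_real, simp)
  show "Re (cinner f f) = 0 \<longleftrightarrow> f = 0"
    by transfer (simp only: * Re_complex_of_real,
        simp add: L2_rel_def square_integrable_def integral_nonneg_eq_0_iff_AE)
qed

instantiation L2 :: real_inner
begin

definition inner_L2 :: "L2 \<Rightarrow> L2 \<Rightarrow> real" where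
  "inner_L2 f g = Re (cinner f g)"

definition norm_L2 :: "L2 \<Rightarrow> real" where
  "norm_L2 f = sqrt (Re (cinner f f))"

definition sgn_L2 :: "L2 \<Rightarrow> L2" where
  "sgn_L2 f = inverse (norm f) *\<^sub>R f"

definition dist_L2 :: "L2 \<Rightarrow> L2 \<Rightarrow> real" where
  "dist_L2 f g = norm (f - g)"

definition uniformity_L2 :: "(L2 \<times> L2) filter" where
  "uniformity_L2 = (INF e\<in>{0<..}. principal {(f, g). dist f g < e})"

definition open_L2 :: "L2 set \<Rightarrow> bool" where
  "open_L2 U \<longleftrightarrow> (\<forall>f\<in>U. eventually (\<lambda>(f', g). f' = f \<longrightarrow> g \<in> U) uniformity)"

instance
proof
  fix f g h :: L2 and r :: real
  show "inner f g = inner g f"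
    unfolding inner_L2_def by (subst cinner_cnj) simp
qed (auto simp: inner_L2_def norm_L2_def sgn_L2_def dist_L2_def uniformity_L2_def open_L2_def
    cinner_add_left scaleR_scaleC cinner_scaleC_left cinner_self)

end

lemma norm_abs_L2:
  assumes "square_integrable f"
  shows "norm (abs_L2 f) = sqrt (\<integral>x. (cmod (f x))\<^sup>2 \<partial>period_measure)"
proof -
  have "L2_rel f f" using assms by (simp add: L2_rel_def)
  then have "cinner (abs_L2 f) (abs_L2 f) = (\<integral>x. f x * cnj (f x) \<partial>period_measure)"
    by (simp add: cinner.abs_eq)
  also have "\<dots> = complex_of_real (\<integral>x. (cmod (f x))\<^sup>2 \<partial>period_measure)"
    by (simp only: complex_norm_square[symmetric] integral_complex_of_real)
  finally show ?thesis by (simp add: norm_L2_def)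
qed

text \<open>
  The description is proper on the finite-dimensional complex subspaces to which it is applied.
\<close>

definition orth_proj :: "L2 set \<Rightarrow> L2 \<Rightarrow> L2" where
  "orth_proj S f = (THE g. g \<in> S \<and> (\<forall>h\<in>S. cinner (f - g) h = 0))"

definition C3_closed_curve :: "(real \<Rightarrow> real \<times> real) \<Rightarrow> bool" where
  "C3_closed_curve \<gamma> \<longleftrightarrow>
     (\<forall>s. \<gamma> (s + 2 * pi) = \<gamma> s) \<and>
     inj_on \<gamma> {0..<2 * pi} \<and>
     (\<exists>\<gamma>1 \<gamma>2 \<gamma>3.
        (\<forall>s. (\<gamma> has_vector_derivative \<gamma>1 s) (at s)) \<and>
        (\<forall>s. (\<gamma>1 has_vector_derivative \<gamma>2 s) (at s)) \<and>
        (\<forall>s. (\<gamma>2 has_vector_derivative \<gamma>3 s) (at s)) \<and>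
        continuous_on UNIV \<gamma>3 \<and>
        (\<forall>s. norm (\<gamma>1 s) > 0))"

text \<open>
  The kernel is square integrable when \<open>\<gamma>\<close> satisfies \<open>C3_closed_curve\<close>, and then the function
  under \<open>abs_L2\<close> is square integrable and its class does not depend on the representative
  \<open>rep_L2 \<Psi>\<close>. The convention \<open>ln 0 = 0\<close> only affects the null set where
  \<open>\<gamma> t = \<gamma> s\<close>.
\<close>

definition symm_op :: "(real \<Rightarrow> real \<times> real) \<Rightarrow> L2 \<Rightarrow> L2" where
  "symm_op \<gamma> \<Psi> = abs_L2 (\<lambda>t. - (1 / complex_of_real pi) *
     (\<integral>s. rep_L2 \<Psi> s * complex_of_real (ln (norm (\<gamma> t - \<gamma> s))) \<partial>period_measure))"

definition fourier_basis :: "int \<Rightarrow> L2" where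
  "fourier_basis k = abs_L2 (\<lambda>t. exp (\<i> * of_int k * complex_of_real t))"

definition Y_DLS :: "nat \<Rightarrow> L2 set" where
  "Y_DLS n = cspan (fourier_basis ` {- int n..int n})"

definition X_DLS :: "(real \<Rightarrow> real \<times> real) \<Rightarrow> nat \<Rightarrow> L2 set" where
  "X_DLS \<gamma> n = symm_op \<gamma> ` Y_DLS n"

text \<open>
  The operator from \<open>X_DLS \<gamma> n\<close> to \<open>Y_DLS n\<close> is the restriction of \<open>K_DLS \<gamma> n\<close>, so its
  inverse is \<open>inv_into (X_DLS \<gamma> n) (K_DLS \<gamma> n)\<close>. Since the Symm operator is self-adjoint,
  \<open>X_DLS \<gamma> n\<close> is also the image of \<open>Y_DLS n\<close> under its adjoint.
\<close>

definition K_DLS :: "(real \<Rightarrow> real \<times> real) \<Rightarrow> nat \<Rightarrow> L2 \<Rightarrow> L2" where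
  "K_DLS \<gamma> n f = orth_proj (Y_DLS n) (symm_op \<gamma> (orth_proj (X_DLS \<gamma> n) f))"

end

theory Submission
  imports Defs
begin

text \<open>
  Let \<open>K\<close> be the Symm operator and \<open>Y\<^sub>n\<close> the trigonometric polynomials of degree at most
  \<open>n\<close>. The error of the dual least squares method is at most the distance of the solution from
  \<open>K Y\<^sub>n\<close> plus \<open>\<delta>\<close> times the norm of the inverse of \<open>K\<close> on \<open>K Y\<^sub>n\<close>, so everything
  rests on the stability estimate \<open>\<parallel>y\<parallel> \<le> c n \<parallel>K y\<parallel>\<close> on \<open>Y\<^sub>n\<close>.

  By Frullani's integral, \<open>- ln r\<close> is the integral of \<open>(exp (- x r\<^sup>2) - exp (- x)) / (2 x)\<close> over
  \<open>x > 0\<close>. Hence the logarithmic energy of a signed measure of total mass \<open>0\<close> is a superposition of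
  nonnegative Gaussian energies, and for a density of degree \<open>n\<close> on the curve those with \<open>x\<close> of order
  \<open>n\<^sup>2\<close> already contribute a multiple of \<open>\<parallel>y\<parallel>\<^sup>2 / n\<close>.

  Total mass \<open>0\<close> is reached by subtracting a uniform measure of the same mass \<open>m\<close> on the unit circle
  about \<open>z0\<close>, whose potential is a multiple of \<open>max 0 (ln \<bar>x - z0\<bar>)\<close>. If the curve lies inside this
  circle, the energy is still \<open>\<pi> \<langle>K y, y\<rangle>\<close>. If it lies outside, the energy changes by
  \<open>2 m\<close> times the potential of \<open>y\<close> at \<open>z0\<close>, and by the maximum principle with a barrier built
  from exterior tangent discs this is bounded by the norm of the boundary values, that is of \<open>K y\<close>.
\<close>

section \<open>Integrals of periodic functions\<close>

text \<open>Energies are estimated instead of \<open>symm_op\<close> itself because the form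
  \<langle>K y, y\<rangle> need not be positive: a curve enclosing the closed unit disc about
  \<open>z0\<close> has logarithmic capacity above 1, and the form is negative at its equilibrium
  density. The condition on \<open>z0\<close> and connectedness of the curve leave only the two
  positions relative to that circle, and compactness keeps a gap \<open>d\<close> between them, so
  their interaction is exponentially small in the Gaussian parameter x. A Gaussian of parameter x
  has width 1/sqrt x. At x = A n^2 with A large, a density of degree n hardly varies over this
  width, so the form is comparable to \<parallel>y\<parallel>^2/sqrt x; and [a, 2 a] has the same
  mass under dx/x for every a. Hence just one power of n is lost, and dividing c
  \<parallel>y\<parallel>^2/n \<le> C \<parallel>y\<parallel> \<parallel>K y\<parallel> by
  \<parallel>y\<parallel> gives stability. The mean value properties behind the maximum principle
  come from one device: circle averages are compatible with squaring the variable.\<close>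

lemma integrable_period_iff:
  fixes f :: "real \<Rightarrow> 'b::{banach, second_countable_topology}"
  shows "integrable period_measure f \<longleftrightarrow> set_integrable lborel {0..2 * pi} f"
  by (simp add: integrable_restrict_space set_integrable_def)

lemma integral_period_eq:
  fixes f :: "real \<Rightarrow> 'b::{banach, second_countable_topology}"
  shows "(\<integral>x. f x \<partial>period_measure) = (LINT x:{0..2 * pi}|lborel. f x)"
  by (simp add: integral_restrict_space set_lebesgue_integral_def)

lemma space_period [simp]: "space period_measure = {0..2 * pi}"
  by (simp add: space_restrict_space)

lemma measure_period [simp]: "measure period_measure {0..2 * pi} = 2 * pi"
  by (simp add: measure_restrict_space)

interpretation period: finite_measure period_measure
  by (rule finite_measureI) (simp add: emeasure_restrict_space)

interpretation period_pair: pair_sigma_finite period_measure period_measure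
  by (intro pair_sigma_finite.intro; unfold_locales)

lemma borel_measurable_period [measurable_dest]:
  fixes f :: "real \<Rightarrow> 'b::topological_space"
  shows "f \<in> borel_measurable borel \<Longrightarrow> f \<in> borel_measurable period_measure"
  by (simp add: measurable_restrict_space1)

lemma periodic_int:
  fixes f :: "real \<Rightarrow> 'b"
  assumes per: "\<And>x. f (x + 2 * pi) = f x"
  shows "f (x + 2 * pi * of_int k) = f x"
proof -
  have nat: "f (x + 2 * pi * of_nat n) = f x" for n x
  proof (induction n)
    case (Suc n)
    have "f (x + 2 * pi * of_nat (Suc n)) = f ((x + 2 * pi * of_nat n) + 2 * pi)"
      by (simp add: algebra_simps)
    then show ?case using Suc per by simp
  qed simp
  show ?thesis
  proof (cases "0 \<le> k")
    case True then show ?thesis using nat[of x "nat k"] by simp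
  next
    case False
    have "x + 2 * pi * of_int k + 2 * pi * of_nat (nat (- k)) = x"
      using False by (simp add: algebra_simps)
    then show ?thesis using nat[of "x + 2 * pi * of_int k" "nat (- k)"] by metis
  qed
qed

lemma shift_into_period:
  fixes s a :: real
  obtains k :: int where "s + 2 * pi * of_int k \<in> {a..<a + 2 * pi}"
proof -
  define k where "k = \<lfloor>(s - a) / (2 * pi)\<rfloor>"
  have "of_int k \<le> (s - a) / (2 * pi)" "(s - a) / (2 * pi) < of_int k + 1"
    unfolding k_def by (rule of_int_floor_le, rule real_of_int_floor_add_one_gt)
  then have "s + 2 * pi * of_int (- k) \<in> {a..<a + 2 * pi}"
    using pi_gt_zero by (simp add: field_simps)
  then show ?thesis using that by blast
qed

text \<open>Half-open intervals tile the line under translations by the period, while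
  \<open>period_measure\<close> lives on the closed one. The integrands differ at \<open>b\<close>
  alone, but \<open>lborel\<close> is not complete, so measurability is carried across by adding or
  removing the indicator of that point; the condition \<open>a \<le> b\<close> covers the case of
  two empty intervals.\<close>

lemma has_bochner_integral_half_open:
  fixes f :: "real \<Rightarrow> 'b::{banach, second_countable_topology}"
  shows "has_bochner_integral lborel (\<lambda>x. indicator {a..<b} x *\<^sub>R f x) I \<longleftrightarrow>
    has_bochner_integral lborel (\<lambda>x. indicator {a..b} x *\<^sub>R f x) I"
proof -
  let ?F = "\<lambda>x. indicator {a..<b} x *\<^sub>R f x" and ?G = "\<lambda>x. indicator {a..b} x *\<^sub>R f x"
  have "?G = (\<lambda>x. ?F x + indicator {x. x = b \<and> a \<le> b} x *\<^sub>R f b)"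
    by (auto simp: indicator_def fun_eq_iff)
  then have m1: "?G \<in> borel_measurable lborel" if "?F \<in> borel_measurable lborel"
    using that by simp
  have "?F = (\<lambda>x. ?G x - indicator {x. x = b \<and> a \<le> b} x *\<^sub>R f b)"
    by (auto simp: indicator_def fun_eq_iff)
  then have m2: "?F \<in> borel_measurable lborel" if "?G \<in> borel_measurable lborel"
    using that by simp
  have ae: "AE x in lborel. ?F x = ?G x"
    using AE_lborel_singleton[of b] by eventually_elim (auto simp: indicator_def)
  show ?thesis
  proof
    assume L: "has_bochner_integral lborel ?F I"
    then show "has_bochner_integral lborel ?G I"
      using m1[OF borel_measurable_has_bochner_integral[OF L]] ae
      by (subst has_bochner_integral_cong_AE[symmetric, where f = ?F])
        (auto intro: borel_measurable_has_bochner_integral)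
  next
    assume L: "has_bochner_integral lborel ?G I"
    then show "has_bochner_integral lborel ?F I"
      using m2[OF borel_measurable_has_bochner_integral[OF L]] ae
      by (subst has_bochner_integral_cong_AE[where g = ?G])
        (auto intro: borel_measurable_has_bochner_integral)
  qed
qed

lemma has_bochner_integral_period_iff:
  fixes f :: "real \<Rightarrow> 'b::{banach, second_countable_topology}"
  shows "has_bochner_integral period_measure f I \<longleftrightarrow>
    has_bochner_integral lborel (\<lambda>x. indicator {0..<2 * pi} x *\<^sub>R f x) I"
  unfolding has_bochner_integral_half_open
  by (simp add: has_bochner_integral_iff integrable_restrict_space integral_restrict_space)

text \<open>Modulo the period the shift is some \<open>b\<close> in [0, 2 pi). Cutting the period at
  \<open>b\<close> and moving the piece [0, b) up by one period yields [b, b + 2 pi), and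
  translation by \<open>k\<close> whole periods reaches [a, a + 2 pi).\<close>

lemma has_bochner_integral_periodic_shift:
  fixes f :: "real \<Rightarrow> 'b::{banach, second_countable_topology}"
  assumes per: "\<And>x. f (x + 2 * pi) = f x"
    and f: "has_bochner_integral period_measure f I"
  shows "has_bochner_integral period_measure (\<lambda>x. f (a + x)) I"
proof -
  obtain k' where k': "a + 2 * pi * of_int k' \<in> {0..<0 + 2 * pi}" by (rule shift_into_period)
  define k where "k = - k'"
  define b where "b = a - 2 * pi * of_int k"
  let ?F = "\<lambda>c d x. indicator {c..<d::real} x *\<^sub>R f x"
  have b: "0 \<le> b" "b \<le> 2 * pi" using k' by (simp_all add: b_def k_def)
  have shift: "has_bochner_integral lborel (?F (c + 2 * pi * of_int j) (d + 2 * pi * of_int j)) J"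
    if "has_bochner_integral lborel (?F c d) J" for c d j J
    using that by (subst lborel_has_bochner_integral_real_affine_iff[where c = 1 and t = "2 * pi * of_int j"])
      (simp_all add: indicator_def add.commute periodic_int[of f, OF per] if_distrib cong: if_cong)
  have f0: "has_bochner_integral lborel (?F 0 (2 * pi)) I"
    using f by (simp add: has_bochner_integral_period_iff)
  have eq: "(\<lambda>x. indicator {0..<b} x *\<^sub>R ?F 0 (2 * pi) x) = ?F 0 b"
    "(\<lambda>x. indicator {b..<2 * pi} x *\<^sub>R ?F 0 (2 * pi) x) = ?F b (2 * pi)"
    using b by (auto simp: fun_eq_iff indicator_def)
  have "integrable lborel (\<lambda>x. indicator {0..<b} x *\<^sub>R ?F 0 (2 * pi) x)"
    "integrable lborel (\<lambda>x. indicator {b..<2 * pi} x *\<^sub>R ?F 0 (2 * pi) x)"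
    using f0 by (auto simp: has_bochner_integral_iff intro!: integrable_mult_indicator simp del: scaleR_scaleR)
  then have "integrable lborel (?F 0 b)" "integrable lborel (?F b (2 * pi))"
    unfolding eq .
  then obtain J1 J2 where J: "has_bochner_integral lborel (?F 0 b) J1"
    "has_bochner_integral lborel (?F b (2 * pi)) J2"
    using has_bochner_integral_integrable by blast
  have eq: "(\<lambda>x. ?F b (2 * pi) x + ?F 0 b x) = ?F 0 (2 * pi)"
    using b by (auto simp: fun_eq_iff indicator_def)
  have I: "I = J2 + J1"
    using has_bochner_integral_add[OF J(2,1)] unfolding eq by (rule has_bochner_integral_eq[OF f0])
  have eq: "(\<lambda>x. ?F b (2 * pi) x + ?F (0 + 2 * pi * of_int 1) (b + 2 * pi * of_int 1) x) = ?F b (b + 2 * pi)"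
    using b by (auto simp: fun_eq_iff indicator_def)
  have "has_bochner_integral lborel (?F b (b + 2 * pi)) I"
    using has_bochner_integral_add[OF J(2) shift[OF J(1), of 1]] unfolding eq I .
  from shift[OF this, of k] have "has_bochner_integral lborel (?F a (a + 2 * pi)) I"
    by (simp add: b_def algebra_simps)
  then show ?thesis
    by (subst (asm) lborel_has_bochner_integral_real_affine_iff[where c = 1 and t = a])
      (simp_all add: has_bochner_integral_period_iff indicator_def if_distrib cong: if_cong)
qed

lemma periodic_shift:
  fixes f :: "real \<Rightarrow> 'b::{banach, second_countable_topology}"
  assumes "\<And>x. f (x + 2 * pi) = f x" and "integrable period_measure f"
  shows "integrable period_measure (\<lambda>x. f (a + x))"
    and "(\<integral>x. f (a + x) \<partial>period_measure) = (\<integral>x. f x \<partial>period_measure)"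
  using has_bochner_integral_periodic_shift[OF assms(1) has_bochner_integral_integrable[OF assms(2)]]
  by (auto simp: has_bochner_integral_iff)

text \<open>The period integral is doubled on [0, 4 pi) and halved by the substitution. Together
  with the shift by pi this makes circle averages compatible with squaring the point on the
  circle.\<close>

lemma periodic_double:
  fixes f :: "real \<Rightarrow> 'b::{banach, second_countable_topology}"
  assumes per: "\<And>x. f (x + 2 * pi) = f x" and f: "integrable period_measure f"
  shows "has_bochner_integral period_measure (\<lambda>x. f (2 * x)) (\<integral>x. f x \<partial>period_measure)"
proof -
  let ?I = "\<integral>x. f x \<partial>period_measure"
  let ?F = "\<lambda>c d x. indicator {c..<d::real} x *\<^sub>R f x"
  have "has_bochner_integral lborel (?F 0 (2 * pi)) ?I"
    using has_bochner_integral_integrable[OF f] by (simp add: has_bochner_integral_period_iff)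
  moreover from this have "has_bochner_integral lborel (?F (2 * pi) (4 * pi)) ?I"
    by (subst lborel_has_bochner_integral_real_affine_iff[where c = 1 and t = "2 * pi"])
      (simp_all add: indicator_def add.commute per if_distrib cong: if_cong)
  ultimately have "has_bochner_integral lborel (\<lambda>x. ?F 0 (2 * pi) x + ?F (2 * pi) (4 * pi) x) (?I + ?I)"
    by (rule has_bochner_integral_add)
  also have "(\<lambda>x. ?F 0 (2 * pi) x + ?F (2 * pi) (4 * pi) x) = ?F 0 (4 * pi)"
    using pi_gt_zero by (auto simp: fun_eq_iff indicator_def)
  finally have "has_bochner_integral lborel (?F 0 (4 * pi)) (?I + ?I)" .
  then have "has_bochner_integral lborel (\<lambda>x. ?F 0 (4 * pi) (0 + 2 * x)) ((?I + ?I) /\<^sub>R \<bar>2\<bar>)"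
    by (subst (asm) lborel_has_bochner_integral_real_affine_iff[where c = 2 and t = 0]) simp_all
  moreover have "(?I + ?I) /\<^sub>R \<bar>2\<bar> = ?I"
    by (simp add: scaleR_2[symmetric])
  moreover have "(\<lambda>x. ?F 0 (4 * pi) (0 + 2 * x)) = (\<lambda>x. indicator {0..<2 * pi} x *\<^sub>R f (2 * x))"
    by (auto simp: fun_eq_iff indicator_def)
  ultimately show ?thesis by (simp add: has_bochner_integral_period_iff)
qed

section \<open>Logarithmic potentials of bi-Lipschitz loops\<close>

text \<open>The offset \<open>h\<close> of at most half a period measures parameter distance around
  the loop, so the two ends of the period count as close. Only the lower bound is built in;
  Lipschitz bounds are assumed separately where they enter.\<close>

locale bilipschitz_loop =
  fixes g :: "real \<Rightarrow> complex" and l :: real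
  assumes per: "g (s + 2 * pi) = g s"
    and cont: "continuous_on UNIV g"
    and l_pos: "0 < l"
    and low: "s \<in> {0..2 * pi} \<Longrightarrow> \<bar>h\<bar> \<le> pi \<Longrightarrow> l * \<bar>h\<bar> \<le> cmod (g (s + h) - g s)"
begin

lemma g_measurable [measurable]: "g \<in> borel_measurable borel"
  using cont by (rule borel_measurable_continuous_onI)

lemma reduce_period: obtains s' where "s' \<in> {0..<2 * pi}" "g s' = g s"
proof -
  obtain k where "s + 2 * pi * of_int k \<in> {0..<0 + 2 * pi}" by (rule shift_into_period)
  then show ?thesis using periodic_int[of g, OF per] that by simp
qed

text \<open>Two parameters with the same image at distance at most pi coincide by
  \<open>low\<close>, so each half of the period holds at most one preimage.\<close>

lemma finite_level: "finite {s \<in> {0..2 * pi}. g s = x}"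
proof -
  have uniq: "s = t" if "s \<in> {0..2 * pi}" "g s = x" "g t = x" "\<bar>t - s\<bar> \<le> pi" for s t
    using low[OF that(1,4)] that l_pos by (simp add: mult_le_0_iff)
  have fin: "finite {s \<in> I. g s = x}" if "I = {0..pi} \<or> I = {pi..2 * pi}" for I
  proof (cases "{s \<in> I. g s = x} = {}")
    case False
    then obtain s where s: "s \<in> I" "g s = x" by blast
    have "{s \<in> I. g s = x} \<subseteq> {s}"
    proof
      fix t assume "t \<in> {s \<in> I. g s = x}"
      then have "s = t" using s that by (intro uniq) (auto simp: abs_le_iff)
      then show "t \<in> {s}" by simp
    qed
    then show ?thesis by (rule finite_subset) simp
  qed (metis finite.emptyI)
  have "{s \<in> {0..2 * pi}. g s = x} \<subseteq> {s \<in> {0..pi}. g s = x} \<union> {s \<in> {pi..2 * pi}. g s = x}"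
    by auto
  then show ?thesis
    by (rule finite_subset) (rule finite_UnI[OF fin[OF disjI1[OF refl]] fin[OF disjI2[OF refl]]])
qed

lemma AE_neq: "AE s in period_measure. g s \<noteq> x"
proof (rule AE_I')
  have "emeasure period_measure {s \<in> {0..2 * pi}. g s = x} = emeasure lborel {s \<in> {0..2 * pi}. g s = x}"
    by (rule emeasure_restrict_space) auto
  also have "\<dots> = 0"
    using finite_level[of x] by (intro emeasure_lborel_countable countable_finite)
  finally show "{s \<in> {0..2 * pi}. g s = x} \<in> null_sets period_measure"
    by (intro null_setsI) (auto simp: sets_restrict_space)
qed auto

text \<open>Extends the lower bound of the locale to points \<open>x\<close> off the curve: if
  \<open>g s\<close> is nearest to \<open>x\<close>, the distance from \<open>g s\<close> to
  \<open>g (s + h)\<close> is at most twice that from \<open>x\<close> to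
  \<open>g (s + h)\<close>.\<close>

lemma nearest_point:
  obtains s where "s \<in> {0..2 * pi}" "\<And>h. \<bar>h\<bar> \<le> pi \<Longrightarrow> l / 2 * \<bar>h\<bar> \<le> cmod (x - g (s + h))"
proof -
  obtain s where s: "s \<in> {0..2 * pi}" "\<forall>t \<in> {0..2 * pi}. cmod (x - g s) \<le> cmod (x - g t)"
  proof -
    have "continuous_on {0..2 * pi} (\<lambda>s. cmod (x - g s))"
      by (intro continuous_intros continuous_on_subset[OF cont]) simp
    then show ?thesis
      using continuous_attains_inf[of "{0..2 * pi}" "\<lambda>s. cmod (x - g s)"] that by auto
  qed
  have "l / 2 * \<bar>h\<bar> \<le> cmod (x - g (s + h))" if "\<bar>h\<bar> \<le> pi" for h
  proof -
    obtain t where t: "t \<in> {0..<2 * pi}" "g t = g (s + h)" by (rule reduce_period)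
    have "l * \<bar>h\<bar> \<le> cmod (g (s + h) - g s)" using low s(1) that by blast
    also have "\<dots> \<le> cmod (x - g s) + cmod (x - g (s + h))"
      using norm_triangle_ineq4[of "x - g s" "x - g (s + h)"] by simp
    also have "\<dots> \<le> 2 * cmod (x - g (s + h))"
      using s(2)[rule_format, of t] t by simp
    finally show ?thesis by simp
  qed
  with s(1) show ?thesis using that by blast
qed

text \<open>The bound is uniform in \<open>x\<close>: a periodic shift puts the parameter nearest to
  \<open>x\<close> at pi, and there \<open>nearest_point\<close> dominates the integrand by one
  fixed function. The power -1/2 is integrable and still dominates squared logarithms.\<close>

lemma inverse_sqrt_dist_bounded:
  obtains C where "0 < C"
    "\<And>x. integrable period_measure (\<lambda>s. cmod (x - g s) powr (- 1 / 2))"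
    "\<And>x. (\<integral>s. cmod (x - g s) powr (- 1 / 2) \<partial>period_measure) \<le> C"
proof -
  define F0 where "F0 = (\<lambda>h::real. indicator {0..pi} h * h powr (- 1 / 2))"
  \<comment> \<open>This is (l/2 |y - pi|)^(-1/2) away from y = pi, split because \<open>F0\<close>
    is supported on [0, pi].\<close>
  define \<Phi> where "\<Phi> = (\<lambda>y. (l / 2) powr (- 1 / 2) * (F0 (y - pi) + F0 (pi - y)))"
  have "(\<lambda>h::real. h powr (- 1 / 2)) integrable_on {0..pi}"
    by (rule integrable_on_powr_from_0) auto
  then obtain I where "((\<lambda>h::real. h powr (- 1 / 2)) has_integral I) {0..pi}" by blast
  then have "integral\<^sup>N lborel (\<lambda>h. ennreal (indicator {0..pi} h * h powr (- 1 / 2))) = ennreal I"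
  proof (intro nn_integral_has_integral_lborel)
    have "(\<lambda>h::real. indicator {0..pi} h * h powr (- 1 / 2)) =
        (\<lambda>h. if h \<in> {0..pi} then h powr (- 1 / 2) else 0)"
      by (auto simp: fun_eq_iff indicator_def)
    moreover assume "((\<lambda>h::real. h powr (- 1 / 2)) has_integral I) {0..pi}"
    ultimately show "((\<lambda>h::real. indicator {0..pi} h * h powr (- 1 / 2)) has_integral I) UNIV"
      by (simp only: has_integral_restrict_UNIV)
  qed auto
  then have F0: "integrable lborel F0"
    by (intro integrableI_nonneg) (auto simp: F0_def indicator_def)
  have "integrable lborel \<Phi>"
    using lborel_integrable_real_affine[OF F0, of 1 "- pi"]
      lborel_integrable_real_affine[OF F0, of "- 1" pi]
    by (simp add: \<Phi>_def)
  then have \<Phi>: "integrable period_measure \<Phi>"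
    by (simp add: integrable_restrict_space integrable_mult_indicator del: real_scaleR_def)
  have \<Phi>0: "0 \<le> \<Phi> y" for y
    by (auto simp: \<Phi>_def F0_def indicator_def)
  show ?thesis
  proof
    show "0 < (\<integral>y. \<Phi> y \<partial>period_measure) + 1"
      using \<Phi>0 by (simp add: add_nonneg_pos integral_nonneg)
    fix x
    let ?F = "\<lambda>s. cmod (x - g s) powr (- 1 / 2)"
    obtain s where s: "s \<in> {0..2 * pi}" "\<And>h. \<bar>h\<bar> \<le> pi \<Longrightarrow> l / 2 * \<bar>h\<bar> \<le> cmod (x - g (s + h))"
      by (rule nearest_point[of x]) (rule that)
    have perF: "?F (s + 2 * pi) = ?F s" for s by (simp add: per)
    have "AE y in period_measure. y \<noteq> pi"
      using AE_lborel_singleton[of pi] by (auto simp: AE_restrict_space_iff elim: eventually_mono)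
    then have le: "AE y in period_measure. ?F (s - pi + y) \<le> \<Phi> y"
      using AE_space
    proof eventually_elim
      case (elim y)
      have "l / 2 * \<bar>y - pi\<bar> \<le> cmod (x - g (s - pi + y))"
        using s(2)[of "y - pi"] elim by (simp add: algebra_simps abs_le_iff)
      then have "?F (s - pi + y) \<le> (l / 2 * \<bar>y - pi\<bar>) powr (- 1 / 2)"
        using l_pos elim by (intro powr_mono2') auto
      also have "\<dots> = (l / 2) powr (- 1 / 2) * \<bar>y - pi\<bar> powr (- 1 / 2)"
        using l_pos by (intro powr_mult) 
      also have "\<bar>y - pi\<bar> powr (- 1 / 2) = F0 (y - pi) + F0 (pi - y)"
        using elim by (auto simp: F0_def indicator_def abs_if)
      finally show ?case by (simp add: \<Phi>_def)
    qed
    have *: "integrable period_measure (\<lambda>y. ?F (s - pi + y))"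
      using \<Phi> by (rule Bochner_Integration.integrable_bound) (use le \<Phi>0 in auto)
    have "integrable period_measure (\<lambda>y. ?F (s - pi + (- (s - pi) + y)))"
      using perF[of "s - pi + _"] by (intro periodic_shift(1)[OF _ *]) (simp add: add.assoc)
    then show F: "integrable period_measure ?F" by simp
    have "(\<integral>y. ?F y \<partial>period_measure) = (\<integral>y. ?F (s - pi + y) \<partial>period_measure)"
      by (rule periodic_shift(2)[OF perF F, symmetric])
    also have "\<dots> \<le> (\<integral>y. \<Phi> y \<partial>period_measure)"
      using * \<Phi> le by (rule integral_mono_AE)
    finally show "(\<integral>s. ?F s \<partial>period_measure) \<le> (\<integral>y. \<Phi> y \<partial>period_measure) + 1" by simp
  qed
qed

end

text \<open>The inequality ln u \<le> u is applied to u = r^(-1/4) and the result squared.\<close>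

lemma ln_square_le_powr:
  assumes "0 < r" "r \<le> (1::real)"
  shows "(ln r)\<^sup>2 \<le> 16 * r powr (- 1 / 2)"
proof -
  have "ln (r powr (- 1 / 4)) \<le> r powr (- 1 / 4)"
    using assms by (intro less_imp_le ln_less_self) simp
  then have "- ln r \<le> 4 * r powr (- 1 / 4)"
    using assms by (simp add: ln_powr)
  then have "(- ln r)\<^sup>2 \<le> (4 * r powr (- 1 / 4))\<^sup>2"
    using assms by (intro power_mono) auto
  also have "\<dots> = 16 * r powr (- 1 / 2)"
    using assms by (simp add: power2_eq_square powr_add[symmetric])
  finally show ?thesis by simp
qed

text \<open>The weight \<open>t\<close> is chosen in \<open>continuous_logpot\<close> so that both
  summands carry the same power of the cut-off.\<close>

lemma mult_le_weighted_squares: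
  fixes a b t :: real
  assumes "0 < t"
  shows "\<bar>a\<bar> * \<bar>b\<bar> \<le> t * a\<^sup>2 + b\<^sup>2 / t"
proof -
  have "0 \<le> (t * \<bar>a\<bar> - \<bar>b\<bar>)\<^sup>2" by simp
  then have "2 * t * (\<bar>a\<bar> * \<bar>b\<bar>) \<le> t * (t * a\<^sup>2) + b\<^sup>2"
    by (simp add: power2_diff power_mult_distrib algebra_simps power2_eq_square)
  moreover have "0 \<le> t * (\<bar>a\<bar> * \<bar>b\<bar>)"
    using assms by simp
  ultimately have "t * (\<bar>a\<bar> * \<bar>b\<bar>) \<le> t * (t * a\<^sup>2) + b\<^sup>2" by linarith
  also have "\<dots> = t * (t * a\<^sup>2 + b\<^sup>2 / t)"
    using assms by (simp add: distrib_left)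
  finally show ?thesis using assms by simp
qed

lemma square_integrable_scaleR:
  fixes f :: "'a \<Rightarrow> real" and \<psi> :: "'a \<Rightarrow> 'b::{banach, second_countable_topology}"
  assumes "f \<in> borel_measurable M" "integrable M (\<lambda>s. (f s)\<^sup>2)"
    and "\<psi> \<in> borel_measurable M" "integrable M (\<lambda>s. (norm (\<psi> s))\<^sup>2)"
  shows "integrable M (\<lambda>s. f s *\<^sub>R \<psi> s)"
proof (rule Bochner_Integration.integrable_bound)
  show "integrable M (\<lambda>s. (f s)\<^sup>2 + (norm (\<psi> s))\<^sup>2)" using assms by simp
  show "(\<lambda>s. f s *\<^sub>R \<psi> s) \<in> borel_measurable M" using assms by simp
  have "norm (f s *\<^sub>R \<psi> s) \<le> norm ((f s)\<^sup>2 + (norm (\<psi> s))\<^sup>2)" for s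
    using mult_le_weighted_squares[of 1 "f s" "norm (\<psi> s)"] by simp
  then show "AE s in M. norm (f s *\<^sub>R \<psi> s) \<le> norm ((f s)\<^sup>2 + (norm (\<psi> s))\<^sup>2)" by simp
qed

lemma norm_integral_le:
  fixes f :: "'a \<Rightarrow> 'b::{banach, second_countable_topology}"
  assumes "integrable M f" "integrable M h" "AE x in M. norm (f x) \<le> h x"
  shows "norm (\<integral>x. f x \<partial>M) \<le> (\<integral>x. h x \<partial>M)"
proof -
  have "norm (\<integral>x. f x \<partial>M) \<le> (\<integral>x. norm (f x) \<partial>M)" by (rule integral_norm_bound)
  also have "\<dots> \<le> (\<integral>x. h x \<partial>M)"
    using assms by (intro integral_mono_AE) auto
  finally show ?thesis .
qed

section \<open>The logarithmic potential of a square integrable density: existence and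
  continuity\<close>

context bilipschitz_loop
begin

lemma g_bounded: obtains R where "0 < R" "\<And>s. cmod (g s) \<le> R"
proof -
  have "compact (g ` {0..2 * pi})"
    by (intro compact_continuous_image continuous_on_subset[OF cont]) auto
  then obtain R where R: "0 < R" "\<forall>x \<in> g ` {0..2 * pi}. cmod x \<le> R"
    using compact_imp_bounded bounded_pos by blast
  have "cmod (g s) \<le> R" for s
  proof -
    obtain s' where "s' \<in> {0..<2 * pi}" "g s' = g s" by (rule reduce_period)
    then show ?thesis using R(2) by (metis atLeastLessThan_iff atLeastAtMost_iff image_eqI less_imp_le)
  qed
  with R(1) that show ?thesis by blast
qed

text \<open>Up to distance 1 the square is dominated by the inverse square root, beyond it by the
  squared logarithm of an upper bound for the distance; at distance 0 the convention
  \<open>ln 0 = 0\<close> makes it vanish.\<close>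

lemma ln_square_bounded:
  obtains C where "\<And>x. cmod x \<le> R \<Longrightarrow> integrable period_measure (\<lambda>s. (ln (cmod (x - g s)))\<^sup>2)"
    "\<And>x. cmod x \<le> R \<Longrightarrow> (\<integral>s. (ln (cmod (x - g s)))\<^sup>2 \<partial>period_measure) \<le> C"
proof -
  obtain C where C: "0 < C" "\<And>x. integrable period_measure (\<lambda>s. cmod (x - g s) powr (- 1 / 2))"
    "\<And>x. (\<integral>s. cmod (x - g s) powr (- 1 / 2) \<partial>period_measure) \<le> C"
    by (rule inverse_sqrt_dist_bounded) blast
  obtain R' where R': "0 < R'" "\<And>s. cmod (g s) \<le> R'" by (rule g_bounded) blast
  have *: "integrable period_measure (\<lambda>s. (ln (cmod (x - g s)))\<^sup>2) \<and>
    (\<integral>s. (ln (cmod (x - g s)))\<^sup>2 \<partial>period_measure) \<le> 16 * C + 2 * pi * (ln (\<bar>R\<bar> + R' + 1))\<^sup>2"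
    if "cmod x \<le> R" for x
  proof
    let ?b = "\<lambda>s. 16 * cmod (x - g s) powr (- 1 / 2) + (ln (\<bar>R\<bar> + R' + 1))\<^sup>2"
    have le: "(ln (cmod (x - g s)))\<^sup>2 \<le> ?b s" for s
    proof -
      have r: "cmod (x - g s) \<le> \<bar>R\<bar> + R' + 1"
        using norm_triangle_ineq4[of x "g s"] R'(2)[of s] that by linarith
      consider "cmod (x - g s) = 0" | "0 < cmod (x - g s)" "cmod (x - g s) \<le> 1" | "1 < cmod (x - g s)"
        by fastforce
      then show ?thesis
      proof cases
        case 2
        then show ?thesis using ln_square_le_powr[of "cmod (x - g s)"] by (simp add: add_increasing2)
      next
        case 3
        then have "(ln (cmod (x - g s)))\<^sup>2 \<le> (ln (\<bar>R\<bar> + R' + 1))\<^sup>2"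
          using r R'(1) by (intro power_mono) (auto intro!: ln_mono)
        then show ?thesis by (simp add: add_increasing)
      qed simp
    qed
    have int: "integrable period_measure ?b" using C(2)[of x] by simp
    show i: "integrable period_measure (\<lambda>s. (ln (cmod (x - g s)))\<^sup>2)"
      using int by (rule Bochner_Integration.integrable_bound) (use le in \<open>auto intro!: AE_I2 order_trans[OF le]\<close>)
    have "(\<integral>s. (ln (cmod (x - g s)))\<^sup>2 \<partial>period_measure) \<le> (\<integral>s. ?b s \<partial>period_measure)"
      using i int le by (intro integral_mono) auto
    also have "\<dots> = 16 * (\<integral>s. cmod (x - g s) powr (- 1 / 2) \<partial>period_measure) + 2 * pi * (ln (\<bar>R\<bar> + R' + 1))\<^sup>2"
      using C(2)[of x] by simp
    finally show "(\<integral>s. (ln (cmod (x - g s)))\<^sup>2 \<partial>period_measure) \<le> 16 * C + 2 * pi * (ln (\<bar>R\<bar> + R' + 1))\<^sup>2"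
      using C(3)[of x] by linarith
  qed
  show ?thesis using * that by blast
qed

lemma ln_square_integrable: "integrable period_measure (\<lambda>s. (ln (cmod (x - g s)))\<^sup>2)"
proof -
  obtain C where "\<And>y. cmod y \<le> cmod x \<Longrightarrow> integrable period_measure (\<lambda>s. (ln (cmod (y - g s)))\<^sup>2)"
    by (rule ln_square_bounded[of "cmod x"]) (rule that)
  then show ?thesis by simp
qed

definition logpot :: "(real \<Rightarrow> 'b::{banach, second_countable_topology}) \<Rightarrow> complex \<Rightarrow> 'b" where
  "logpot \<psi> x = (\<integral>s. ln (cmod (x - g s)) *\<^sub>R \<psi> s \<partial>period_measure)"

lemma integrable_logpot:
  fixes \<psi> :: "real \<Rightarrow> 'b::{banach, second_countable_topology}"
  assumes "\<psi> \<in> borel_measurable period_measure" "integrable period_measure (\<lambda>s. (norm (\<psi> s))\<^sup>2)"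
  shows "integrable period_measure (\<lambda>s. ln (cmod (x - g s)) *\<^sub>R \<psi> s)"
  by (rule square_integrable_scaleR) (use assms ln_square_integrable in auto)

lemma square_integrable_imp_integrable:
  fixes \<psi> :: "real \<Rightarrow> 'b::{banach, second_countable_topology}"
  assumes "\<psi> \<in> borel_measurable period_measure" "integrable period_measure (\<lambda>s. (norm (\<psi> s))\<^sup>2)"
  shows "integrable period_measure \<psi>"
  using square_integrable_scaleR[of "\<lambda>_. 1" period_measure \<psi>] assms by simp

text \<open>Replacing the distance by its maximum with \<epsilon> changes the potential by at most K
  \<epsilon>^(1/4) uniformly in \<open>x\<close>, and the truncated potential is Lipschitz with
  constant N1/\<epsilon>. So \<open>logpot \<psi>\<close> is a uniform limit of continuous
  functions.\<close>

lemma continuous_logpot: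
  fixes \<psi> :: "real \<Rightarrow> 'b::{banach, second_countable_topology}"
  assumes [measurable]: "\<psi> \<in> borel_measurable period_measure"
    and sq: "integrable period_measure (\<lambda>s. (norm (\<psi> s))\<^sup>2)"
  shows "continuous_on UNIV (logpot \<psi>)"
proof -
  obtain C where C: "0 < C" "\<And>x. integrable period_measure (\<lambda>s. cmod (x - g s) powr (- 1 / 2))"
    "\<And>x. (\<integral>s. cmod (x - g s) powr (- 1 / 2) \<partial>period_measure) \<le> C"
    by (rule inverse_sqrt_dist_bounded) blast
  define N where "N = (\<integral>s. (norm (\<psi> s))\<^sup>2 \<partial>period_measure)"
  define N1 where "N1 = (\<integral>s. norm (\<psi> s) \<partial>period_measure)"
  define K where "K = 16 * C + N"
  have N0: "0 \<le> N" "0 \<le> N1" by (simp_all add: N_def N1_def)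
  have int\<psi>: "integrable period_measure \<psi>"
    by (rule square_integrable_imp_integrable) (use sq in auto)
  have int: "integrable period_measure (\<lambda>s. ln (cmod (x - g s)) *\<^sub>R \<psi> s)" for x
    by (rule integrable_logpot) (use sq in auto)
  define W where "W = (\<lambda>\<epsilon> x. \<integral>s. ln (max (cmod (x - g s)) \<epsilon>) *\<^sub>R \<psi> s \<partial>period_measure)"
  have pt: "norm ((ln (cmod (x - g s)) - ln (max (cmod (x - g s)) \<epsilon>)) *\<^sub>R \<psi> s) \<le>
      16 * \<epsilon> powr (1 / 4) * cmod (x - g s) powr (- 1 / 2) + (norm (\<psi> s))\<^sup>2 * \<epsilon> powr (1 / 4)"
    if "0 < \<epsilon>" "g s \<noteq> x" for \<epsilon> x s
  proof (cases "cmod (x - g s) < \<epsilon>")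
    case True
    let ?r = "cmod (x - g s)"
    have r: "0 < ?r" using that by auto
    have "(ln ?r - ln \<epsilon>)\<^sup>2 = (ln (?r / \<epsilon>))\<^sup>2" using r that by (simp add: ln_div)
    also have "\<dots> \<le> 16 * (?r / \<epsilon>) powr (- 1 / 2)"
      using r True that by (intro ln_square_le_powr) auto
    also have "\<dots> = 16 * \<epsilon> powr (1 / 2) * ?r powr (- 1 / 2)"
      using r that by (simp add: powr_divide powr_minus_divide)
    finally have 1: "(ln ?r - ln \<epsilon>)\<^sup>2 \<le> 16 * \<epsilon> powr (1 / 2) * ?r powr (- 1 / 2)" .
    \<comment> \<open>The squared logarithm carries \<epsilon>^(1/2); the weight \<epsilon>^(-1/4)
      balances it against the square of \<psi> so that both terms keep \<epsilon>^(1/4).\<close>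
    have "norm ((ln ?r - ln \<epsilon>) *\<^sub>R \<psi> s) \<le> \<epsilon> powr (- 1 / 4) * (ln ?r - ln \<epsilon>)\<^sup>2 + (norm (\<psi> s))\<^sup>2 / \<epsilon> powr (- 1 / 4)"
      using mult_le_weighted_squares[of "\<epsilon> powr (- 1 / 4)" "ln ?r - ln \<epsilon>" "norm (\<psi> s)"] that by simp
    also have "\<dots> \<le> \<epsilon> powr (- 1 / 4) * (16 * \<epsilon> powr (1 / 2) * ?r powr (- 1 / 2)) + (norm (\<psi> s))\<^sup>2 / \<epsilon> powr (- 1 / 4)"
      using 1 by (intro add_right_mono mult_left_mono) auto
    also have "\<dots> = 16 * (\<epsilon> powr (- 1 / 4) * \<epsilon> powr (1 / 2)) * ?r powr (- 1 / 2) + (norm (\<psi> s))\<^sup>2 * \<epsilon> powr (1 / 4)"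
      by (simp add: powr_minus_divide)
    also have "\<epsilon> powr (- 1 / 4) * \<epsilon> powr (1 / 2) = \<epsilon> powr (1 / 4)"
      using that by (simp add: powr_add[symmetric])
    finally show ?thesis using True by (simp add: max_def)
  qed (auto simp: max_def)
  have meas: "(\<lambda>s. ln (max (cmod (x - g s)) \<epsilon>) *\<^sub>R \<psi> s) \<in> borel_measurable period_measure" for x \<epsilon>
    by measurable
  have tail: "integrable period_measure (\<lambda>s. ln (max (cmod (x - g s)) \<epsilon>) *\<^sub>R \<psi> s)"
    "norm (logpot \<psi> x - W \<epsilon> x) \<le> K * \<epsilon> powr (1 / 4)" if "0 < \<epsilon>" for \<epsilon> x
  proof -
    let ?b = "\<lambda>s. 16 * \<epsilon> powr (1 / 4) * cmod (x - g s) powr (- 1 / 2) + (norm (\<psi> s))\<^sup>2 * \<epsilon> powr (1 / 4)"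
    let ?d = "\<lambda>s. (ln (cmod (x - g s)) - ln (max (cmod (x - g s)) \<epsilon>)) *\<^sub>R \<psi> s"
    have intb: "integrable period_measure ?b" using C(2)[of x] sq by simp
    have ae: "AE s in period_measure. norm (?d s) \<le> ?b s"
      using AE_neq[of x] by eventually_elim (use pt that in blast)
    have intd: "integrable period_measure ?d"
      using intb by (rule Bochner_Integration.integrable_bound)
        (use ae in \<open>auto elim!: eventually_mono intro: order_trans\<close>)
    have "integrable period_measure (\<lambda>s. ln (cmod (x - g s)) *\<^sub>R \<psi> s - ?d s)"
      using int intd by (rule Bochner_Integration.integrable_diff)
    then show i: "integrable period_measure (\<lambda>s. ln (max (cmod (x - g s)) \<epsilon>) *\<^sub>R \<psi> s)"
      by (simp add: algebra_simps)
    have eq: "logpot \<psi> x - W \<epsilon> x = (\<integral>s. ?d s \<partial>period_measure)"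
      unfolding logpot_def W_def using int[of x] i
      by (subst Bochner_Integration.integral_diff[symmetric]) (simp_all add: scaleR_diff_left)
    have "norm (logpot \<psi> x - W \<epsilon> x) \<le> (\<integral>s. ?b s \<partial>period_measure)"
      unfolding eq by (rule norm_integral_le[OF intd intb ae])
    also have "\<dots> = 16 * \<epsilon> powr (1 / 4) * (\<integral>s. cmod (x - g s) powr (- 1 / 2) \<partial>period_measure) + N * \<epsilon> powr (1 / 4)"
      using C(2)[of x] sq by (simp add: N_def)
    also have "\<dots> \<le> 16 * \<epsilon> powr (1 / 4) * C + N * \<epsilon> powr (1 / 4)"
      using C(3)[of x] by (intro add_right_mono mult_left_mono) auto
    also have "\<dots> = K * \<epsilon> powr (1 / 4)" by (simp add: K_def algebra_simps)
    finally show "norm (logpot \<psi> x - W \<epsilon> x) \<le> K * \<epsilon> powr (1 / 4)" .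
  qed
  have lip: "norm (W \<epsilon> x - W \<epsilon> y) \<le> N1 / \<epsilon> * cmod (x - y)" if e: "0 < \<epsilon>" for \<epsilon> x y
  proof -
    let ?d = "\<lambda>s. (ln (max (cmod (x - g s)) \<epsilon>) - ln (max (cmod (y - g s)) \<epsilon>)) *\<^sub>R \<psi> s"
    have ln_lip: "\<bar>ln a - ln b\<bar> \<le> \<bar>a - b\<bar> / \<epsilon>" if "\<epsilon> \<le> a" "\<epsilon> \<le> b" for a b
    proof -
      have *: "ln u - ln v \<le> (u - v) / \<epsilon>" if "\<epsilon> \<le> v" "v \<le> u" for u v
      proof -
        have "ln u - ln v \<le> (u - v) / v" using that e by (intro ln_diff_le) auto
        also have "\<dots> \<le> (u - v) / \<epsilon>" using that e by (intro divide_left_mono) auto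
        finally show ?thesis .
      qed
      show ?thesis using *[of a b] *[of b a] that e
        by (cases "a \<le> b") (auto simp: abs_if)
    qed
    have b: "norm (?d s) \<le> cmod (x - y) / \<epsilon> * norm (\<psi> s)" for s
    proof -
      have "\<bar>ln (max (cmod (x - g s)) \<epsilon>) - ln (max (cmod (y - g s)) \<epsilon>)\<bar>
          \<le> \<bar>max (cmod (x - g s)) \<epsilon> - max (cmod (y - g s)) \<epsilon>\<bar> / \<epsilon>"
        by (rule ln_lip) auto
      also have "\<bar>max (cmod (x - g s)) \<epsilon> - max (cmod (y - g s)) \<epsilon>\<bar> \<le> \<bar>cmod (x - g s) - cmod (y - g s)\<bar>"
        by (auto simp: max_def abs_if)
      also have "\<dots> \<le> cmod (x - y)"
        using norm_triangle_ineq3[of "x - g s" "y - g s"] by simp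
      finally have "\<bar>ln (max (cmod (x - g s)) \<epsilon>) - ln (max (cmod (y - g s)) \<epsilon>)\<bar> \<le> cmod (x - y) / \<epsilon>"
        using e by (simp add: divide_right_mono)
      from mult_right_mono[OF this norm_ge_zero[of "\<psi> s"]] show ?thesis by simp
    qed
    have eq: "W \<epsilon> x - W \<epsilon> y = (\<integral>s. ?d s \<partial>period_measure)"
      unfolding W_def using tail(1)[OF e, of x] tail(1)[OF e, of y]
      by (subst Bochner_Integration.integral_diff[symmetric]) (simp_all add: scaleR_diff_left)
    have "norm (W \<epsilon> x - W \<epsilon> y) \<le> (\<integral>s. cmod (x - y) / \<epsilon> * norm (\<psi> s) \<partial>period_measure)"
      unfolding eq
    proof (rule norm_integral_le)
      show "integrable period_measure ?d"
        using tail(1)[OF e, of x] tail(1)[OF e, of y] by (simp add: scaleR_diff_left)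
    qed (use int\<psi> b in auto)
    also have "\<dots> = N1 / \<epsilon> * cmod (x - y)" by (simp add: N1_def)
    finally show ?thesis .
  qed
  show ?thesis
    unfolding continuous_on_iff
  proof (intro ballI allI impI)
    fix x and e :: real assume "0 < e"
    have K: "0 < K" using C(1) N0 by (simp add: K_def)
    \<comment> \<open>Chosen so that each of the two truncation errors is at most e/4;
      \<open>d\<close> then makes the Lipschitz part at most e/4 as well.\<close>
    define \<epsilon> where "\<epsilon> = (e / (4 * K)) powr 4"
    have "\<epsilon> powr (1 / 4) = (e / (4 * K)) powr (4 * (1 / 4))"
      unfolding \<epsilon>_def by (rule powr_powr)
    also have "\<dots> = e / (4 * K)" using \<open>0 < e\<close> K by simp
    finally have "K * \<epsilon> powr (1 / 4) = e / 4" using K by simp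
    moreover have "0 < \<epsilon>" using \<open>0 < e\<close> K by (simp add: \<epsilon>_def)
    ultimately have \<epsilon>: "0 < \<epsilon>" "K * \<epsilon> powr (1 / 4) = e / 4" by blast+
    define d where "d = \<epsilon> * e / (4 * (N1 + 1))"
    have "0 < d" using \<epsilon> \<open>0 < e\<close> N0 by (simp add: d_def)
    moreover have "dist (logpot \<psi> y) (logpot \<psi> x) < e" if "dist y x < d" for y
    proof -
      have "norm (W \<epsilon> y - W \<epsilon> x) \<le> N1 / \<epsilon> * cmod (y - x)" by (rule lip[OF \<epsilon>(1)])
      also have "\<dots> \<le> N1 / \<epsilon> * d"
        using that N0 \<epsilon> by (intro mult_left_mono) (auto simp: dist_norm)
      also have "\<dots> \<le> e / 4"
      proof -
        have "N1 / \<epsilon> * d = e / 4 * (N1 / (N1 + 1))" using \<epsilon>(1) by (simp add: d_def)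
        also have "\<dots> \<le> e / 4 * 1" using N0 \<open>0 < e\<close> by (intro mult_left_mono) auto
        finally show ?thesis by simp
      qed
      finally have 1: "norm (W \<epsilon> y - W \<epsilon> x) \<le> e / 4" .
      have "norm (logpot \<psi> y - logpot \<psi> x) = norm ((logpot \<psi> y - W \<epsilon> y) + (W \<epsilon> y - W \<epsilon> x) - (logpot \<psi> x - W \<epsilon> x))" by simp
      also have "\<dots> \<le> norm ((logpot \<psi> y - W \<epsilon> y) + (W \<epsilon> y - W \<epsilon> x)) + norm (logpot \<psi> x - W \<epsilon> x)"
        by (rule norm_triangle_ineq4)
      also have "\<dots> \<le> norm (logpot \<psi> y - W \<epsilon> y) + norm (W \<epsilon> y - W \<epsilon> x) + norm (logpot \<psi> x - W \<epsilon> x)"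
        by (intro add_right_mono norm_triangle_ineq)
      also have "\<dots> \<le> e / 4 + e / 4 + e / 4"
        using 1 tail(2)[OF \<epsilon>(1)] \<epsilon>(2) by (intro add_mono) auto
      finally show ?thesis using \<open>0 < e\<close> by (simp add: dist_norm)
    qed
    ultimately show "\<exists>d>0. \<forall>y\<in>UNIV. dist y x < d \<longrightarrow> dist (logpot \<psi> y) (logpot \<psi> x) < e" by blast
  qed
qed

end

section \<open>The unit circle\<close>

text \<open>Jordan's inequality: sine is concave on [0, pi/2] and lies above its chord. It provides
  the constant 2/pi of the circle as a \<open>bilipschitz_loop\<close>.\<close>

lemma two_sin_half_lower:
  assumes "\<bar>h\<bar> \<le> pi"
  shows "2 / pi * \<bar>h\<bar> \<le> 2 * \<bar>sin (h / 2)\<bar>"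
proof -
  have *: "2 / pi * h \<le> 2 * sin (h / 2)" if "0 \<le> h" "h \<le> pi" for h
  proof -
    have "concave_on {0..pi / 2} sin"
      by (rule f''_le0_imp_concave[where f' = cos and f'' = "\<lambda>x. - sin x"])
        (auto intro!: derivative_eq_intros sin_ge_zero)
    from concave_onD_Icc[OF this, of "h / pi"] show ?thesis
      using that by (simp add: field_simps)
  qed
  show ?thesis using *[of "\<bar>h\<bar>"] assms by (cases "0 \<le> h") (auto simp: abs_if)
qed

lemma cmod_cis_diff: "cmod (cis a - cis b) = 2 * \<bar>sin ((a - b) / 2)\<bar>"
proof -
  have "(cmod (cis a - cis b))\<^sup>2 = 2 - 2 * cos (a - b)"
    using sin_cos_squared_add[of a] sin_cos_squared_add[of b]
    by (simp add: cmod_power2 power2_diff cos_diff algebra_simps)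
  also have "cos (a - b) = 1 - 2 * (sin ((a - b) / 2))\<^sup>2"
    unfolding cos_double_sin[symmetric] by (rule arg_cong[where f = cos]) (simp add: field_simps)
  also have "2 - 2 * (1 - 2 * (sin ((a - b) / 2))\<^sup>2) = (2 * \<bar>sin ((a - b) / 2)\<bar>)\<^sup>2"
    by (simp add: power_mult_distrib)
  finally show ?thesis by (rule power2_eq_imp_eq) auto
qed

interpretation circle: bilipschitz_loop cis "2 / pi"
proof
  show "cis (s + 2 * pi) = cis s" for s by (simp add: complex_eq_iff)
  show "continuous_on UNIV cis" by (intro continuous_intros)
qed (use two_sin_half_lower in \<open>auto simp: cmod_cis_diff\<close>)

text \<open>Since z^2 - cis (2 s) = (z - cis s) (z - cis (pi + s)), the logarithm splits into two
  terms with equal integrals, and \<open>periodic_double\<close> removes the factor 2 in the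
  parameter. The splitting can fail only at zeros, a null set.\<close>

lemma circle_logpot_square:
  "circle.logpot (\<lambda>_. 1::real) (z\<^sup>2) = 2 * circle.logpot (\<lambda>_. 1) z"
proof -
  let ?f = "\<lambda>z s. ln (cmod (z - cis s))"
  have int: "integrable period_measure (?f z)" for z
    using circle.integrable_logpot[of "\<lambda>_. 1::real" z] by simp
  have per: "?f z (s + 2 * pi) = ?f z s" for s z by (simp add: circle.per)
  have cis_double: "cis (2 * s) = (cis s)\<^sup>2" for s
    by (simp only: power2_eq_square cis_mult mult_2)
  have "AE s in period_measure. ?f (z\<^sup>2) (2 * s) = ?f z s + ?f z (pi + s)"
    using circle.AE_neq[of z] circle.AE_neq[of "- z"]
  proof eventually_elim
    case (elim s)
    have "cis (pi + s) = - cis s" by (simp add: cis_mult[symmetric])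
    moreover have "z\<^sup>2 - cis (2 * s) = (z - cis s) * (z + cis s)"
      unfolding cis_double by (simp add: power2_eq_square algebra_simps)
    moreover have "z + cis s \<noteq> 0"
      using elim(2) by (metis add.inverse_inverse add_eq_0_iff)
    ultimately show ?case using elim by (simp add: norm_mult ln_mult)
  qed
  then have "(\<integral>s. ?f (z\<^sup>2) (2 * s) \<partial>period_measure) = (\<integral>s. ?f z s + ?f z (pi + s) \<partial>period_measure)"
    by (intro integral_cong_AE borel_measurable_period) measurable
  also have "\<dots> = 2 * (\<integral>s. ?f z s \<partial>period_measure)"
    using int[of z] periodic_shift[of "?f z", OF per int] by simp
  also have "(\<integral>s. ?f (z\<^sup>2) (2 * s) \<partial>period_measure) = (\<integral>s. ?f (z\<^sup>2) s \<partial>period_measure)"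
    using periodic_double[of "?f (z\<^sup>2)", OF per int] by (simp add: has_bochner_integral_iff)
  finally show ?thesis by (simp add: circle.logpot_def)
qed

text \<open>
  On the closed unit disc the logarithmic potential of the circle is bounded and is doubled by
  squaring the argument, so it vanishes.
\<close>

lemma circle_logpot_unit_disc:
  assumes "cmod z \<le> 1"
  shows "circle.logpot (\<lambda>_. 1::real) z = 0"
proof -
  let ?J = "circle.logpot (\<lambda>_. 1::real)"
  have "compact (cball 0 1 :: complex set)" by simp
  moreover have "continuous_on (cball 0 1) ?J"
    by (rule continuous_on_subset[OF circle.continuous_logpot]) auto
  ultimately have "bounded (?J ` cball 0 1)"
    by (intro compact_imp_bounded compact_continuous_image)
  then obtain C where C: "\<And>w. cmod w \<le> 1 \<Longrightarrow> \<bar>?J w\<bar> \<le> C"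
    by (metis bounded_iff imageI mem_cball_0 real_norm_def)
  have *: "\<bar>?J w\<bar> \<le> C / 2 ^ k" if "cmod w \<le> 1" for k w
    using that
  proof (induction k arbitrary: w)
    case (Suc k)
    have "cmod (w\<^sup>2) \<le> 1" using Suc.prems by (simp add: norm_power power_le_one)
    from Suc.IH[OF this] show ?case by (simp add: circle_logpot_square field_simps abs_mult)
  qed (use C in simp)
  have "(\<lambda>k. C / 2 ^ k) \<longlonglongrightarrow> 0"
    by (rule LIMSEQ_divide_realpow_zero) simp
  then have "\<bar>?J z\<bar> \<le> 0"
    using *[OF assms] by (intro LIMSEQ_le_const) auto
  then show ?thesis by simp
qed

text \<open>Reflection in the unit circle: |z - cis s| = |z| |1 / cnj z - cis s|, and the reflected
  point lies in the disc, where the potential vanishes.\<close>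

lemma circle_logpot_outside:
  assumes "1 < cmod z"
  shows "circle.logpot (\<lambda>_. 1::real) z = 2 * pi * ln (cmod z)"
proof -
  have eq: "cmod (z - cis s) = cmod z * cmod (inverse (cnj z) - cis s)" for s
  proof -
    have "z \<noteq> 0" using assms by auto
    then have "cmod z * cmod (inverse (cnj z) - cis s) = cmod (cnj z * (inverse (cnj z) - cis s))"
      by (simp add: norm_mult)
    also have "cnj z * (inverse (cnj z) - cis s) = - (cis s * cnj (z - cis s))"
      using \<open>z \<noteq> 0\<close> by (simp add: algebra_simps cis_cnj cis_mult)
    finally show ?thesis by (simp add: norm_mult del: complex_cnj_diff)
  qed
  have int: "integrable period_measure (\<lambda>s. ln (cmod (w - cis s)))" for w
    using circle.integrable_logpot[of "\<lambda>_. 1::real" w] by simp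
  have "AE s in period_measure. ln (cmod (z - cis s)) = ln (cmod z) + ln (cmod (inverse (cnj z) - cis s))"
    using circle.AE_neq[of "inverse (cnj z)"]
    by eventually_elim (use assms in \<open>auto simp: eq ln_mult\<close>)
  then have "circle.logpot (\<lambda>_. 1::real) z =
      (\<integral>s. ln (cmod z) + ln (cmod (inverse (cnj z) - cis s)) \<partial>period_measure)"
    unfolding circle.logpot_def by (intro integral_cong_AE) auto
  also have "\<dots> = 2 * pi * ln (cmod z) + circle.logpot (\<lambda>_. 1::real) (inverse (cnj z))"
    using int by (simp add: circle.logpot_def)
  also have "circle.logpot (\<lambda>_. 1::real) (inverse (cnj z)) = 0"
    using assms by (intro circle_logpot_unit_disc) (simp add: norm_divide divide_simps)
  finally show ?thesis by simp
qed

text \<open>The mean value property of ln |. - a| on discs that avoid \<open>a\<close>; rescaling to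
  the unit circle turns \<open>a\<close> into an outside point \<open>z\<close>.\<close>

lemma circle_mean_ln:
  assumes "0 < r" "r < cmod (c - a)"
  shows "(\<integral>s. ln (cmod (c + of_real r * cis s - a)) \<partial>period_measure) = 2 * pi * ln (cmod (c - a))"
proof -
  define z where "z = (a - c) / of_real r"
  have z: "1 < cmod z" using assms by (simp add: z_def norm_divide norm_minus_commute field_simps)
  have "cmod (c + of_real r * cis s - a) = r * cmod (z - cis s)" for s
  proof -
    have "c + of_real r * cis s - a = - of_real r * (z - cis s)"
    proof -
      have "of_real r * z = a - c" using assms by (simp add: z_def)
      then show ?thesis by (simp add: right_diff_distrib)
    qed
    then show ?thesis using assms by (simp add: norm_mult)
  qed
  moreover have "z - cis s \<noteq> 0" for s using z by auto
  ultimately have "ln (cmod (c + of_real r * cis s - a)) = ln r + ln (cmod (z - cis s))" for s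
    using assms by (simp add: ln_mult)
  then have "(\<integral>s. ln (cmod (c + of_real r * cis s - a)) \<partial>period_measure) =
      2 * pi * ln r + circle.logpot (\<lambda>_. 1::real) z"
    using circle.integrable_logpot[of "\<lambda>_. 1::real" z] by (simp add: circle.logpot_def)
  also have "\<dots> = 2 * pi * (ln r + ln (cmod z))" using z by (simp add: circle_logpot_outside algebra_simps)
  also have "ln r + ln (cmod z) = ln (cmod (c - a))"
  proof -
    have "r * cmod z = cmod (c - a)"
      using assms by (simp add: z_def norm_divide norm_minus_commute)
    moreover have "z \<noteq> 0" using z by auto
    ultimately show ?thesis using assms z ln_mult_pos[of r "cmod z"] by simp
  qed
  finally show ?thesis .
qed

text \<open>The mean value property of 1/(. - a). Normalised to the unit circle, the integral
  satisfies D (z^2) = D z, hence D z = D (z^(2^k)), which tends to D 0 = 2 pi.\<close>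

lemma circle_mean_inverse:
  fixes a c :: complex
  assumes "0 < r" "r < cmod (c - a)"
  shows "(\<integral>s. inverse (c + of_real r * cis s - a) \<partial>period_measure) = 2 * pi * inverse (c - a)"
proof -
  define D where "D = (\<lambda>z. \<integral>s. inverse (1 - z * cis s) \<partial>period_measure)"
  have nz: "1 - z * cis s \<noteq> 0" if "cmod z < 1" for z s
  proof
    assume "1 - z * cis s = 0"
    then have "cmod (z * cis s) = 1" by simp
    then show False using that by (simp add: norm_mult)
  qed
  have cont: "continuous_on UNIV (\<lambda>s. inverse (1 - z * cis s))" if "cmod z < 1" for z
    using nz[OF that] by (intro continuous_intros) auto
  have int: "integrable period_measure (\<lambda>s. inverse (1 - z * cis s))" if "cmod z < 1" for z
    using borel_integrable_compact[OF _ continuous_on_subset[OF cont[OF that]], of "{0..2 * pi}"]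
    by (simp add: integrable_restrict_space)
  have per: "inverse (1 - z * cis (s + 2 * pi)) = inverse (1 - z * cis s)" for z s by (simp add: circle.per)
  have square: "D (z\<^sup>2) = D z" if "cmod z < 1" for z
  proof -
    have z2: "cmod (z\<^sup>2) < 1" using that by (simp add: norm_power power_less_one_iff)
    \<comment> \<open>Partial fractions with w = z cis s: 2/(1 - w^2) = 1/(1 - w) + 1/(1 + w), and 1
      + w belongs to the parameter pi + s.\<close>
    have "2 * inverse (1 - z\<^sup>2 * cis (2 * s)) = inverse (1 - z * cis s) + inverse (1 - z * cis (pi + s))" for s
    proof -
      have m: "cis (pi + s) = - cis s" by (simp add: cis_mult[symmetric])
      have d: "cis (2 * s) = (cis s)\<^sup>2" by (simp only: power2_eq_square cis_mult mult_2)
      have "1 - z\<^sup>2 * cis (2 * s) = (1 - z * cis s) * (1 + z * cis s)"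
        unfolding d by (simp add: power2_eq_square algebra_simps)
      moreover have "1 + z * cis s \<noteq> 0" using nz[OF that, of "pi + s"] by (simp add: m)
      ultimately show ?thesis using nz[OF that, of s]
        by (simp add: m division_ring_inverse_add)
    qed
    then have "(\<integral>s. 2 * inverse (1 - z\<^sup>2 * cis (2 * s)) \<partial>period_measure) =
        (\<integral>s. inverse (1 - z * cis s) + inverse (1 - z * cis (pi + s)) \<partial>period_measure)" by simp
    also have "\<dots> = 2 * D z"
      using int[OF that] periodic_shift[of "\<lambda>s. inverse (1 - z * cis s)" pi, OF per int[OF that]]
      by (simp add: D_def)
    finally show ?thesis
      using periodic_double[of "\<lambda>s. inverse (1 - z\<^sup>2 * cis s)", OF per int[OF z2]]
      by (simp add: has_bochner_integral_iff D_def)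
  qed
  have D: "D z = 2 * pi" if "cmod z < 1" for z
  proof -
    have pow: "D (z ^ (2 ^ k)) = D z" for k
    proof (induction k)
      case (Suc k)
      have "cmod (z ^ (2 ^ k)) < 1" using that by (simp add: norm_power power_less_one_iff)
      from square[OF this] show ?case using Suc by (simp add: power_mult[symmetric] mult.commute)
    qed simp
    have bound: "cmod (D z - 2 * pi) \<le> 2 * pi * (cmod w / (1 - cmod w))" if "cmod w < 1" "D w = D z" for w
    proof -
      have eq: "D w - 2 * pi = (\<integral>s. inverse (1 - w * cis s) - 1 \<partial>period_measure)"
        using int[OF that(1)] by (simp add: D_def scaleR_conv_of_real)
      have "cmod (D w - 2 * pi) \<le> (\<integral>s. cmod w / (1 - cmod w) \<partial>period_measure)"
        unfolding eq
      proof (rule norm_integral_le)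
        have "cmod (inverse (1 - w * cis s) - 1) \<le> cmod w / (1 - cmod w)" for s
        proof -
          have "inverse (1 - w * cis s) - 1 = w * cis s / (1 - w * cis s)"
            using nz[OF that(1), of s] by (simp add: field_simps)
          moreover have "1 - cmod w \<le> cmod (1 - w * cis s)"
            using norm_triangle_ineq2[of 1 "w * cis s"] by (simp add: norm_mult)
          ultimately show ?thesis
            using that(1) by (simp add: norm_divide norm_mult frac_le)
        qed
        then show "AE s in period_measure. cmod (inverse (1 - w * cis s) - 1) \<le> cmod w / (1 - cmod w)" by simp
      qed (use int[OF that(1)] in auto)
      then show ?thesis using that by simp
    qed
    have "(\<lambda>k. cmod z ^ k) \<longlonglongrightarrow> 0" using that by (intro LIMSEQ_realpow_zero) auto
    moreover have "filterlim (\<lambda>k. 2 ^ k :: nat) at_top sequentially"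
      by (rule filterlim_subseq) (simp add: strict_mono_def)
    ultimately have lim: "(\<lambda>k. cmod z ^ (2 ^ k)) \<longlonglongrightarrow> 0"
      by (rule filterlim_compose)
    have "(\<lambda>k. 2 * pi * (cmod z ^ (2 ^ k) / (1 - cmod z ^ (2 ^ k)))) \<longlonglongrightarrow> 2 * pi * (0 / (1 - 0))"
      by (intro tendsto_intros lim) simp
    moreover have "cmod (D z - 2 * pi) \<le> 2 * pi * (cmod z ^ (2 ^ k) / (1 - cmod z ^ (2 ^ k)))" for k
      using bound[of "z ^ (2 ^ k)"] pow[of k] that by (simp add: norm_power power_less_one_iff)
    ultimately have "cmod (D z - 2 * pi) \<le> 0"
      by (intro LIMSEQ_le_const) auto
    then show ?thesis by simp
  qed
  define z where "z = of_real r / (a - c)"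
  have ac: "a \<noteq> c" using assms by auto
  have rac: "r < cmod (a - c)" using assms by (simp add: norm_minus_commute)
  have "0 < cmod (a - c)" using ac by simp
  then have "r / cmod (a - c) < 1" using rac by (simp only: pos_divide_less_eq)
  then have z: "cmod z < 1" using assms(1) by (simp add: z_def norm_divide)
  have "inverse (c + of_real r * cis s - a) = inverse (c - a) * inverse (1 - z * cis s)" for s
  proof -
    have "c + of_real r * cis s - a = (c - a) * (1 - z * cis s)"
    proof -
      have "(c - a) * z = - of_real r"
        using ac minus_divide_right[of "c - a" "a - c"] by (simp add: z_def field_simps)
      then have "(c - a) * (z * cis s) = - of_real r * cis s" by (simp only: mult.assoc[symmetric])
      then show ?thesis by (simp add: right_diff_distrib)
    qed
    then show ?thesis by simp
  qed
  then have "(\<integral>s. inverse (c + of_real r * cis s - a) \<partial>period_measure) = inverse (c - a) * D z"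
    by (simp add: D_def)
  then show ?thesis using D[OF z] by simp
qed

section \<open>Logarithmic energy\<close>

text \<open>The quotient is the integral of \<rho> exp (- x \<rho>^2) over \<rho> in [a, b];
  integrating over x first leaves 1/\<rho>. Extended nonnegative integrals allow the exchange before
  integrability is known.\<close>

lemma integral_exp_quotient_nn:
  assumes "0 < a" "a \<le> b"
  shows "(\<integral>\<^sup>+x. ennreal ((exp (- x * a\<^sup>2) - exp (- x * b\<^sup>2)) / (2 * x)) * indicator {0<..} x \<partial>lborel)
    = ennreal (ln b - ln a)"
proof -
  have inner1: "(\<integral>\<^sup>+\<rho>. ennreal (\<rho> * exp (- x * \<rho>\<^sup>2)) * indicator {a..b} \<rho> \<partial>lborel) =
      ennreal ((exp (- x * a\<^sup>2) - exp (- x * b\<^sup>2)) / (2 * x))" if "0 < x" for x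
  proof -
    have "(\<integral>\<^sup>+\<rho>. ennreal (\<rho> * exp (- x * \<rho>\<^sup>2)) * indicator {a..b} \<rho> \<partial>lborel) =
        ennreal (- exp (- x * b\<^sup>2) / (2 * x) - (- exp (- x * a\<^sup>2) / (2 * x)))"
      using assms that
      by (intro nn_integral_FTC_Icc) (auto intro!: derivative_eq_intros simp: field_simps power2_eq_square)
    then show ?thesis by (simp add: diff_divide_distrib)
  qed
  have inner2: "(\<integral>\<^sup>+x. ennreal (\<rho> * exp (- x * \<rho>\<^sup>2)) * indicator {0..} x \<partial>lborel) = ennreal (1 / \<rho>)"
    if "0 < \<rho>" for \<rho>
  proof -
    have "((\<lambda>x. - (exp (- x * \<rho>\<^sup>2) / \<rho>)) \<longlongrightarrow> - (0 / \<rho>)) at_top"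
    proof (intro tendsto_intros)
      have "filterlim (\<lambda>x. \<rho>\<^sup>2 * x) at_top at_top"
        using that by (intro filterlim_tendsto_pos_mult_at_top[OF tendsto_const _ filterlim_ident]) simp
      then have "((\<lambda>x. exp (- (\<rho>\<^sup>2 * x))) \<longlongrightarrow> 0) at_top"
        by (intro filterlim_compose[OF exp_at_bot] filterlim_compose[OF filterlim_uminus_at_bot_at_top])
      then show "((\<lambda>x. exp (- x * \<rho>\<^sup>2)) \<longlongrightarrow> 0) at_top" by (simp add: mult.commute)
    qed (use that in simp)
    then have "(\<integral>\<^sup>+x. ennreal (\<rho> * exp (- x * \<rho>\<^sup>2)) * indicator {0..} x \<partial>lborel) = ennreal (0 - (- (exp (- 0 * \<rho>\<^sup>2) / \<rho>)))"
      using that by (intro nn_integral_FTC_atLeast)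
        (auto intro!: derivative_eq_intros simp: field_simps power2_eq_square)
    then show ?thesis by simp
  qed
  let ?F = "\<lambda>x \<rho>. ennreal (\<rho> * exp (- x * \<rho>\<^sup>2)) * indicator {a..b} \<rho> * indicator {0<..} x :: ennreal"
  have "(\<integral>\<^sup>+x. ennreal ((exp (- x * a\<^sup>2) - exp (- x * b\<^sup>2)) / (2 * x)) * indicator {0<..} x \<partial>lborel) =
      (\<integral>\<^sup>+x. (\<integral>\<^sup>+\<rho>. ?F x \<rho> \<partial>lborel) \<partial>lborel)"
  proof (rule nn_integral_cong)
    fix x :: real
    show "ennreal ((exp (- x * a\<^sup>2) - exp (- x * b\<^sup>2)) / (2 * x)) * indicator {0<..} x = (\<integral>\<^sup>+\<rho>. ?F x \<rho> \<partial>lborel)"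
      using inner1[of x] by (cases "0 < x") auto
  qed
  also have "\<dots> = (\<integral>\<^sup>+\<rho>. (\<integral>\<^sup>+x. ?F x \<rho> \<partial>lborel) \<partial>lborel)"
    by (rule lborel_pair.Fubini') measurable
  also have "\<dots> = (\<integral>\<^sup>+\<rho>. ennreal (1 / \<rho>) * indicator {a..b} \<rho> \<partial>lborel)"
  proof (rule nn_integral_cong)
    fix \<rho> :: real
    show "(\<integral>\<^sup>+x. ?F x \<rho> \<partial>lborel) = ennreal (1 / \<rho>) * indicator {a..b} \<rho>"
    proof (cases "\<rho> \<in> {a..b}")
      case True
      have "(\<integral>\<^sup>+x. ?F x \<rho> \<partial>lborel) = (\<integral>\<^sup>+x. ennreal (\<rho> * exp (- x * \<rho>\<^sup>2)) * indicator {0..} x \<partial>lborel)"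
        using AE_lborel_singleton[of 0] True
        by (intro nn_integral_cong_AE) (auto elim!: eventually_mono simp: indicator_def)
      then show ?thesis using inner2[of \<rho>] True assms by simp
    qed simp
  qed
  also have "\<dots> = ennreal (ln b - ln a)"
    using assms by (intro nn_integral_FTC_Icc) (auto intro!: derivative_eq_intros)
  finally show ?thesis .
qed

text \<open>The integrand keeps one sign, which depends on whether r \<le> 1, so its absolute value
  integrates to |ln r|. This second claim is the domination that lets Fubini be applied to the
  energy.\<close>

lemma frullani_ln:
  fixes r :: real
  assumes "0 < r"
  defines "f \<equiv> \<lambda>x. indicator {0<..} x * ((exp (- x * r\<^sup>2) - exp (- x)) / (2 * x))"
  shows "has_bochner_integral lborel f (- ln r)"
    and "has_bochner_integral lborel (\<lambda>x. \<bar>f x\<bar>) \<bar>ln r\<bar>"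
proof -
  have *: "has_bochner_integral lborel (\<lambda>x. indicator {0<..} x * ((exp (- x * a\<^sup>2) - exp (- x * b\<^sup>2)) / (2 * x)))
      (ln b - ln a)" and pos: "0 \<le> indicator {0<..} x * ((exp (- x * a\<^sup>2) - exp (- x * b\<^sup>2)) / (2 * x))"
    if "0 < a" "a \<le> b" for a b x :: real
  proof -
    show pos: "0 \<le> indicator {0<..} x * ((exp (- x * a\<^sup>2) - exp (- x * b\<^sup>2)) / (2 * x))" for x
      using that by (auto simp: indicator_def intro!: divide_nonneg_pos mult_left_mono power_mono)
    show "has_bochner_integral lborel (\<lambda>x. indicator {0<..} x * ((exp (- x * a\<^sup>2) - exp (- x * b\<^sup>2)) / (2 * x)))
        (ln b - ln a)"
    proof (rule has_bochner_integral_nn_integral)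
      have "(\<integral>\<^sup>+x. ennreal (indicator {0<..} x * ((exp (- x * a\<^sup>2) - exp (- x * b\<^sup>2)) / (2 * x))) \<partial>lborel) =
          (\<integral>\<^sup>+x. ennreal ((exp (- x * a\<^sup>2) - exp (- x * b\<^sup>2)) / (2 * x)) * indicator {0<..} x \<partial>lborel)"
        by (intro nn_integral_cong) (auto simp: indicator_def)
      then show "(\<integral>\<^sup>+x. ennreal (indicator {0<..} x * ((exp (- x * a\<^sup>2) - exp (- x * b\<^sup>2)) / (2 * x))) \<partial>lborel) = ennreal (ln b - ln a)"
        using integral_exp_quotient_nn[OF that] by simp
    qed (use that pos in auto)
  qed
  have f: "f x = - (indicator {0<..} x * ((exp (- x) - exp (- x * r\<^sup>2)) / (2 * x)))" for x
    unfolding f_def by (metis minus_diff_eq minus_divide_left mult_minus_right)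
  show "has_bochner_integral lborel f (- ln r)" "has_bochner_integral lborel (\<lambda>x. \<bar>f x\<bar>) \<bar>ln r\<bar>"
  proof -
    show "has_bochner_integral lborel f (- ln r)"
    proof (cases "r \<le> 1")
      case True
      then show ?thesis using *[of r 1] assms by (simp add: f_def)
    next
      case False
      then show ?thesis using has_bochner_integral_minus[OF *[of 1 r]] by (simp add: f[abs_def])
    qed
    show "has_bochner_integral lborel (\<lambda>x. \<bar>f x\<bar>) \<bar>ln r\<bar>"
    proof (cases "r \<le> 1")
      case True
      have "0 \<le> f x" for x
        using pos[OF assms(1) True, of x] by (simp only: f_def power_one mult_1_right)
      then have "\<bar>f x\<bar> = f x" for x by simp
      then show ?thesis using *[of r 1] assms True by (simp add: f_def)
    next
      case False
      then have "0 \<le> indicator {0<..} x * ((exp (- x) - exp (- x * r\<^sup>2)) / (2 * x))" for x :: real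
        using pos[of 1 r x] by (simp only: power_one mult_1_right zero_less_one not_le less_imp_le simp_thms)
      then have "\<bar>f x\<bar> = indicator {0<..} x * ((exp (- x) - exp (- x * r\<^sup>2)) / (2 * x))" for x
        unfolding f abs_minus_cancel by (rule abs_of_nonneg)
      then show ?thesis using *[of 1 r] False by simp
    qed
  qed
qed

section \<open>Fubini on the square of the period\<close>

abbreviation period_square :: "(real \<times> real) measure" where
  "period_square \<equiv> period_measure \<Otimes>\<^sub>M period_measure"

lemma measurable_ident_period: "(\<lambda>x. x) \<in> period_measure \<rightarrow>\<^sub>M borel"
  by (simp add: measurable_restrict_space1)

text \<open>Explicit integrands are shown measurable for the Borel sigma algebra and pulled back
  along the identity, because \<open>period_square\<close> is a product of restricted
  spaces.\<close>

lemma measurable_ident_period_square: "(\<lambda>p. p) \<in> period_square \<rightarrow>\<^sub>M (borel \<Otimes>\<^sub>M borel)"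
proof -
  have "(\<lambda>p. (fst p, snd p)) \<in> period_square \<rightarrow>\<^sub>M (borel \<Otimes>\<^sub>M borel)"
    by (intro measurable_Pair measurable_compose[OF measurable_fst measurable_ident_period]
        measurable_compose[OF measurable_snd measurable_ident_period])
  then show ?thesis by simp
qed

lemma borel_measurable_period_square:
  "f \<in> borel_measurable (borel \<Otimes>\<^sub>M borel) \<Longrightarrow> f \<in> borel_measurable period_square"
  by (rule measurable_compose[OF measurable_ident_period_square])

lemma borel_measurable_period_square_lborel:
  assumes "f \<in> borel_measurable ((borel \<Otimes>\<^sub>M borel) \<Otimes>\<^sub>M borel)"
  shows "f \<in> borel_measurable (period_square \<Otimes>\<^sub>M lborel)"
proof -
  have "(\<lambda>q. (fst q, snd q)) \<in> (period_square \<Otimes>\<^sub>M lborel) \<rightarrow>\<^sub>M ((borel \<Otimes>\<^sub>M borel) \<Otimes>\<^sub>M borel)"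
    by (intro measurable_Pair measurable_compose[OF measurable_fst measurable_ident_period_square])
      (simp add: measurable_snd)
  from measurable_compose[OF this assms] show ?thesis by simp
qed

interpretation period_square: finite_measure period_square
  by (intro finite_measure_pair_measure period.finite_measure_axioms)

interpretation period_square_lborel: pair_sigma_finite period_square lborel
  by (intro pair_sigma_finite.intro; unfold_locales)

lemma integral_period_square_mult:
  fixes a b :: "real \<Rightarrow> real"
  assumes "integrable period_measure a" "integrable period_measure b"
  shows "integrable period_square (\<lambda>p. a (fst p) * b (snd p))"
    and "(\<integral>p. a (fst p) * b (snd p) \<partial>period_square) = (\<integral>t. a t \<partial>period_measure) * (\<integral>s. b s \<partial>period_measure)"
proof -
  show int: "integrable period_square (\<lambda>p. a (fst p) * b (snd p))"
  proof (rule period_pair.Fubini_integrable)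
    show "(\<lambda>p. a (fst p) * b (snd p)) \<in> borel_measurable period_square"
      using assms[THEN borel_measurable_integrable] by measurable
  qed (use assms in \<open>auto simp: abs_mult\<close>)
  show "(\<integral>p. a (fst p) * b (snd p) \<partial>period_square) = (\<integral>t. a t \<partial>period_measure) * (\<integral>s. b s \<partial>period_measure)"
    using period_pair.integral_fst'[OF int] by (simp add: mult.commute)
qed

lemma (in finite_measure) integrable_bounded:
  fixes f :: "'a \<Rightarrow> real"
  assumes "f \<in> borel_measurable M" "\<And>x. \<bar>f x\<bar> \<le> B"
  shows "integrable M f"
  using assms by (intro integrable_const_bound[of _ B]) auto

section \<open>Gaussian forms: Frullani superposition and positivity\<close>

definition gauss_form ::
  "(real \<Rightarrow> complex) \<Rightarrow> (real \<Rightarrow> complex) \<Rightarrow> (real \<Rightarrow> real) \<Rightarrow> (real \<Rightarrow> real) \<Rightarrow> real \<Rightarrow> real" where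
  "gauss_form \<Gamma>\<^sub>1 \<Gamma>\<^sub>2 w\<^sub>1 w\<^sub>2 x =
    (\<integral>p. exp (- x * (cmod (\<Gamma>\<^sub>1 (fst p) - \<Gamma>\<^sub>2 (snd p)))\<^sup>2) * (w\<^sub>1 (fst p) * w\<^sub>2 (snd p)) \<partial>period_square)"

lemma gauss_form_integrable:
  assumes [measurable]: "\<Gamma>\<^sub>1 \<in> borel_measurable borel" "\<Gamma>\<^sub>2 \<in> borel_measurable borel"
    "w\<^sub>1 \<in> borel_measurable borel" "w\<^sub>2 \<in> borel_measurable borel"
    and W: "\<And>t. \<bar>w\<^sub>1 t\<bar> \<le> W" "\<And>t. \<bar>w\<^sub>2 t\<bar> \<le> W" and x: "0 \<le> x"
  shows "integrable period_square
    (\<lambda>p. exp (- x * (cmod (\<Gamma>\<^sub>1 (fst p) - \<Gamma>\<^sub>2 (snd p)))\<^sup>2) * (w\<^sub>1 (fst p) * w\<^sub>2 (snd p)))"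
proof (rule period_square.integrable_bounded)
  fix p :: "real \<times> real"
  have W0: "0 \<le> W" using W(1)[of 0] by linarith
  have "exp (- x * (cmod (\<Gamma>\<^sub>1 (fst p) - \<Gamma>\<^sub>2 (snd p)))\<^sup>2) \<le> 1" using x by simp
  moreover have "\<bar>w\<^sub>1 (fst p) * w\<^sub>2 (snd p)\<bar> \<le> W * W"
    unfolding abs_mult by (intro mult_mono W W0) auto
  ultimately have "exp (- x * (cmod (\<Gamma>\<^sub>1 (fst p) - \<Gamma>\<^sub>2 (snd p)))\<^sup>2) * \<bar>w\<^sub>1 (fst p) * w\<^sub>2 (snd p)\<bar> \<le> 1 * (W * W)"
    by (rule mult_mono) auto
  then show "\<bar>exp (- x * (cmod (\<Gamma>\<^sub>1 (fst p) - \<Gamma>\<^sub>2 (snd p)))\<^sup>2) * (w\<^sub>1 (fst p) * w\<^sub>2 (snd p))\<bar> \<le> 1 * (W * W)"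
    by (simp add: abs_mult)
qed (rule borel_measurable_period_square, measurable)

text \<open>Frullani's formula is integrated against the two densities. Its subtracted term exp (-
  x) collects the product of the masses, which disappears later in a combination of total mass
  0.\<close>

lemma log_energy_eq_integral_gauss_form:
  assumes [measurable]: "\<Gamma>\<^sub>1 \<in> borel_measurable borel" "\<Gamma>\<^sub>2 \<in> borel_measurable borel"
    "w\<^sub>1 \<in> borel_measurable borel" "w\<^sub>2 \<in> borel_measurable borel"
    and W: "\<And>t. \<bar>w\<^sub>1 t\<bar> \<le> W" "\<And>t. \<bar>w\<^sub>2 t\<bar> \<le> W"
    and int: "integrable period_square (\<lambda>p. ln (cmod (\<Gamma>\<^sub>1 (fst p) - \<Gamma>\<^sub>2 (snd p))))"
    and neq: "AE p in period_square. \<Gamma>\<^sub>1 (fst p) \<noteq> \<Gamma>\<^sub>2 (snd p)"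
  defines "m\<^sub>1 \<equiv> \<integral>t. w\<^sub>1 t \<partial>period_measure" and "m\<^sub>2 \<equiv> \<integral>t. w\<^sub>2 t \<partial>period_measure"
  shows "has_bochner_integral lborel
      (\<lambda>x. indicator {0<..} x * ((gauss_form \<Gamma>\<^sub>1 \<Gamma>\<^sub>2 w\<^sub>1 w\<^sub>2 x - exp (- x) * (m\<^sub>1 * m\<^sub>2)) / (2 * x)))
      (- (\<integral>p. ln (cmod (\<Gamma>\<^sub>1 (fst p) - \<Gamma>\<^sub>2 (snd p))) * (w\<^sub>1 (fst p) * w\<^sub>2 (snd p)) \<partial>period_square))"
proof -
  let ?r = "\<lambda>p. cmod (\<Gamma>\<^sub>1 (fst p) - \<Gamma>\<^sub>2 (snd p))"
  let ?w = "\<lambda>p. w\<^sub>1 (fst p) * w\<^sub>2 (snd p)"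
  let ?f = "\<lambda>p x. indicator {0<..} x * ((exp (- x * (?r p)\<^sup>2) - exp (- x)) / (2 * x)) :: real"
  have W0: "0 \<le> W" using W(1)[of 0] by linarith
  have wb: "\<bar>?w p\<bar> \<le> W * W" for p
    unfolding abs_mult by (intro mult_mono W W0) auto
  have fr: "AE p in period_square. has_bochner_integral lborel (?f p) (- ln (?r p)) \<and>
      has_bochner_integral lborel (\<lambda>x. \<bar>?f p x\<bar>) \<bar>ln (?r p)\<bar>"
    using neq by eventually_elim (use frullani_ln in auto)
  have intlnw: "integrable period_square (\<lambda>p. ln (?r p) * ?w p)"
  proof (rule Bochner_Integration.integrable_bound)
    show "integrable period_square (\<lambda>p. (W * W) * ln (?r p))" using int by simp
    have "\<bar>ln (?r p) * ?w p\<bar> \<le> \<bar>(W * W) * ln (?r p)\<bar>" for p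
      using mult_left_mono[OF wb[of p] abs_ge_zero[of "ln (?r p)"]] W0 by (simp add: abs_mult mult_ac)
    then show "AE p in period_square. norm (ln (?r p) * ?w p) \<le> norm ((W * W) * ln (?r p))" by simp
  qed (rule borel_measurable_period_square, measurable)
  \<comment> \<open>The inner integral of the absolute value is |ln r| times the absolute weight, so
    joint integrability reduces to that of the logarithmic kernel.\<close>
  have F: "integrable (period_square \<Otimes>\<^sub>M lborel) (\<lambda>(p, x). ?f p x * ?w p)"
  proof (rule period_square_lborel.Fubini_integrable)
    show "(\<lambda>(p, x). ?f p x * ?w p) \<in> borel_measurable (period_square \<Otimes>\<^sub>M lborel)"
      by (rule borel_measurable_period_square_lborel) measurable
    have "AE p in period_square. (\<integral>x. norm (case (p, x) of (p, x) \<Rightarrow> ?f p x * ?w p) \<partial>lborel) = \<bar>ln (?r p) * ?w p\<bar>"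
      using fr
    proof eventually_elim
      case (elim p)
      have "(\<integral>x. norm (case (p, x) of (p, x) \<Rightarrow> ?f p x * ?w p) \<partial>lborel) = (\<integral>x. \<bar>?f p x\<bar> * \<bar>?w p\<bar> \<partial>lborel)"
        by (intro Bochner_Integration.integral_cong) (simp_all only: prod.case real_norm_def abs_mult)
      also have "\<dots> = \<bar>ln (?r p)\<bar> * \<bar>?w p\<bar>"
        using elim by (simp only: integral_mult_left_zero has_bochner_integral_iff)
      finally show ?case by (simp only: abs_mult)
    qed
    moreover have "(\<lambda>p. (\<integral>x. norm (case (p, x) of (p, x) \<Rightarrow> ?f p x * ?w p) \<partial>lborel)) \<in> borel_measurable period_square"
      by (rule borel_measurable_period_square) measurable
    ultimately show "integrable period_square (\<lambda>p. (\<integral>x. norm (case (p, x) of (p, x) \<Rightarrow> ?f p x * ?w p) \<partial>lborel))"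
      using integrable_abs[OF intlnw] by (subst integrable_cong_AE[where g = "\<lambda>p. \<bar>ln (?r p) * ?w p\<bar>"]) auto
    show "AE p in period_square. integrable lborel (\<lambda>x. case (p, x) of (p, x) \<Rightarrow> ?f p x * ?w p)"
      using fr by eventually_elim (simp only: prod.case has_bochner_integral_iff Bochner_Integration.integrable_mult_left)
  qed
  have G: "(\<integral>p. ?f p x * ?w p \<partial>period_square) =
      indicator {0<..} x * ((gauss_form \<Gamma>\<^sub>1 \<Gamma>\<^sub>2 w\<^sub>1 w\<^sub>2 x - exp (- x) * (m\<^sub>1 * m\<^sub>2)) / (2 * x))" for x
  proof (cases "0 < x")
    case True
    have i1: "integrable period_square (\<lambda>p. exp (- x * (?r p)\<^sup>2) * ?w p)"
      using W True by (intro gauss_form_integrable) auto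
    have iw: "integrable period_measure w\<^sub>1" "integrable period_measure w\<^sub>2"
      using W by (auto intro!: period.integrable_bounded)
    note m = integral_period_square_mult[OF iw]
    have "(\<integral>p. ?f p x * ?w p \<partial>period_square) =
        (\<integral>p. (exp (- x * (?r p)\<^sup>2) * ?w p - exp (- x) * ?w p) / (2 * x) \<partial>period_square)"
      using True by (intro Bochner_Integration.integral_cong) (auto simp: field_simps)
    also have "\<dots> = (gauss_form \<Gamma>\<^sub>1 \<Gamma>\<^sub>2 w\<^sub>1 w\<^sub>2 x - exp (- x) * (m\<^sub>1 * m\<^sub>2)) / (2 * x)"
      using i1 m by (simp add: gauss_form_def m\<^sub>1_def m\<^sub>2_def)
    finally show ?thesis using True by simp
  qed simp
  have "integrable lborel (\<lambda>x. \<integral>p. ?f p x * ?w p \<partial>period_square)"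
    by (rule period_square_lborel.integrable_snd[OF F])
  moreover have "(\<integral>x. (\<integral>p. ?f p x * ?w p \<partial>period_square) \<partial>lborel) = (\<integral>p. (\<integral>x. ?f p x * ?w p \<partial>lborel) \<partial>period_square)"
    by (rule period_square_lborel.Fubini_integral[OF F])
  moreover have "(\<integral>p. (\<integral>x. ?f p x * ?w p \<partial>lborel) \<partial>period_square) = (\<integral>p. - (ln (?r p) * ?w p) \<partial>period_square)"
  proof (rule integral_cong_AE)
    show "AE p in period_square. (\<integral>x. ?f p x * ?w p \<partial>lborel) = - (ln (?r p) * ?w p)"
      using fr by eventually_elim (simp only: integral_mult_left_zero has_bochner_integral_iff minus_mult_left)
  qed ((rule borel_measurable_period_square, measurable)[1])+
  ultimately show ?thesis
    by (simp only: G has_bochner_integral_iff Bochner_Integration.integral_minus simp_thms)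
qed

text \<open>The coefficients of the expansion \<open>exp (- x \<bar>z - w\<bar>\<^sup>2) =
  (\<Sum>j k. c\<^sub>j c\<^sub>k \<phi>\<^sub>j\<^sub>k(z) \<phi>\<^sub>j\<^sub>k(w))\<close> with \<open>c\<^sub>j = (2 x)\<^sup>j / j!\<close>
  and \<open>\<phi>\<^sub>j\<^sub>k(z) = exp (- x \<bar>z\<bar>\<^sup>2) (Re z)\<^sup>j (Im z)\<^sup>k\<close>, paired with the density \<open>w\<close>.\<close>

definition gauss_moment :: "(real \<Rightarrow> complex) \<Rightarrow> (real \<Rightarrow> real) \<Rightarrow> real \<Rightarrow> nat \<Rightarrow> nat \<Rightarrow> real" where
  "gauss_moment \<Gamma> w x j k =
    (\<integral>t. w t * exp (- x * (cmod (\<Gamma> t))\<^sup>2) * Re (\<Gamma> t) ^ j * Im (\<Gamma> t) ^ k \<partial>period_measure)"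

text \<open>In |z - w|^2 only the products Re z Re w and Im z Im w couple the two points; expanding
  their exponentials separates the variables. Boundedness of the curves gives the bound exp (2 x
  B^2) for all partial sums, so dominated convergence applies.\<close>

lemma gauss_form_LIMSEQ:
  assumes [measurable]: "\<Gamma>\<^sub>1 \<in> borel_measurable borel" "\<Gamma>\<^sub>2 \<in> borel_measurable borel"
    "w\<^sub>1 \<in> borel_measurable borel" "w\<^sub>2 \<in> borel_measurable borel"
    and W: "\<And>t. \<bar>w\<^sub>1 t\<bar> \<le> W" "\<And>t. \<bar>w\<^sub>2 t\<bar> \<le> W"
    and B: "\<And>t. cmod (\<Gamma>\<^sub>1 t) \<le> B" "\<And>t. cmod (\<Gamma>\<^sub>2 t) \<le> B"
    and x: "0 \<le> x"
  shows "(\<lambda>n. \<Sum>j<n. \<Sum>k<n. ((2 * x) ^ j / fact j) * ((2 * x) ^ k / fact k) *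
      (gauss_moment \<Gamma>\<^sub>1 w\<^sub>1 x j k * gauss_moment \<Gamma>\<^sub>2 w\<^sub>2 x j k))
    \<longlonglongrightarrow> gauss_form \<Gamma>\<^sub>1 \<Gamma>\<^sub>2 w\<^sub>1 w\<^sub>2 x"
proof -
  define c where "c = (\<lambda>j. (2 * x) ^ j / fact j)"
  define E where "E = (\<lambda>n y. \<Sum>j<n. (2 * x) ^ j / fact j * y ^ j :: real)"
  define \<phi> where "\<phi> = (\<lambda>\<Gamma> w j k t. w t * exp (- x * (cmod (\<Gamma> t))\<^sup>2) * Re (\<Gamma> (t :: real)) ^ j * Im (\<Gamma> t) ^ k :: real)"
  define S where "S = (\<lambda>n p. (w\<^sub>1 (fst p) * exp (- x * (cmod (\<Gamma>\<^sub>1 (fst p)))\<^sup>2)) * (w\<^sub>2 (snd p) * exp (- x * (cmod (\<Gamma>\<^sub>2 (snd p)))\<^sup>2)) *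
      (E n (Re (\<Gamma>\<^sub>1 (fst p)) * Re (\<Gamma>\<^sub>2 (snd p))) * E n (Im (\<Gamma>\<^sub>1 (fst p)) * Im (\<Gamma>\<^sub>2 (snd p)))))"
  have W0: "0 \<le> W" using W(1)[of 0] by linarith
  have B0: "0 \<le> B" using B(1)[of 0] norm_ge_zero order_trans by blast
  have c0: "0 \<le> c j" for j using x by (simp add: c_def)
  have E_lim: "(\<lambda>n. E n y) \<longlonglongrightarrow> exp (2 * x * y)" for y
  proof -
    have "(\<lambda>j. (2 * x * y) ^ j /\<^sub>R fact j) sums exp (2 * x * y)" by (rule exp_converges)
    then show ?thesis
      by (simp add: sums_def E_def power_mult_distrib divide_inverse mult_ac)
  qed
  have E_bound: "\<bar>E n y\<bar> \<le> exp (2 * x * B\<^sup>2)" if "\<bar>y\<bar> \<le> B\<^sup>2" for n y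
  proof -
    have "\<bar>E n y\<bar> \<le> (\<Sum>j<n. \<bar>(2 * x) ^ j / fact j * y ^ j\<bar>)" unfolding E_def by (rule sum_abs)
    also have "\<dots> \<le> (\<Sum>j<n. (2 * x * B\<^sup>2) ^ j /\<^sub>R fact j)"
    proof (rule sum_mono)
      fix j
      have "\<bar>y\<bar> ^ j \<le> (B\<^sup>2) ^ j" using that by (rule power_mono) simp
      then have "c j * \<bar>y\<bar> ^ j \<le> c j * (B\<^sup>2) ^ j" using c0 by (rule mult_left_mono)
      then show "\<bar>(2 * x) ^ j / fact j * y ^ j\<bar> \<le> (2 * x * B\<^sup>2) ^ j /\<^sub>R fact j"
        using x by (simp add: c_def abs_mult power_abs power_mult_distrib divide_inverse mult_ac)
    qed
    also have "\<dots> \<le> exp (2 * x * B\<^sup>2)"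
      unfolding exp_def using x summable_exp_generic[of "2 * x * B\<^sup>2"]
      by (intro sum_le_suminf) auto
    finally show ?thesis .
  qed
  have S_lim: "(\<lambda>n. S n p) \<longlonglongrightarrow> exp (- x * (cmod (\<Gamma>\<^sub>1 (fst p) - \<Gamma>\<^sub>2 (snd p)))\<^sup>2) * (w\<^sub>1 (fst p) * w\<^sub>2 (snd p))" for p
  proof -
    let ?z = "\<Gamma>\<^sub>1 (fst p)" and ?w = "\<Gamma>\<^sub>2 (snd p)"
    have "exp (- x * (cmod (?z - ?w))\<^sup>2) = exp (- x * (cmod ?z)\<^sup>2 + - x * (cmod ?w)\<^sup>2 + (2 * x * (Re ?z * Re ?w) + 2 * x * (Im ?z * Im ?w)))"
      by (rule arg_cong[where f = exp]) (simp add: cmod_power2 power2_diff algebra_simps)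
    also have "\<dots> = exp (- x * (cmod ?z)\<^sup>2) * exp (- x * (cmod ?w)\<^sup>2) * (exp (2 * x * (Re ?z * Re ?w)) * exp (2 * x * (Im ?z * Im ?w)))"
      by (simp only: exp_add)
    finally have eq: "exp (- x * (cmod (?z - ?w))\<^sup>2) * (w\<^sub>1 (fst p) * w\<^sub>2 (snd p)) =
        (w\<^sub>1 (fst p) * exp (- x * (cmod ?z)\<^sup>2)) * (w\<^sub>2 (snd p) * exp (- x * (cmod ?w)\<^sup>2)) *
        (exp (2 * x * (Re ?z * Re ?w)) * exp (2 * x * (Im ?z * Im ?w)))"
      by (simp only: mult_ac)
    show ?thesis unfolding S_def eq by (intro tendsto_intros E_lim)
  qed
  have S_bound: "\<bar>S n p\<bar> \<le> (W * W) * (exp (2 * x * B\<^sup>2) * exp (2 * x * B\<^sup>2))" for n p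
  proof -
    have w: "\<bar>w * exp (- x * (cmod z)\<^sup>2)\<bar> \<le> W" if "\<bar>w\<bar> \<le> W" for w z
    proof -
      have "\<bar>w\<bar> * exp (- x * (cmod z)\<^sup>2) \<le> W * 1"
        using that x by (rule_tac mult_mono) auto
      then show ?thesis by (simp add: abs_mult)
    qed
    have prod: "\<bar>a * b\<bar> \<le> B\<^sup>2" if "\<bar>a\<bar> \<le> B" "\<bar>b\<bar> \<le> B" for a b
      unfolding abs_mult power2_eq_square using that B0 by (rule_tac mult_mono) auto
    have re: "\<bar>Re (\<Gamma>\<^sub>1 (fst p)) * Re (\<Gamma>\<^sub>2 (snd p))\<bar> \<le> B\<^sup>2"
      by (intro prod order_trans[OF abs_Re_le_cmod] B)
    have im: "\<bar>Im (\<Gamma>\<^sub>1 (fst p)) * Im (\<Gamma>\<^sub>2 (snd p))\<bar> \<le> B\<^sup>2"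
      by (intro prod order_trans[OF abs_Im_le_cmod] B)
    show ?thesis
      unfolding S_def abs_mult[of "_ * _" "_ * _"] abs_mult[of "w\<^sub>1 _ * _"] abs_mult[of "E _ _"]
      by (intro mult_mono w W E_bound re im) (use W0 in auto)
  qed
  have S_meas: "S n \<in> borel_measurable period_square" for n
    unfolding S_def E_def by (rule borel_measurable_period_square) measurable
  have lim: "(\<lambda>n. \<integral>p. S n p \<partial>period_square) \<longlonglongrightarrow> gauss_form \<Gamma>\<^sub>1 \<Gamma>\<^sub>2 w\<^sub>1 w\<^sub>2 x"
    unfolding gauss_form_def
  proof (rule integral_dominated_convergence[where w = "\<lambda>_. (W * W) * (exp (2 * x * B\<^sup>2) * exp (2 * x * B\<^sup>2))"])
    show "(\<lambda>p. exp (- x * (cmod (\<Gamma>\<^sub>1 (fst p) - \<Gamma>\<^sub>2 (snd p)))\<^sup>2) * (w\<^sub>1 (fst p) * w\<^sub>2 (snd p))) \<in> borel_measurable period_square"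
      by (rule borel_measurable_period_square) measurable
    show "AE p in period_square. norm (S n p) \<le> (W * W) * (exp (2 * x * B\<^sup>2) * exp (2 * x * B\<^sup>2))" for n
      using S_bound[of n] by (simp only: real_norm_def) simp
  qed (use S_meas S_lim in auto)
  have \<phi>_int: "integrable period_measure (\<phi> \<Gamma> w j k)"
    if [measurable]: "\<Gamma> \<in> borel_measurable borel" "w \<in> borel_measurable borel"
      and b: "\<And>t. \<bar>w t\<bar> \<le> W" "\<And>t. cmod (\<Gamma> t) \<le> B" for \<Gamma> w j k
  proof (rule period.integrable_bounded)
    show "\<phi> \<Gamma> w j k \<in> borel_measurable period_measure"
      unfolding \<phi>_def by (rule borel_measurable_period) measurable
    fix t
    have e: "exp (- x * (cmod (\<Gamma> t))\<^sup>2) \<le> 1" using x by simp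
    have re: "\<bar>Re (\<Gamma> t)\<bar> ^ j \<le> B ^ j" by (intro power_mono order_trans[OF abs_Re_le_cmod] b) simp
    have im: "\<bar>Im (\<Gamma> t)\<bar> ^ k \<le> B ^ k" by (intro power_mono order_trans[OF abs_Im_le_cmod] b) simp
    have "\<bar>w t\<bar> * exp (- x * (cmod (\<Gamma> t))\<^sup>2) * \<bar>Re (\<Gamma> t)\<bar> ^ j * \<bar>Im (\<Gamma> t)\<bar> ^ k \<le> W * 1 * B ^ j * B ^ k"
      by (intro mult_mono b(1) e re im) (use W0 B0 in auto)
    then show "\<bar>\<phi> \<Gamma> w j k t\<bar> \<le> W * 1 * B ^ j * B ^ k"
      by (simp add: \<phi>_def abs_mult power_abs)
  qed
  have int1: "integrable period_measure (\<phi> \<Gamma>\<^sub>1 w\<^sub>1 j k)" and int2: "integrable period_measure (\<phi> \<Gamma>\<^sub>2 w\<^sub>2 j k)" for j k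
    using W B by (auto intro!: \<phi>_int)
  have EE: "E n a * E n b = (\<Sum>j<n. \<Sum>k<n. (c j * a ^ j) * (c k * b ^ k))" for n a b
    unfolding E_def c_def by (rule sum_product)
  have "S n p = (\<Sum>j<n. \<Sum>k<n. (c j * c k) * (\<phi> \<Gamma>\<^sub>1 w\<^sub>1 j k (fst p) * \<phi> \<Gamma>\<^sub>2 w\<^sub>2 j k (snd p)))" for n p
    unfolding S_def EE sum_distrib_left
    by (intro sum.cong refl) (simp add: \<phi>_def c_def power_mult_distrib)
  then have "(\<integral>p. S n p \<partial>period_square) = (\<Sum>j<n. \<Sum>k<n. (c j * c k) * (gauss_moment \<Gamma>\<^sub>1 w\<^sub>1 x j k * gauss_moment \<Gamma>\<^sub>2 w\<^sub>2 x j k))" for n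
    using integral_period_square_mult[OF int1 int2]
    by (simp add: gauss_moment_def \<phi>_def)
  with lim show ?thesis by (simp add: c_def)
qed

text \<open>Both measures are expanded in the same functions with nonnegative weights, so the
  expression is a limit of weighted sums of squares: of the moments of the first measure minus
  \<alpha> times those of the second.\<close>

lemma gauss_form_difference_nonneg:
  assumes "\<Gamma>\<^sub>1 \<in> borel_measurable borel" "\<Gamma>\<^sub>2 \<in> borel_measurable borel"
    "w\<^sub>1 \<in> borel_measurable borel" "w\<^sub>2 \<in> borel_measurable borel"
    and "\<And>t. \<bar>w\<^sub>1 t\<bar> \<le> W" "\<And>t. \<bar>w\<^sub>2 t\<bar> \<le> W"
    and "\<And>t. cmod (\<Gamma>\<^sub>1 t) \<le> B" "\<And>t. cmod (\<Gamma>\<^sub>2 t) \<le> B"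
    and "0 \<le> x"
  shows "0 \<le> gauss_form \<Gamma>\<^sub>1 \<Gamma>\<^sub>1 w\<^sub>1 w\<^sub>1 x - 2 * \<alpha> * gauss_form \<Gamma>\<^sub>1 \<Gamma>\<^sub>2 w\<^sub>1 w\<^sub>2 x + \<alpha>\<^sup>2 * gauss_form \<Gamma>\<^sub>2 \<Gamma>\<^sub>2 w\<^sub>2 w\<^sub>2 x"
proof (rule LIMSEQ_le_const)
  define c where "c = (\<lambda>j. (2 * x) ^ j / fact j)"
  let ?A = "\<lambda>j k. gauss_moment \<Gamma>\<^sub>1 w\<^sub>1 x j k" and ?B = "\<lambda>j k. gauss_moment \<Gamma>\<^sub>2 w\<^sub>2 x j k"
  let ?T = "\<lambda>p q n. \<Sum>j<n. \<Sum>k<n. c j * c k * (p j k * q j k)"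
  show "(\<lambda>n. ?T ?A ?A n - 2 * \<alpha> * ?T ?A ?B n + \<alpha>\<^sup>2 * ?T ?B ?B n) \<longlonglongrightarrow>
      gauss_form \<Gamma>\<^sub>1 \<Gamma>\<^sub>1 w\<^sub>1 w\<^sub>1 x - 2 * \<alpha> * gauss_form \<Gamma>\<^sub>1 \<Gamma>\<^sub>2 w\<^sub>1 w\<^sub>2 x + \<alpha>\<^sup>2 * gauss_form \<Gamma>\<^sub>2 \<Gamma>\<^sub>2 w\<^sub>2 w\<^sub>2 x"
    unfolding c_def using assms by (intro tendsto_intros gauss_form_LIMSEQ)
  have "?T ?A ?A n - 2 * \<alpha> * ?T ?A ?B n + \<alpha>\<^sup>2 * ?T ?B ?B n = (\<Sum>j<n. \<Sum>k<n. c j * c k * (?A j k - \<alpha> * ?B j k)\<^sup>2)" for n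
    by (simp add: sum_distrib_left sum_subtractf[symmetric] sum.distrib[symmetric] power2_eq_square algebra_simps)
  moreover have "0 \<le> c j" for j using assms by (simp add: c_def)
  ultimately show "\<exists>N. \<forall>n\<ge>N. 0 \<le> ?T ?A ?A n - 2 * \<alpha> * ?T ?A ?B n + \<alpha>\<^sup>2 * ?T ?B ?B n"
    by (simp add: sum_nonneg)
qed

lemma has_bochner_integral_le:
  fixes f h :: "'a \<Rightarrow> real"
  assumes "has_bochner_integral M h J" "has_bochner_integral M f I" "\<And>x. f x \<le> h x"
  shows "I \<le> J"
  using assms integral_mono[of M f h] by (simp add: has_bochner_integral_iff)

section \<open>Energies of a charge on the loop balanced by a charge on the unit circle\<close>

context bilipschitz_loop
begin

text \<open>\<open>\<Gamma>\<close> is an arbitrary bounded measurable map, so one lemma serves the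
  loop against itself, the loop against the circle, and the circle against itself.\<close>

lemma integrable_log_kernel:
  assumes \<Gamma>: "\<Gamma> \<in> borel_measurable borel" and B: "\<And>t. cmod (\<Gamma> t) \<le> B"
  shows "integrable period_square (\<lambda>p. ln (cmod (\<Gamma> (fst p) - g (snd p))))"
    and "integrable period_square (\<lambda>p. (ln (cmod (\<Gamma> (fst p) - g (snd p))))\<^sup>2)"
    and "AE p in period_square. \<Gamma> (fst p) \<noteq> g (snd p)"
proof -
  note [measurable] = \<Gamma>
  obtain C where C: "\<And>x. cmod x \<le> B \<Longrightarrow> integrable period_measure (\<lambda>s. (ln (cmod (x - g s)))\<^sup>2)"
    "\<And>x. cmod x \<le> B \<Longrightarrow> (\<integral>s. (ln (cmod (x - g s)))\<^sup>2 \<partial>period_measure) \<le> C"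
    by (rule ln_square_bounded[of B]) (rule that)
  show sq: "integrable period_square (\<lambda>p. (ln (cmod (\<Gamma> (fst p) - g (snd p))))\<^sup>2)"
  proof (rule period_pair.Fubini_integrable)
    show "(\<lambda>p. (ln (cmod (\<Gamma> (fst p) - g (snd p))))\<^sup>2) \<in> borel_measurable period_square"
      by (rule borel_measurable_period_square) measurable
    show "integrable period_measure (\<lambda>t. \<integral>s. norm ((ln (cmod (\<Gamma> (fst (t, s)) - g (snd (t, s)))))\<^sup>2) \<partial>period_measure)"
    proof (rule period.integrable_bounded[where B = C])
      have "(\<lambda>p. norm ((ln (cmod (\<Gamma> (fst p) - g (snd p))))\<^sup>2)) \<in> borel_measurable period_square"
        by (rule borel_measurable_period_square) measurable
      then show "(\<lambda>t. \<integral>s. norm ((ln (cmod (\<Gamma> (fst (t, s)) - g (snd (t, s)))))\<^sup>2) \<partial>period_measure) \<in> borel_measurable period_measure"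
        by (intro period.borel_measurable_lebesgue_integral) (simp add: case_prod_beta)
      show "\<bar>\<integral>s. norm ((ln (cmod (\<Gamma> (fst (t, s)) - g (snd (t, s)))))\<^sup>2) \<partial>period_measure\<bar> \<le> C" for t
        using C(2)[OF B[of t]] by (simp add: abs_of_nonneg integral_nonneg)
    qed
    show "AE t in period_measure. integrable period_measure (\<lambda>s. (ln (cmod (\<Gamma> (fst (t, s)) - g (snd (t, s)))))\<^sup>2)"
      using C(1)[OF B] by simp
  qed
  show "integrable period_square (\<lambda>p. ln (cmod (\<Gamma> (fst p) - g (snd p))))"
  proof (rule Bochner_Integration.integrable_bound)
    show "integrable period_square (\<lambda>p. (ln (cmod (\<Gamma> (fst p) - g (snd p))))\<^sup>2 + 1)" using sq by simp
    show "(\<lambda>p. ln (cmod (\<Gamma> (fst p) - g (snd p)))) \<in> borel_measurable period_square"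
      by (rule borel_measurable_period_square) measurable
    have "\<bar>y\<bar> \<le> \<bar>y\<^sup>2 + 1\<bar>" for y :: real
      using mult_le_weighted_squares[of 1 y 1] by simp
    then show "AE p in period_square. norm (ln (cmod (\<Gamma> (fst p) - g (snd p)))) \<le>
        norm ((ln (cmod (\<Gamma> (fst p) - g (snd p))))\<^sup>2 + 1)" by simp
  qed
  show "AE p in period_square. \<Gamma> (fst p) \<noteq> g (snd p)"
  proof (rule period_pair.AE_pair_measure)
    have "{p \<in> space (borel \<Otimes>\<^sub>M borel). \<Gamma> (fst p) \<noteq> g (snd p)} \<in> sets (borel \<Otimes>\<^sub>M borel :: (real \<times> real) measure)"
      by measurable
    from measurable_sets[OF measurable_ident_period_square this]
    show "{p \<in> space period_square. \<Gamma> (fst p) \<noteq> g (snd p)} \<in> sets period_square"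
      by (simp add: space_pair_measure Int_def vimage_def) (simp add: conj_commute)
    show "AE t in period_measure. AE s in period_measure. \<Gamma> (fst (t, s)) \<noteq> g (snd (t, s))"
    proof (rule AE_I2)
      fix t
      show "AE s in period_measure. \<Gamma> (fst (t, s)) \<noteq> g (snd (t, s))"
        using AE_neq[of "\<Gamma> t"] by (auto elim!: eventually_mono)
    qed
  qed
qed

text \<open>
  The Gaussian and the logarithmic energy of the signed measure \<open>u ds - m/(2\<pi>) d\<theta>\<close> of total
  mass \<open>0\<close>, where \<open>m = \<integral> u\<close> and \<open>d\<theta>\<close> lives on the unit circle about \<open>z0\<close>. The
  circle has logarithmic potential \<open>2\<pi> max 0 (ln \<bar>x - z0\<bar>)\<close> and no self-energy.
\<close>

definition gauss_energy :: "complex \<Rightarrow> (real \<Rightarrow> real) \<Rightarrow> real \<Rightarrow> real" where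
  "gauss_energy z0 u x = (let \<alpha> = (\<integral>t. u t \<partial>period_measure) / (2 * pi) in
    gauss_form g g u u x - 2 * \<alpha> * gauss_form g (\<lambda>t. z0 + cis t) u (\<lambda>_. 1) x
    + \<alpha>\<^sup>2 * gauss_form (\<lambda>t. z0 + cis t) (\<lambda>t. z0 + cis t) (\<lambda>_. 1) (\<lambda>_. 1) x)"

definition log_energy :: "complex \<Rightarrow> (real \<Rightarrow> real) \<Rightarrow> real" where
  "log_energy z0 u =
    - (\<integral>p. ln (cmod (g (fst p) - g (snd p))) * (u (fst p) * u (snd p)) \<partial>period_square)
    + 2 * (\<integral>t. u t \<partial>period_measure) * (\<integral>t. max 0 (ln (cmod (g t - z0))) * u t \<partial>period_measure)"

lemma gauss_energy_nonneg:
  assumes "u \<in> borel_measurable borel" and W: "\<And>t. \<bar>u t\<bar> \<le> W" and "0 \<le> x"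
  shows "0 \<le> gauss_energy z0 u x"
proof -
  obtain R where R: "0 < R" "\<And>s. cmod (g s) \<le> R" by (rule g_bounded) blast
  have "cmod (g t) \<le> R + cmod z0 + 1" "cmod (z0 + cis t) \<le> R + cmod z0 + 1"
    "\<bar>u t\<bar> \<le> max W 1" "\<bar>1::real\<bar> \<le> max W 1" for t
    using R(1) R(2)[of t] norm_triangle_ineq[of z0 "cis t"] W[of t] by (auto intro: order_trans)
  then show ?thesis
    unfolding gauss_energy_def Let_def using assms by (intro gauss_form_difference_nonneg) auto
qed

text \<open>The factor \<alpha> makes the masses cancel, so the exp (- x) terms of the three
  Frullani identities drop out and only the Gaussian energies remain.\<close>

lemma log_energy_eq_integral_gauss_energy:
  assumes u: "u \<in> borel_measurable borel" and W: "\<And>t. \<bar>u t\<bar> \<le> W"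
    and z0: "\<And>t. cmod (g t - z0) \<noteq> 1"
  shows "has_bochner_integral lborel (\<lambda>x. indicator {0<..} x * (gauss_energy z0 u x / (2 * x))) (log_energy z0 u)"
proof -
  define \<alpha> where "\<alpha> = (\<integral>t. u t \<partial>period_measure) / (2 * pi)"
  define \<Gamma> where "\<Gamma> = (\<lambda>t. z0 + cis t)"
  obtain R where R: "0 < R" "\<And>s. cmod (g s) \<le> R" by (rule g_bounded) blast
  define B where "B = R + cmod z0 + 1"
  have B: "cmod (g t) \<le> B" "cmod (\<Gamma> t) \<le> B" "cmod (g t - z0) \<le> B" for t
    using R(1) R(2)[of t] norm_triangle_ineq[of z0 "cis t"] norm_triangle_ineq4[of "g t" z0]
    by (auto simp: B_def \<Gamma>_def intro: order_trans)
  define V where "V = max W 1"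
  have V: "\<bar>u t\<bar> \<le> V" "\<bar>1::real\<bar> \<le> V" for t using W[of t] by (auto simp: V_def)
  have m\<Gamma> [measurable]: "\<Gamma> \<in> borel_measurable borel" unfolding \<Gamma>_def by measurable
  note [measurable] = u
  note ker_gg = integrable_log_kernel[OF g_measurable R(2)]
  have ker_gc: "integrable period_square (\<lambda>p. ln (cmod (g (fst p) - \<Gamma> (snd p))))"
    "AE p in period_square. g (fst p) \<noteq> \<Gamma> (snd p)"
    using circle.integrable_log_kernel[of "\<lambda>t. g t - z0", OF _ B(3)]
    by (auto simp: \<Gamma>_def algebra_simps elim!: eventually_mono)
  have ker_cc: "integrable period_square (\<lambda>p. ln (cmod (\<Gamma> (fst p) - \<Gamma> (snd p))))"
    "AE p in period_square. \<Gamma> (fst p) \<noteq> \<Gamma> (snd p)"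
    using circle.integrable_log_kernel[of cis 1] by (auto simp: \<Gamma>_def elim!: eventually_mono)
  let ?Lgg = "\<integral>p. ln (cmod (g (fst p) - g (snd p))) * (u (fst p) * u (snd p)) \<partial>period_square"
  let ?Lgc = "\<integral>p. ln (cmod (g (fst p) - \<Gamma> (snd p))) * (u (fst p) * 1) \<partial>period_square"
  let ?Lcc = "\<integral>p. ln (cmod (\<Gamma> (fst p) - \<Gamma> (snd p))) * (1 * 1) \<partial>period_square"
  let ?Q = "\<lambda>x. gauss_form g g u u x - 2 * \<alpha> * gauss_form g \<Gamma> u (\<lambda>_. 1) x + \<alpha>\<^sup>2 * gauss_form \<Gamma> \<Gamma> (\<lambda>_. 1) (\<lambda>_. 1) x"
  have one: "(\<lambda>_. 1) \<in> borel_measurable borel" by simp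
  have mass: "(\<integral>t. u t \<partial>period_measure) = \<alpha> * (\<integral>t. 1 \<partial>period_measure)" by (simp add: \<alpha>_def)
  have combine: "i * ((q\<^sub>1 - e * (M * M)) / d) - 2 * \<alpha> * (i * ((q\<^sub>2 - e * (M * N)) / d)) + \<alpha>\<^sup>2 * (i * ((q\<^sub>3 - e * (N * N)) / d))
      = i * ((q\<^sub>1 - 2 * \<alpha> * q\<^sub>2 + \<alpha>\<^sup>2 * q\<^sub>3) / d)" if "M = \<alpha> * N" for i q\<^sub>1 q\<^sub>2 q\<^sub>3 e M N d :: real
    by (simp add: that divide_inverse algebra_simps power2_eq_square)
  note e_gg = log_energy_eq_integral_gauss_form[OF g_measurable g_measurable u u V(1) V(1) ker_gg(1,3)]
  note e_gc = log_energy_eq_integral_gauss_form[OF g_measurable m\<Gamma> u one V(1) V(2) ker_gc]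
  note e_cc = log_energy_eq_integral_gauss_form[OF m\<Gamma> m\<Gamma> one one V(2) V(2) ker_cc]
  have H: "has_bochner_integral lborel (\<lambda>x. indicator {0<..} x * (?Q x / (2 * x)))
      ((- ?Lgg) - 2 * \<alpha> * (- ?Lgc) + \<alpha>\<^sup>2 * (- ?Lcc))"
    using has_bochner_integral_add[OF has_bochner_integral_diff[OF e_gg has_bochner_integral_mult_right[OF e_gc, of "2 * \<alpha>"]]
        has_bochner_integral_mult_right[OF e_cc, of "\<alpha>\<^sup>2"]]
    by (rule has_bochner_integral_cong[THEN iffD1, rotated 3]) (simp_all only: combine[OF mass])
  have "?Lcc = 0"
  proof -
    have "?Lcc = (\<integral>t. (\<integral>s. ln (cmod (\<Gamma> t - \<Gamma> s)) \<partial>period_measure) \<partial>period_measure)"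
      using period_pair.integral_fst'[OF ker_cc(1)] by simp
    also have "\<dots> = (\<integral>t. circle.logpot (\<lambda>_. 1::real) (cis t) \<partial>period_measure)"
      by (simp add: circle.logpot_def \<Gamma>_def)
    also have "\<dots> = 0" by (simp add: circle_logpot_unit_disc)
    finally show ?thesis .
  qed
  moreover have "?Lgc = 2 * pi * (\<integral>t. max 0 (ln (cmod (g t - z0))) * u t \<partial>period_measure)"
  proof -
    have inner: "(\<integral>s. ln (cmod (g t - \<Gamma> s)) \<partial>period_measure) = 2 * pi * max 0 (ln (cmod (g t - z0)))" for t
    proof -
      have "(\<integral>s. ln (cmod (g t - \<Gamma> s)) \<partial>period_measure) = circle.logpot (\<lambda>_. 1::real) (g t - z0)"
        by (simp add: circle.logpot_def \<Gamma>_def algebra_simps)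
      also have "\<dots> = 2 * pi * max 0 (ln (cmod (g t - z0)))"
      proof (cases "cmod (g t - z0) \<le> 1")
        case True
        \<comment> \<open>At the centre the convention \<open>ln 0 = 0\<close> gives the right value
          0.\<close>
        then show ?thesis by (cases "cmod (g t - z0) = 0") (auto simp: circle_logpot_unit_disc max_def)
      next
        case False
        then show ?thesis by (auto simp: circle_logpot_outside max_def)
      qed
      finally show ?thesis .
    qed
    have "integrable period_square (\<lambda>p. ln (cmod (g (fst p) - \<Gamma> (snd p))) * (u (fst p) * 1))"
    proof (rule Bochner_Integration.integrable_bound)
      show "integrable period_square (\<lambda>p. V * ln (cmod (g (fst p) - \<Gamma> (snd p))))" using ker_gc(1) by simp
      show "(\<lambda>p. ln (cmod (g (fst p) - \<Gamma> (snd p))) * (u (fst p) * 1)) \<in> borel_measurable period_square"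
        by (rule borel_measurable_period_square) measurable
      have "\<bar>y * (u t * 1)\<bar> \<le> \<bar>V * y\<bar>" for y t
        using mult_left_mono[OF V(1)[of t] abs_ge_zero[of y]] V(2) by (simp add: abs_mult mult.commute)
      then show "AE p in period_square. norm (ln (cmod (g (fst p) - \<Gamma> (snd p))) * (u (fst p) * 1)) \<le>
          norm (V * ln (cmod (g (fst p) - \<Gamma> (snd p))))"
        by (simp only: real_norm_def) simp
    qed
    from period_pair.integral_fst'[OF this]
    have "?Lgc = (\<integral>t. (\<integral>s. ln (cmod (g t - \<Gamma> s)) * (u t * 1) \<partial>period_measure) \<partial>period_measure)" by simp
    also have "\<dots> = (\<integral>t. 2 * pi * (max 0 (ln (cmod (g t - z0))) * u t) \<partial>period_measure)"
      by (simp only: integral_mult_left_zero inner mult_1_right mult.assoc)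
    finally show ?thesis by simp
  qed
  ultimately have "log_energy z0 u = (- ?Lgg) - 2 * \<alpha> * (- ?Lgc) + \<alpha>\<^sup>2 * (- ?Lcc)"
    by (simp only: log_energy_def) (simp add: \<alpha>_def)
  moreover have "gauss_energy z0 u x = ?Q x" for x
    by (simp only: gauss_energy_def Let_def \<alpha>_def \<Gamma>_def)
  ultimately show ?thesis using H by (simp only:)
qed

text \<open>All Gaussian energies are nonnegative, so only [a, 2 a] is kept. It has length
  \<open>a\<close>, and 1/(2 x) \<ge> 1/(4 a) there, which gives the factor 1/4 whatever
  \<open>a\<close> is.\<close>

lemma log_energy_lower_bound:
  assumes "u \<in> borel_measurable borel" "\<And>t. \<bar>u t\<bar> \<le> W"
    and "v \<in> borel_measurable borel" "\<And>t. \<bar>v t\<bar> \<le> W"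
    and z0: "\<And>t. cmod (g t - z0) \<noteq> 1" and a: "0 < a" and \<kappa>: "0 \<le> \<kappa>"
    and gain: "\<And>x. x \<in> {a..2 * a} \<Longrightarrow> \<kappa> \<le> gauss_energy z0 u x + gauss_energy z0 v x"
  shows "\<kappa> / 4 \<le> log_energy z0 u + log_energy z0 v"
proof (rule has_bochner_integral_le)
  let ?Q = "\<lambda>x. gauss_energy z0 u x + gauss_energy z0 v x"
  show "has_bochner_integral lborel (\<lambda>x. indicator {0<..} x * (gauss_energy z0 u x / (2 * x)) +
      indicator {0<..} x * (gauss_energy z0 v x / (2 * x))) (log_energy z0 u + log_energy z0 v)"
    using assms by (intro has_bochner_integral_add log_energy_eq_integral_gauss_energy) auto
  show "has_bochner_integral lborel (\<lambda>x. indicator {a..2 * a} x * (\<kappa> / (4 * a))) (\<kappa> / 4)"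
    using has_bochner_integral_mult_left[OF has_bochner_integral_real_indicator[of "{a..2 * a}" lborel], of "\<kappa> / (4 * a)"] a
    by simp
  fix x
  have "indicator {a..2 * a} x * (\<kappa> / (4 * a)) \<le> indicator {0<..} x * (?Q x / (2 * x))"
  proof (cases "x \<in> {a..2 * a}")
    case True
    have "\<kappa> / (4 * a) \<le> \<kappa> / (2 * x)" using True a \<kappa> by (intro divide_left_mono) auto
    also have "\<dots> \<le> ?Q x / (2 * x)" using True a gain by (intro divide_right_mono) auto
    finally show ?thesis using True a by simp
  next
    case False
    have "0 \<le> ?Q x" if "0 < x"
      using that assms(1-4) by (intro add_nonneg_nonneg gauss_energy_nonneg) auto
    then show ?thesis using False by (auto simp: indicator_def)
  qed
  then show "indicator {a..2 * a} x * (\<kappa> / (4 * a)) \<le> indicator {0<..} x * (gauss_energy z0 u x / (2 * x)) +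
      indicator {0<..} x * (gauss_energy z0 v x / (2 * x))"
    by (simp add: add_divide_distrib distrib_left)
qed

end

section \<open>Coercivity of the logarithmic energy on low frequencies\<close>

text \<open>Nonnegativity of the variance of |f| over the period.\<close>

lemma cauchy_schwarz_period:
  fixes f :: "real \<Rightarrow> real"
  assumes "f \<in> borel_measurable period_measure" "integrable period_measure (\<lambda>t. (f t)\<^sup>2)"
  shows "(\<integral>t. \<bar>f t\<bar> \<partial>period_measure)\<^sup>2 \<le> 2 * pi * (\<integral>t. (f t)\<^sup>2 \<partial>period_measure)"
proof -
  let ?m = "(\<integral>t. \<bar>f t\<bar> \<partial>period_measure) / (2 * pi)"
  have int: "integrable period_measure (\<lambda>t. \<bar>f t\<bar>)"
    using square_integrable_scaleR[of "\<lambda>_. 1" period_measure f] assms by simp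
  have "0 \<le> (\<integral>t. (\<bar>f t\<bar> - ?m)\<^sup>2 \<partial>period_measure)" by (rule Bochner_Integration.integral_nonneg) simp
  also have "(\<integral>t. (\<bar>f t\<bar> - ?m)\<^sup>2 \<partial>period_measure) = (\<integral>t. (f t)\<^sup>2 + ?m\<^sup>2 - 2 * ?m * \<bar>f t\<bar> \<partial>period_measure)"
    by (intro Bochner_Integration.integral_cong refl) (simp add: power2_diff)
  also have "\<dots> = (\<integral>t. (f t)\<^sup>2 \<partial>period_measure) + 2 * pi * ?m\<^sup>2 - 2 * ?m * (\<integral>t. \<bar>f t\<bar> \<partial>period_measure)"
    using int assms(2) by simp
  also have "\<dots> = (\<integral>t. (f t)\<^sup>2 \<partial>period_measure) - (\<integral>t. \<bar>f t\<bar> \<partial>period_measure)\<^sup>2 / (2 * pi)"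
    by (simp add: power2_eq_square field_simps)
  finally show ?thesis by (simp add: field_simps)
qed

lemma integrable_period_continuous:
  fixes f :: "real \<Rightarrow> 'b::{banach, second_countable_topology}"
  assumes "continuous_on {0..2 * pi} f"
  shows "integrable period_measure f"
  using borel_integrable_compact[OF compact_Icc assms] by (simp add: integrable_restrict_space)

lemma integrable_period_square_continuous:
  fixes f :: "real \<times> real \<Rightarrow> 'b::{banach, second_countable_topology}"
  assumes cont: "continuous_on UNIV f"
  shows "integrable period_square f"
proof -
  have meas: "f \<in> borel_measurable (borel \<Otimes>\<^sub>M borel)"
    unfolding borel_prod by (rule borel_measurable_continuous_onI[OF cont])
  have "compact (f ` ({0..2 * pi} \<times> {0..2 * pi}))"
    by (intro compact_continuous_image continuous_on_subset[OF cont] compact_Times) auto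
  then obtain C where C: "\<forall>x \<in> f ` ({0..2 * pi} \<times> {0..2 * pi}). norm x \<le> C"
    using compact_imp_bounded bounded_iff by metis
  show ?thesis
    by (intro period_square.integrable_const_bound[of _ C] AE_I2 borel_measurable_period_square meas)
      (use C in \<open>auto simp: space_pair_measure\<close>)
qed

text \<open>The order a^(-3/2) is the point. From z (1 + z) \<le> 2 exp z with z = a y^2 the
  integrand is at most (2/a)/(1 + a y^2), whose primitive is an arctangent.\<close>

lemma integral_square_gauss_le:
  fixes a :: real
  assumes "0 < a"
  shows "(\<integral>k. (k - pi)\<^sup>2 * exp (- a * (k - pi)\<^sup>2) \<partial>period_measure) \<le> 2 * pi / (a * sqrt a)"
proof -
  have pt: "y\<^sup>2 * exp (- a * y\<^sup>2) \<le> 2 / a * (1 / (1 + a * y\<^sup>2))" for y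
  proof -
    define z where "z = a * y\<^sup>2"
    have z: "0 \<le> z" using assms by (simp add: z_def)
    have "z * (1 + z) \<le> 2 * (1 + z + z\<^sup>2 / 2)" using z by (simp add: power2_eq_square algebra_simps)
    also have "\<dots> \<le> 2 * exp z" using exp_lower_Taylor_quadratic[OF z] by simp
    finally have "z * exp (- z) \<le> 2 * (1 / (1 + z))"
      using z by (simp add: exp_minus field_simps)
    then have "1 / a * (z * exp (- z)) \<le> 1 / a * (2 * (1 / (1 + z)))"
      using assms by (intro mult_left_mono) auto
    then show ?thesis using assms by (simp add: z_def)
  qed
  have int: "integrable period_measure (\<lambda>k. (k - pi)\<^sup>2 * exp (- a * (k - pi)\<^sup>2))"
    "integrable period_measure (\<lambda>k. 2 / a * (1 / (1 + a * (k - pi)\<^sup>2)))"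
    using assms by (auto intro!: integrable_period_continuous continuous_intros simp: add_nonneg_eq_0_iff)
  have "(\<integral>k. 1 / (1 + a * (k - pi)\<^sup>2) \<partial>period_measure) =
      arctan (sqrt a * (2 * pi - pi)) / sqrt a - arctan (sqrt a * (0 - pi)) / sqrt a"
  proof -
    have "has_bochner_integral lborel (\<lambda>k. (1 / (1 + a * (k - pi)\<^sup>2)) * indicator {0..2 * pi} k)
       (arctan (sqrt a * (2 * pi - pi)) / sqrt a - arctan (sqrt a * (0 - pi)) / sqrt a)"
    proof (rule has_bochner_integral_FTC_Icc_real)
      fix k :: real
      have nz: "1 + (sqrt a * (k - pi))\<^sup>2 \<noteq> 0" by (metis add_cancel_right_left add_nonneg_eq_0_iff one_neq_zero zero_le_one zero_le_power2)
      show "((\<lambda>k. arctan (sqrt a * (k - pi)) / sqrt a) has_real_derivative 1 / (1 + a * (k - pi)\<^sup>2)) (at k)"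
        using assms nz by (auto intro!: derivative_eq_intros simp: power_mult_distrib inverse_eq_divide)
      show "isCont (\<lambda>k. 1 / (1 + a * (k - pi)\<^sup>2)) k"
        using assms nz by (intro continuous_intros) (simp add: power_mult_distrib)
    qed simp
    then show ?thesis
      by (simp add: has_bochner_integral_iff integral_restrict_space mult.commute)
  qed
  also have "\<dots> \<le> pi / sqrt a"
  proof -
    have "arctan (sqrt a * (2 * pi - pi)) - arctan (sqrt a * (0 - pi)) \<le> pi / 2 - (- (pi / 2))"
      by (intro diff_mono less_imp_le arctan_ubound arctan_lbound)
    then show ?thesis using assms by (simp add: diff_divide_distrib[symmetric] divide_right_mono)
  qed
  finally have "2 / a * (\<integral>k. 1 / (1 + a * (k - pi)\<^sup>2) \<partial>period_measure) \<le> 2 / a * (pi / sqrt a)"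
    using assms by (intro mult_left_mono) auto
  moreover have "(\<integral>k. (k - pi)\<^sup>2 * exp (- a * (k - pi)\<^sup>2) \<partial>period_measure) \<le> (\<integral>k. 2 / a * (1 / (1 + a * (k - pi)\<^sup>2)) \<partial>period_measure)"
    using int pt by (intro integral_mono) auto
  moreover have "(\<integral>k. 2 / a * (1 / (1 + a * (k - pi)\<^sup>2)) \<partial>period_measure) = 2 / a * (\<integral>k. 1 / (1 + a * (k - pi)\<^sup>2) \<partial>period_measure)" by (rule integral_mult_right_zero)
  ultimately show ?thesis by simp
qed

section \<open>Lower bounds for the Gaussian form at large parameter\<close>

context bilipschitz_loop
begin

text \<open>On a parameter interval of length 1/sqrt x next to \<open>t\<close> the Lipschitz bound
  keeps the exponent above - L^2.\<close>

lemma gauss_kernel_mean_lower_bound: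
  assumes L: "\<And>t s. t \<in> {0..2 * pi} \<Longrightarrow> s \<in> {0..2 * pi} \<Longrightarrow> cmod (g t - g s) \<le> L * \<bar>t - s\<bar>"
    and L0: "0 \<le> L" and t: "t \<in> {0..2 * pi}" and x: "1 \<le> x"
  shows "exp (- L\<^sup>2) / sqrt x \<le> (\<integral>s. exp (- x * (cmod (g t - g s))\<^sup>2) \<partial>period_measure)"
proof -
  define d where "d = 1 / sqrt x"
  have d: "0 < d" "d \<le> 1" "x * d\<^sup>2 = 1" using x by (auto simp: d_def power_divide)
  have d_pi: "d \<le> pi" using d(2) pi_gt3 by linarith
  \<comment> \<open>The interval extends to the right of \<open>t\<close> in the first half of the
    period and to the left in the second, so it stays inside because d \<le> 1 < pi.\<close>
  define J where "J = (if t \<le> pi then {t..t + d} else {t - d..t})"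
  have J: "J \<subseteq> {0..2 * pi}" "\<And>s. s \<in> J \<Longrightarrow> \<bar>t - s\<bar> \<le> d"
    using t d d_pi by (auto simp: J_def split: if_splits)
  have mJ: "measure lborel J = d" using d by (auto simp: J_def)
  have le: "indicator J s * exp (- L\<^sup>2) \<le> exp (- x * (cmod (g t - g s))\<^sup>2)" for s
  proof (cases "s \<in> J")
    case True
    have "cmod (g t - g s) \<le> L * d"
    proof -
      have "cmod (g t - g s) \<le> L * \<bar>t - s\<bar>" using L[OF t] J(1) True by blast
      also have "\<dots> \<le> L * d" using J(2) True L0 by (intro mult_left_mono) auto
      finally show ?thesis .
    qed
    then have "(cmod (g t - g s))\<^sup>2 \<le> (L * d)\<^sup>2" by (intro power_mono) auto
    then have "x * (cmod (g t - g s))\<^sup>2 \<le> x * (L * d)\<^sup>2" using x by (intro mult_left_mono) auto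
    also have "\<dots> = L\<^sup>2" using d(3) by (simp add: power_mult_distrib mult.left_commute)
    finally show ?thesis using True by simp
  qed simp
  have int: "integrable period_measure (\<lambda>s. exp (- x * (cmod (g t - g s))\<^sup>2))"
    by (intro integrable_period_continuous continuous_intros continuous_on_subset[OF cont]) auto
  have intJ: "integrable period_measure (\<lambda>s. indicator J s * exp (- L\<^sup>2))"
  proof (rule period.integrable_bounded[where B = 1])
    have [measurable]: "J \<in> sets borel" by (auto simp: J_def)
    show "(\<lambda>s. indicator J s * exp (- L\<^sup>2)) \<in> borel_measurable period_measure"
      by (rule borel_measurable_period) measurable
  qed (auto simp: indicator_def)
  have "exp (- L\<^sup>2) / sqrt x = (\<integral>s. indicator J s * exp (- L\<^sup>2) \<partial>period_measure)"
  proof -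
    have "(\<integral>s. indicator J s * exp (- L\<^sup>2) \<partial>period_measure) = (\<integral>s. indicator J s * exp (- L\<^sup>2) \<partial>lborel)"
      using J by (auto simp: integral_restrict_space indicator_def intro!: Bochner_Integration.integral_cong)
    also have "\<dots> = d * exp (- L\<^sup>2)" using mJ by (auto simp: J_def)
    finally show ?thesis by (simp add: d_def)
  qed
  also have "\<dots> \<le> (\<integral>s. exp (- x * (cmod (g t - g s))\<^sup>2) \<partial>period_measure)"
    using int intJ le by (intro integral_mono) auto
  finally show ?thesis .
qed

text \<open>Polarisation, Re (a cnj b) = (|a|^2 + |b|^2 - |b - a|^2)/2, separates the form into a
  diagonal part of order 1/sqrt x and an oscillation part. Under the Gaussian the latter is a second
  moment of the offset, of order N x^(-3/2); here \<open>N\<close> stands for the square of the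
  frequency.\<close>

lemma gauss_form_complex_lower_bound:
  fixes y :: "real \<Rightarrow> complex"
  assumes L: "\<And>t s. t \<in> {0..2 * pi} \<Longrightarrow> s \<in> {0..2 * pi} \<Longrightarrow> cmod (g t - g s) \<le> L * \<bar>t - s\<bar>"
    and L0: "0 \<le> L" and x: "1 \<le> x"
    and y: "continuous_on UNIV y" "\<And>t. y (t + 2 * pi) = y t"
    and osc: "\<And>h. (\<integral>t. (cmod (y (t + h) - y t))\<^sup>2 \<partial>period_measure) \<le> N * h\<^sup>2 * (\<integral>t. (cmod (y t))\<^sup>2 \<partial>period_measure)"
    and N: "0 \<le> N"
  shows "(exp (- L\<^sup>2) / sqrt x - pi * N / (l ^ 3 * (x * sqrt x))) * (\<integral>t. (cmod (y t))\<^sup>2 \<partial>period_measure)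
    \<le> gauss_form g g (\<lambda>t. Re (y t)) (\<lambda>t. Re (y t)) x + gauss_form g g (\<lambda>t. Im (y t)) (\<lambda>t. Im (y t)) x"
proof -
  let ?S = "\<integral>t. (cmod (y t))\<^sup>2 \<partial>period_measure"
  let ?G = "\<lambda>t s. exp (- x * (cmod (g t - g s))\<^sup>2)"
  have [continuous_intros]: "continuous_on A (\<lambda>t. g (f t))" if "continuous_on A f" for A f
    using continuous_on_compose2[OF cont that] by auto
  have [continuous_intros]: "continuous_on A (\<lambda>t. y (f t))" if "continuous_on A f" for A f
    using continuous_on_compose2[OF y(1) that] by auto
  have [measurable]: "y \<in> borel_measurable borel" by (rule borel_measurable_continuous_onI[OF y(1)])
  have A: "integrable period_square (\<lambda>p. ?G (fst p) (snd p) * (cmod (y (fst p)))\<^sup>2)"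
    "integrable period_square (\<lambda>p. ?G (fst p) (snd p) * (cmod (y (snd p)))\<^sup>2)"
    "integrable period_square (\<lambda>p. ?G (fst p) (snd p) * (cmod (y (snd p) - y (fst p)))\<^sup>2)"
    "integrable period_square (\<lambda>p. ?G (fst p) (snd p) * (Re (y (fst p)) * Re (y (snd p))))"
    "integrable period_square (\<lambda>p. ?G (fst p) (snd p) * (Im (y (fst p)) * Im (y (snd p))))"
    by (intro integrable_period_square_continuous continuous_intros)+
  let ?I1 = "\<integral>p. ?G (fst p) (snd p) * (cmod (y (fst p)))\<^sup>2 \<partial>period_square"
  let ?I3 = "\<integral>p. ?G (fst p) (snd p) * (cmod (y (snd p) - y (fst p)))\<^sup>2 \<partial>period_square"
  have polar: "Re a * Re b + Im a * Im b = ((cmod a)\<^sup>2 + (cmod b)\<^sup>2 - (cmod (b - a))\<^sup>2) / 2" for a b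
    by (simp add: cmod_power2 power2_diff algebra_simps)
  have "(\<integral>p. ?G (fst p) (snd p) * (cmod (y (snd p)))\<^sup>2 \<partial>period_square) = ?I1"
    using period_pair.integral_product_swap[of "\<lambda>p. ?G (fst p) (snd p) * (cmod (y (fst p)))\<^sup>2"] A
    by (simp add: case_prod_unfold norm_minus_commute borel_measurable_integrable)
  moreover have "gauss_form g g (\<lambda>t. Re (y t)) (\<lambda>t. Re (y t)) x + gauss_form g g (\<lambda>t. Im (y t)) (\<lambda>t. Im (y t)) x =
     (\<integral>p. (?G (fst p) (snd p) * (cmod (y (fst p)))\<^sup>2 + ?G (fst p) (snd p) * (cmod (y (snd p)))\<^sup>2
        - ?G (fst p) (snd p) * (cmod (y (snd p) - y (fst p)))\<^sup>2) / 2 \<partial>period_square)"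
    unfolding gauss_form_def
    by (subst Bochner_Integration.integral_add[symmetric, OF A(4,5)], intro Bochner_Integration.integral_cong refl)
      (simp only: distrib_left[symmetric] right_diff_distrib[symmetric] polar times_divide_eq_right)
  ultimately have form: "gauss_form g g (\<lambda>t. Re (y t)) (\<lambda>t. Re (y t)) x + gauss_form g g (\<lambda>t. Im (y t)) (\<lambda>t. Im (y t)) x = ?I1 - ?I3 / 2"
    using A(1-3) by simp
  have main: "exp (- L\<^sup>2) / sqrt x * ?S \<le> ?I1"
  proof -
    have "exp (- L\<^sup>2) / sqrt x * ?S = (\<integral>t. exp (- L\<^sup>2) / sqrt x * (cmod (y t))\<^sup>2 \<partial>period_measure)" by simp
    also have "\<dots> \<le> (\<integral>t. (\<integral>s. ?G t s * (cmod (y t))\<^sup>2 \<partial>period_measure) \<partial>period_measure)"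
    proof (rule integral_mono)
      show "integrable period_measure (\<lambda>t. exp (- L\<^sup>2) / sqrt x * (cmod (y t))\<^sup>2)"
        by (intro integrable_period_continuous continuous_intros)
      show "integrable period_measure (\<lambda>t. \<integral>s. ?G t s * (cmod (y t))\<^sup>2 \<partial>period_measure)"
        using period_pair.integrable_fst'[OF A(1)] by simp
      fix t assume "t \<in> space period_measure"
      then show "exp (- L\<^sup>2) / sqrt x * (cmod (y t))\<^sup>2 \<le> (\<integral>s. ?G t s * (cmod (y t))\<^sup>2 \<partial>period_measure)"
        unfolding integral_mult_left_zero
        by (intro mult_right_mono gauss_kernel_mean_lower_bound[OF L L0 _ x]) auto
    qed
    also have "\<dots> = ?I1" using period_pair.integral_fst'[OF A(1)] by simp
    finally show ?thesis .
  qed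
  have "?I3 \<le> 2 * (pi * N / (l ^ 3 * (x * sqrt x)) * ?S)"
  proof -
    define a where "a = x * l\<^sup>2"
    have a: "0 < a" using x l_pos by (simp add: a_def)
    \<comment> \<open>The substitution s = t + (k - pi) centres the period at \<open>t\<close>, so
      that \<open>low\<close> holds for every offset and replaces the Gaussian along the curve by
      one in the parameter.\<close>
    let ?H = "\<lambda>t k. exp (- a * (k - pi)\<^sup>2) * (cmod (y (t + (k - pi)) - y t))\<^sup>2"
    have H: "integrable period_square (\<lambda>p. ?H (fst p) (snd p))"
      by (intro integrable_period_square_continuous continuous_intros)
    have "?I3 = (\<integral>t. (\<integral>s. ?G t s * (cmod (y s - y t))\<^sup>2 \<partial>period_measure) \<partial>period_measure)"
      using period_pair.integral_fst'[OF A(3)] by simp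
    also have "\<dots> \<le> (\<integral>t. (\<integral>k. ?H t k \<partial>period_measure) \<partial>period_measure)"
    proof (rule integral_mono)
      show "integrable period_measure (\<lambda>t. \<integral>s. ?G t s * (cmod (y s - y t))\<^sup>2 \<partial>period_measure)"
        using period_pair.integrable_fst'[OF A(3)] by simp
      show "integrable period_measure (\<lambda>t. \<integral>k. ?H t k \<partial>period_measure)"
        using period_pair.integrable_fst'[OF H] by simp
      fix t assume "t \<in> space period_measure"
      then have t: "t \<in> {0..2 * pi}" by simp
      let ?F = "\<lambda>s. ?G t s * (cmod (y s - y t))\<^sup>2"
      have intF: "integrable period_measure ?F"
        by (intro integrable_period_continuous continuous_intros)
      have "(\<integral>s. ?F s \<partial>period_measure) = (\<integral>k. ?F ((t - pi) + k) \<partial>period_measure)"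
        using intF by (intro periodic_shift(2)[symmetric]) (simp_all add: per y(2))
      also have "\<dots> \<le> (\<integral>k. ?H t k \<partial>period_measure)"
      proof (rule integral_mono)
        show "integrable period_measure (\<lambda>k. ?F ((t - pi) + k))" "integrable period_measure (?H t)"
          by (intro integrable_period_continuous continuous_intros)+
        fix k assume "k \<in> space period_measure"
        then have k: "\<bar>k - pi\<bar> \<le> pi" by (auto simp: abs_le_iff)
        have eq: "(t - pi) + k = t + (k - pi)" by simp
        have "(l * \<bar>k - pi\<bar>)\<^sup>2 \<le> (cmod (g (t + (k - pi)) - g t))\<^sup>2"
          using low[OF t k] l_pos by (intro power_mono) auto
        then have "x * (l * \<bar>k - pi\<bar>)\<^sup>2 \<le> x * (cmod (g t - g (t + (k - pi))))\<^sup>2"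
          using x by (intro mult_left_mono) (auto simp: norm_minus_commute)
        then have "?G t (t + (k - pi)) \<le> exp (- a * (k - pi)\<^sup>2)"
          by (simp add: a_def power_mult_distrib mult.assoc)
        then show "?F ((t - pi) + k) \<le> ?H t k"
          unfolding eq by (intro mult_right_mono) auto
      qed
      finally show "(\<integral>s. ?F s \<partial>period_measure) \<le> (\<integral>k. ?H t k \<partial>period_measure)" .
    qed
    also have "\<dots> = (\<integral>k. (\<integral>t. ?H t k \<partial>period_measure) \<partial>period_measure)"
      using H by (intro period_pair.Fubini_integral[symmetric]) (simp add: case_prod_unfold)
    also have "\<dots> \<le> (\<integral>k. N * ?S * ((k - pi)\<^sup>2 * exp (- a * (k - pi)\<^sup>2)) \<partial>period_measure)"
    proof (rule integral_mono)
      show "integrable period_measure (\<lambda>k. \<integral>t. ?H t k \<partial>period_measure)"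
        using H by (intro period_pair.integrable_snd) (simp add: case_prod_unfold)
      show "integrable period_measure (\<lambda>k. N * ?S * ((k - pi)\<^sup>2 * exp (- a * (k - pi)\<^sup>2)))"
        by (intro integrable_period_continuous continuous_intros)
      fix k :: real
      show "(\<integral>t. ?H t k \<partial>period_measure) \<le> N * ?S * ((k - pi)\<^sup>2 * exp (- a * (k - pi)\<^sup>2))"
        using mult_left_mono[OF osc[of "k - pi"], of "exp (- a * (k - pi)\<^sup>2)"] by (simp add: mult_ac)
    qed
    also have "\<dots> = N * ?S * (\<integral>k. (k - pi)\<^sup>2 * exp (- a * (k - pi)\<^sup>2) \<partial>period_measure)" by simp
    also have "\<dots> \<le> N * ?S * (2 * pi / (a * sqrt a))"
      using integral_square_gauss_le[OF a] N by (intro mult_left_mono mult_nonneg_nonneg) auto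
    also have "a * sqrt a = l ^ 3 * (x * sqrt x)"
      using l_pos by (simp add: a_def real_sqrt_mult power2_eq_square power3_eq_cube)
    finally show ?thesis by (simp add: mult_ac)
  qed
  then show ?thesis using main unfolding form by (simp add: left_diff_distrib)
qed

end

text \<open>The last clause is Bernstein's inequality in a mean-square difference form, with
  \<open>N\<close> the frequency bound; it is the only spectral information that enters the energy
  estimate.\<close>

definition low_frequency :: "real \<Rightarrow> (real \<Rightarrow> complex) \<Rightarrow> bool" where
  "low_frequency N y \<longleftrightarrow> continuous_on UNIV y \<and> (\<forall>t. y (t + 2 * pi) = y t) \<and> bounded (range y) \<and>
    (\<forall>h. (\<integral>t. (cmod (y (t + h) - y t))\<^sup>2 \<partial>period_measure) \<le> N\<^sup>2 * h\<^sup>2 * (\<integral>t. (cmod (y t))\<^sup>2 \<partial>period_measure))"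

context bilipschitz_loop
begin

text \<open>The circle stays at distance at least \<open>d\<close> from the curve, so the
  interaction carries exp (- x d^2) \<le> 1/(x d^2), which is of smaller order than 1/sqrt x. The
  self-term of the circle is nonnegative and dropped.\<close>

lemma gauss_energy_ge_gauss_form:
  assumes u: "u \<in> borel_measurable borel" and W: "\<And>t. \<bar>u t\<bar> \<le> W"
    and d: "0 < d" "\<And>t. d \<le> \<bar>cmod (g t - z0) - 1\<bar>" and x: "0 < x"
  shows "gauss_form g g u u x - 4 * pi / (x * d\<^sup>2) * (\<integral>t. (u t)\<^sup>2 \<partial>period_measure) \<le> gauss_energy z0 u x"
proof -
  note [measurable] = u
  define \<Gamma> where "\<Gamma> = (\<lambda>t. z0 + cis t)"
  have [measurable]: "\<Gamma> \<in> borel_measurable borel" unfolding \<Gamma>_def by measurable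
  define m where "m = (\<integral>t. \<bar>u t\<bar> \<partial>period_measure)"
  define \<alpha> where "\<alpha> = (\<integral>t. u t \<partial>period_measure) / (2 * pi)"
  have um: "u \<in> borel_measurable period_measure" by (rule borel_measurable_period) measurable
  have int1: "integrable period_measure (\<lambda>t. \<bar>u t\<bar>)"
    using W um by (intro period.integrable_bounded[where B = W]) auto
  have int2: "integrable period_measure (\<lambda>t. (u t)\<^sup>2)"
  proof (rule period.integrable_bounded[where B = "W\<^sup>2"])
    show "\<bar>(u t)\<^sup>2\<bar> \<le> W\<^sup>2" for t using W[of t] by (simp add: abs_le_square_iff[symmetric])
  qed (use um in simp)
  have m0: "0 \<le> m" by (simp add: m_def)
  have "\<bar>\<integral>t. u t \<partial>period_measure\<bar> \<le> m"
    unfolding m_def using integral_norm_bound[of period_measure u] by simp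
  then have \<alpha>: "\<bar>\<alpha>\<bar> \<le> m / (2 * pi)" by (simp add: \<alpha>_def divide_right_mono)
  have "\<bar>gauss_form g \<Gamma> u (\<lambda>_. 1) x\<bar> \<le> (\<integral>p. exp (- x * d\<^sup>2) * (\<bar>u (fst p)\<bar> * 1) \<partial>period_square)"
    unfolding gauss_form_def real_norm_def[symmetric]
  proof (rule norm_integral_le)
    show "integrable period_square (\<lambda>p. exp (- x * (cmod (g (fst p) - \<Gamma> (snd p)))\<^sup>2) * (u (fst p) * 1))"
      using W x by (intro gauss_form_integrable[where W = "max W 1"]) (auto simp: le_max_iff_disj)
    show "integrable period_square (\<lambda>p. exp (- x * d\<^sup>2) * (norm (u (fst p)) * 1))"
      using integral_period_square_mult(1)[OF int1, of "\<lambda>_. 1"] by simp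
    have "exp (- x * (cmod (g t - \<Gamma> s))\<^sup>2) * \<bar>u t\<bar> \<le> exp (- x * d\<^sup>2) * \<bar>u t\<bar>" for t s
    proof -
      have "d \<le> \<bar>cmod (g t - z0) - cmod (cis s)\<bar>" using d(2) by simp
      also have "\<dots> \<le> cmod (g t - \<Gamma> s)"
        using norm_triangle_ineq3[of "g t - z0" "cis s"] by (simp add: \<Gamma>_def algebra_simps)
      finally have "d\<^sup>2 \<le> (cmod (g t - \<Gamma> s))\<^sup>2" using d(1) by (intro power_mono) auto
      then show ?thesis using x by (intro mult_right_mono) auto
    qed
    then show "AE p in period_square. norm (exp (- x * (cmod (g (fst p) - \<Gamma> (snd p)))\<^sup>2) * (u (fst p) * 1)) \<le>
        exp (- x * d\<^sup>2) * (norm (u (fst p)) * 1)"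
      by (simp add: abs_mult)
  qed
  also have "\<dots> = exp (- x * d\<^sup>2) * (2 * pi * m)"
    using integral_period_square_mult(2)[OF int1, of "\<lambda>_. 1"] by (simp add: m_def)
  finally have cross: "\<bar>gauss_form g \<Gamma> u (\<lambda>_. 1) x\<bar> \<le> exp (- x * d\<^sup>2) * (2 * pi * m)" .
  have "\<bar>2 * \<alpha> * gauss_form g \<Gamma> u (\<lambda>_. 1) x\<bar> \<le> 2 * (m / (2 * pi)) * (exp (- x * d\<^sup>2) * (2 * pi * m))"
    unfolding abs_mult using \<alpha> cross m0 by (intro mult_mono) auto
  also have "\<dots> = 2 * exp (- x * d\<^sup>2) * m\<^sup>2" by (simp add: power2_eq_square)
  also have "\<dots> \<le> 2 * (1 / (x * d\<^sup>2)) * (2 * pi * (\<integral>t. (u t)\<^sup>2 \<partial>period_measure))"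
  proof (intro mult_mono)
    have xd: "0 < x * d\<^sup>2" using x d by simp
    have "x * d\<^sup>2 \<le> exp (x * d\<^sup>2)" using exp_ge_add_one_self[of "x * d\<^sup>2"] by linarith
    then show "exp (- x * d\<^sup>2) \<le> 1 / (x * d\<^sup>2)"
      using xd by (simp add: exp_minus inverse_eq_divide frac_le)
    show "m\<^sup>2 \<le> 2 * pi * (\<integral>t. (u t)\<^sup>2 \<partial>period_measure)"
      unfolding m_def by (rule cauchy_schwarz_period[OF um int2])
  qed (use x in auto)
  finally have "2 * \<alpha> * gauss_form g \<Gamma> u (\<lambda>_. 1) x \<le> 4 * pi / (x * d\<^sup>2) * (\<integral>t. (u t)\<^sup>2 \<partial>period_measure)"
    by simp
  moreover have "0 \<le> \<alpha>\<^sup>2 * gauss_form \<Gamma> \<Gamma> (\<lambda>_. 1) (\<lambda>_. 1) x"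
    unfolding gauss_form_def by simp
  ultimately show ?thesis
    unfolding gauss_energy_def Let_def \<alpha>_def[symmetric] \<Gamma>_def[symmetric] by linarith
qed

lemma log_energy_coercive:
  assumes L: "\<And>t s. t \<in> {0..2 * pi} \<Longrightarrow> s \<in> {0..2 * pi} \<Longrightarrow> cmod (g t - g s) \<le> L * \<bar>t - s\<bar>"
    and L0: "0 \<le> L" and d: "0 < d" "\<And>t. d \<le> \<bar>cmod (g t - z0) - 1\<bar>"
  obtains c where "0 < c"
    "\<And>y N. 1 \<le> N \<Longrightarrow> low_frequency N y \<Longrightarrow>
      c / N * (\<integral>t. (cmod (y t))\<^sup>2 \<partial>period_measure) \<le> log_energy z0 (\<lambda>t. Re (y t)) + log_energy z0 (\<lambda>t. Im (y t))"
proof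
  define c0 where "c0 = exp (- L\<^sup>2)"
  \<comment> \<open>For x \<ge> A N^2 the second entry brings the oscillation error, and the third
    the interaction with the circle, below a quarter of the main term c0/sqrt x, so half of it
    survives.\<close>
  define A where "A = max 1 (max (4 * pi / (l ^ 3 * c0)) ((16 * pi / (d\<^sup>2 * c0))\<^sup>2))"
  have c0: "0 < c0" by (simp add: c0_def)
  have A: "1 \<le> A" "4 * pi / (l ^ 3 * c0) \<le> A" "(16 * pi / (d\<^sup>2 * c0))\<^sup>2 \<le> A" by (auto simp: A_def)
  show "0 < c0 / (8 * sqrt (2 * A))" using c0 A by simp
  fix y :: "real \<Rightarrow> complex" and N :: real
  assume N: "1 \<le> N" and low_y: "low_frequency N y"
  have y: "continuous_on UNIV y" "\<And>t. y (t + 2 * pi) = y t" "bounded (range y)"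
    and osc: "\<And>h. (\<integral>t. (cmod (y (t + h) - y t))\<^sup>2 \<partial>period_measure) \<le> N\<^sup>2 * h\<^sup>2 * (\<integral>t. (cmod (y t))\<^sup>2 \<partial>period_measure)"
    using low_y by (simp_all add: low_frequency_def)
  define S where "S = (\<integral>t. (cmod (y t))\<^sup>2 \<partial>period_measure)"
  have S0: "0 \<le> S" by (simp add: S_def)
  have [measurable]: "y \<in> borel_measurable borel" by (rule borel_measurable_continuous_onI[OF y(1)])
  obtain W where "\<And>t. cmod (y t) \<le> W" using y(3) unfolding bounded_iff by auto
  then have W: "\<bar>Re (y t)\<bar> \<le> W" "\<bar>Im (y t)\<bar> \<le> W" for t
    by (meson abs_Re_le_cmod abs_Im_le_cmod order_trans)+
  have S: "S = (\<integral>t. (Re (y t))\<^sup>2 \<partial>period_measure) + (\<integral>t. (Im (y t))\<^sup>2 \<partial>period_measure)"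
  proof -
    have "integrable period_measure (\<lambda>t. (Re (y t))\<^sup>2)" "integrable period_measure (\<lambda>t. (Im (y t))\<^sup>2)"
      by (intro integrable_period_continuous continuous_intros continuous_on_subset[OF y(1)] subset_UNIV)+
    then show ?thesis by (simp add: S_def cmod_power2)
  qed
  \<comment> \<open>Half of the main term at the far end x = 2 A N^2, its smallest value on the
    interval.\<close>
  define \<kappa> where "\<kappa> = c0 / 2 / (sqrt (2 * A) * N) * S"
  have "\<kappa> / 4 \<le> log_energy z0 (\<lambda>t. Re (y t)) + log_energy z0 (\<lambda>t. Im (y t))"
  proof (rule log_energy_lower_bound[OF _ W(1) _ W(2)])
    show "cmod (g t - z0) \<noteq> 1" for t using d(1) d(2)[of t] by auto
    show "0 < A * N\<^sup>2" "0 \<le> \<kappa>" using A N c0 S0 by (auto simp: \<kappa>_def)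
    fix x assume x: "x \<in> {A * N\<^sup>2..2 * (A * N\<^sup>2)}"
    have N2: "1 \<le> N\<^sup>2" using N by (simp add: one_le_power)
    have "A * 1 \<le> A * N\<^sup>2" using A(1) N2 by (intro mult_left_mono) auto
    then have xA: "A \<le> x" using x by simp
    then have x1: "1 \<le> x" using A(1) by linarith
    have sx: "0 < sqrt x" using x1 by simp
    have t1: "pi * N\<^sup>2 / (l ^ 3 * (x * sqrt x)) \<le> c0 / 4 / sqrt x"
    proof -
      have "4 * pi / (l ^ 3 * c0) * N\<^sup>2 \<le> A * N\<^sup>2" by (rule mult_right_mono[OF A(2)]) simp
      also have "\<dots> \<le> x" using x by simp
      finally have "4 * pi / (l ^ 3 * c0) * N\<^sup>2 \<le> x" .
      then have "pi * N\<^sup>2 / (l ^ 3 * x) \<le> c0 / 4"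
        using c0 l_pos x1 by (simp add: field_simps)
      from divide_right_mono[OF this, of "sqrt x"] show ?thesis using x1 by (simp add: mult.assoc)
    qed
    have t2: "4 * pi / (x * d\<^sup>2) \<le> c0 / 4 / sqrt x"
    proof -
      have "16 * pi / (d\<^sup>2 * c0) \<le> sqrt x"
        using A(3) xA by (intro real_le_rsqrt) linarith
      then have "16 * pi \<le> sqrt x * (d\<^sup>2 * c0)" using d c0 by (simp add: pos_divide_le_eq)
      then have "16 * pi / (sqrt x * (sqrt x * d\<^sup>2)) \<le> sqrt x * (d\<^sup>2 * c0) / (sqrt x * (sqrt x * d\<^sup>2))"
        using sx by (intro divide_right_mono) auto
      also have "\<dots> = c0 / sqrt x" using sx d by simp
      finally have "16 * pi / (x * d\<^sup>2) \<le> c0 / sqrt x" using x1 by (simp add: mult.assoc[symmetric])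
      then show ?thesis by simp
    qed
    have "c0 / 2 / (sqrt (2 * A) * N) \<le> c0 / 2 / sqrt x"
    proof (rule divide_left_mono)
      have "sqrt x \<le> sqrt (2 * A * N\<^sup>2)" using x by simp
      also have "\<dots> = sqrt (2 * A) * N" using N by (simp add: real_sqrt_mult)
      finally show "sqrt x \<le> sqrt (2 * A) * N" .
    qed (use c0 sx A N in auto)
    also have "\<dots> \<le> c0 / sqrt x - pi * N\<^sup>2 / (l ^ 3 * (x * sqrt x)) - 4 * pi / (x * d\<^sup>2)"
    proof -
      have "c0 / sqrt x = c0 / 2 / sqrt x + c0 / 4 / sqrt x + c0 / 4 / sqrt x" by simp
      then show ?thesis using t1 t2 by linarith
    qed
    finally have "\<kappa> \<le> (c0 / sqrt x - pi * N\<^sup>2 / (l ^ 3 * (x * sqrt x)) - 4 * pi / (x * d\<^sup>2)) * S"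
      unfolding \<kappa>_def using S0 by (rule mult_right_mono)
    also have "\<dots> = (c0 / sqrt x - pi * N\<^sup>2 / (l ^ 3 * (x * sqrt x))) * S
        - 4 * pi / (x * d\<^sup>2) * (\<integral>t. (Re (y t))\<^sup>2 \<partial>period_measure)
        - 4 * pi / (x * d\<^sup>2) * (\<integral>t. (Im (y t))\<^sup>2 \<partial>period_measure)"
      by (simp only: left_diff_distrib S distrib_left)
    also have "\<dots> \<le> gauss_energy z0 (\<lambda>t. Re (y t)) x + gauss_energy z0 (\<lambda>t. Im (y t)) x"
    proof -
      have "(c0 / sqrt x - pi * N\<^sup>2 / (l ^ 3 * (x * sqrt x))) * S
        \<le> gauss_form g g (\<lambda>t. Re (y t)) (\<lambda>t. Re (y t)) x + gauss_form g g (\<lambda>t. Im (y t)) (\<lambda>t. Im (y t)) x"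
        unfolding c0_def S_def by (rule gauss_form_complex_lower_bound[OF L L0 x1 y(1,2) osc]) auto
      moreover have "gauss_form g g (\<lambda>t. Re (y t)) (\<lambda>t. Re (y t)) x - 4 * pi / (x * d\<^sup>2) * (\<integral>t. (Re (y t))\<^sup>2 \<partial>period_measure)
          \<le> gauss_energy z0 (\<lambda>t. Re (y t)) x"
        using x1 by (intro gauss_energy_ge_gauss_form[OF _ W(1) d]) auto
      moreover have "gauss_form g g (\<lambda>t. Im (y t)) (\<lambda>t. Im (y t)) x - 4 * pi / (x * d\<^sup>2) * (\<integral>t. (Im (y t))\<^sup>2 \<partial>period_measure)
          \<le> gauss_energy z0 (\<lambda>t. Im (y t)) x"
        using x1 by (intro gauss_energy_ge_gauss_form[OF _ W(2) d]) auto
      ultimately show ?thesis by linarith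
    qed
    finally show "\<kappa> \<le> gauss_energy z0 (\<lambda>t. Re (y t)) x + gauss_energy z0 (\<lambda>t. Im (y t)) x" .
  qed measurable
  moreover have "c0 / (8 * sqrt (2 * A)) / N * S = \<kappa> / 4" by (simp add: \<kappa>_def)
  ultimately show "c0 / (8 * sqrt (2 * A)) / N * (\<integral>t. (cmod (y t))\<^sup>2 \<partial>period_measure)
      \<le> log_energy z0 (\<lambda>t. Re (y t)) + log_energy z0 (\<lambda>t. Im (y t))"
    unfolding S_def[symmetric] by (simp only:)
qed

end

section \<open>Interior values of a logarithmic potential\<close>

lemma continuous_nonneg_integral_zero:
  fixes f :: "real \<Rightarrow> real"
  assumes cont: "continuous_on {0..2 * pi} f" and nn: "\<And>s. s \<in> {0..2 * pi} \<Longrightarrow> 0 \<le> f s"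
    and zero: "(\<integral>s. f s \<partial>period_measure) = 0" and s: "s \<in> {0..2 * pi}"
  shows "f s = 0"
proof -
  have "set_integrable lborel {0..2 * pi} f"
    using integrable_period_continuous[OF cont] by (simp add: integrable_period_iff)
  then have "integral {0..2 * pi} f = 0"
    using zero set_borel_integral_eq_integral(2)[of "{0..2 * pi}" f] by (simp add: integral_period_eq)
  moreover have "integral {0..2 * pi} f = 0 \<longleftrightarrow> (\<forall>x \<in> {0..2 * pi}. f x = 0)"
    using pi_gt_zero nn by (intro integral_eq_0_iff[OF cont]) auto
  ultimately show ?thesis using s by blast
qed

text \<open>A positive maximum would be attained inside. At a maximum point with largest real part,
  equality with the mean over a circle about it forces the maximum also at the rightmost point of
  that circle, a contradiction.\<close>

lemma mean_value_maximum_principle: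
  fixes V :: "complex \<Rightarrow> real"
  assumes "open \<Omega>" "bounded \<Omega>" and cont: "continuous_on (closure \<Omega>) V"
    and mean: "\<And>c. c \<in> \<Omega> \<Longrightarrow> \<exists>r>0. cball c r \<subseteq> \<Omega> \<and>
      (\<integral>s. V (c + of_real r * cis s) \<partial>period_measure) = 2 * pi * V c"
    and bd: "\<And>x. x \<in> frontier \<Omega> \<Longrightarrow> V x \<le> 0" and x: "x \<in> \<Omega>"
  shows "V x \<le> 0"
proof (rule ccontr)
  assume "\<not> V x \<le> 0"
  have K: "compact (closure \<Omega>)" using assms(2) by simp
  obtain q where q: "q \<in> closure \<Omega>" "\<And>p. p \<in> closure \<Omega> \<Longrightarrow> V p \<le> V q"
    using continuous_attains_sup[OF K _ cont] x closure_subset by blast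
  define T where "T = {p \<in> closure \<Omega>. V p = V q}"
  have "closed T"
    unfolding T_def using cont by (rule continuous_closed_preimage_constant) simp
  then have "compact (closure \<Omega> \<inter> T)" by (rule compact_Int_closed[OF K])
  moreover have "closure \<Omega> \<inter> T = T" by (auto simp: T_def)
  ultimately have "compact T" by simp
  moreover have "T \<noteq> {}" using q(1) by (auto simp: T_def)
  ultimately obtain p where p: "p \<in> T" "\<And>p'. p' \<in> T \<Longrightarrow> Re p' \<le> Re p"
    using continuous_attains_sup[of T Re] continuous_on_Re[OF continuous_on_id] by blast
  have "0 < V q" using q(2)[of x] x closure_subset \<open>\<not> V x \<le> 0\<close> by fastforce
  then have "p \<notin> frontier \<Omega>" using p(1) bd by (fastforce simp: T_def)
  then have "p \<in> \<Omega>" using p(1) \<open>open \<Omega>\<close> by (simp add: T_def frontier_def interior_open)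
  then obtain r where r: "0 < r" "cball p r \<subseteq> \<Omega>"
    "(\<integral>s. V (p + of_real r * cis s) \<partial>period_measure) = 2 * pi * V p"
    using mean by blast
  have in_cl: "p + of_real r * cis s \<in> closure \<Omega>" for s
    using r closure_subset by (intro subsetD[OF closure_subset] subsetD[OF r(2)]) (auto simp: dist_norm norm_mult)
  let ?D = "\<lambda>s. V p - V (p + of_real r * cis s)"
  have contV: "continuous_on {0..2 * pi} (\<lambda>s. V (p + of_real r * cis s))"
    by (rule continuous_on_compose2[OF cont]) (use in_cl in \<open>auto intro!: continuous_intros\<close>)
  have "?D 0 = 0"
  proof (rule continuous_nonneg_integral_zero[where f = ?D])
    show "continuous_on {0..2 * pi} ?D" by (intro continuous_intros contV)
    show "0 \<le> ?D s" for s using q(2)[OF in_cl[of s]] p(1) by (simp add: T_def)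
    show "(\<integral>s. ?D s \<partial>period_measure) = 0"
      using r(3) integrable_period_continuous[OF contV] by simp
  qed simp
  then have "p + of_real r \<in> T" using p(1) in_cl[of 0] by (simp add: T_def)
  then show False using p(2)[of "p + of_real r"] r(1) by simp
qed

context bilipschitz_loop
begin

text \<open>
  In the proof, the function \<open>P s\<close> is the Poisson kernel of the exterior of a disc of radius \<open>r - \<epsilon>\<close> inside the
  exterior tangent disc at \<open>g s\<close>, with pole \<open>p s\<close> at distance \<open>\<epsilon>\<close> from \<open>g s\<close>. Since it is at least
  a multiple of \<open>1/\<epsilon>\<close> on the arc of length \<open>\<epsilon>\<close> about \<open>g s\<close>, the superposition of the
  \<open>P s\<close> with weight \<open>\<bar>V (g s)\<bar>\<close> majorizes \<open>\<bar>V\<bar>\<close> on the boundary.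
\<close>

lemma logpot_interior_bound:
  assumes \<Omega>: "open \<Omega>" "bounded \<Omega>" "frontier \<Omega> = range g" "z0 \<in> \<Omega>"
    and L: "\<And>t s. t \<in> {0..2 * pi} \<Longrightarrow> s \<in> {0..2 * pi} \<Longrightarrow> cmod (g t - g s) \<le> L * \<bar>t - s\<bar>"
    and L0: "0 \<le> L"
    and n: "continuous_on UNIV n" "\<And>s. cmod (n s) = 1"
    and r: "0 < r" "\<And>s. ball (g s + of_real r * n s) r \<inter> \<Omega> = {}"
  obtains C where "0 \<le> C"
    "\<And>u::real \<Rightarrow> real. continuous_on UNIV u \<Longrightarrow>
      \<bar>logpot u z0\<bar> \<le> C * (\<integral>s. \<bar>logpot u (g s)\<bar> \<partial>period_measure)"
proof -
  have g_notin: "g s \<notin> \<Omega>" for s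
    using \<Omega>(1,3) by (auto simp: frontier_def interior_open)
  have [continuous_intros]: "continuous_on A (\<lambda>t. g (h t))" if "continuous_on A h" for A h
    using continuous_on_compose2[OF cont that] by auto
  have [continuous_intros]: "continuous_on A (\<lambda>t. n (h t))" if "continuous_on A h" for A h
    using continuous_on_compose2[OF n(1) that] by auto
  obtain d where d: "0 < d" "\<And>s. d \<le> cmod (z0 - g s)"
  proof -
    obtain e where e: "0 < e" "ball z0 e \<subseteq> \<Omega>" using \<Omega>(1,4) openE by blast
    then have "e \<le> cmod (z0 - g s)" for s using g_notin[of s] by (force simp: dist_norm)
    then show ?thesis using that e(1) by blast
  qed
  \<comment> \<open>The kernels are at least r \<epsilon> / ((L + 1) \<epsilon>)^2 = c1/\<epsilon>
    on the arc; times the arc length \<epsilon> this no longer depends on \<epsilon>.\<close>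
  define c1 where "c1 = r / (L + 1)\<^sup>2"
  have c1: "0 < c1" using r(1) L0 by (simp add: c1_def)
  \<comment> \<open>The numerator bounds every kernel at \<open>z0\<close>. It is free of \<epsilon>
    and \<eta>, so \<eta> can be sent to 0 at the end.\<close>
  define C where "C = (1 + 4 * r / d) / c1"
  show ?thesis
  proof
    show "0 \<le> C" using c1 r d by (simp add: C_def)
    fix u :: "real \<Rightarrow> real" assume u: "continuous_on UNIV u"
    have [continuous_intros]: "continuous_on A (\<lambda>t. u (h t))" if "continuous_on A h" for A and h :: "'z::topological_space \<Rightarrow> real"
      using continuous_on_compose2[OF u that] by auto
    let ?V = "logpot u :: complex \<Rightarrow> real"
    have contV: "continuous_on UNIV ?V"
      by (intro continuous_logpot borel_measurable_period borel_measurable_continuous_onI u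
          integrable_period_continuous continuous_intros)
    have [continuous_intros]: "continuous_on A (\<lambda>t. ?V (h t))" if "continuous_on A h" for A and h :: "'z::topological_space \<Rightarrow> complex"
      using continuous_on_compose2[OF contV that] by auto
    define f where "f = (\<lambda>s. \<bar>?V (g s)\<bar>)"
    have contf: "continuous_on UNIV f" unfolding f_def by (intro continuous_intros)
    have [continuous_intros]: "continuous_on A (\<lambda>t. f (h t))" if "continuous_on A h" for A and h :: "'z::topological_space \<Rightarrow> real"
      using continuous_on_compose2[OF contf that] by auto
    have f0: "0 \<le> f s" for s by (simp add: f_def)
    have meanV: "(\<integral>\<theta>. ?V (c + of_real \<rho> * cis \<theta>) \<partial>period_measure) = 2 * pi * ?V c"
      if c: "0 < \<rho>" "cball c \<rho> \<subseteq> \<Omega>" for c \<rho>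
    proof -
      have far: "\<rho> < cmod (c - g s)" for s using c(2) g_notin[of s] by (force simp: dist_norm)
      have nz: "c + of_real \<rho> * cis \<theta> - g s \<noteq> 0" for \<theta> s
      proof -
        have "c + of_real \<rho> * cis \<theta> \<in> \<Omega>" using c by (intro subsetD[OF c(2)]) (auto simp: dist_norm norm_mult)
        then show ?thesis using g_notin[of s] by auto
      qed
      have int: "integrable period_square (\<lambda>p. ln (cmod (c + of_real \<rho> * cis (fst p) - g (snd p))) * u (snd p))"
        by (intro integrable_period_square_continuous continuous_intros) (use nz in auto)
      have "(\<integral>\<theta>. ?V (c + of_real \<rho> * cis \<theta>) \<partial>period_measure) =
          (\<integral>\<theta>. (\<integral>s. ln (cmod (c + of_real \<rho> * cis \<theta> - g s)) * u s \<partial>period_measure) \<partial>period_measure)"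
        by (simp add: logpot_def)
      also have "\<dots> = (\<integral>s. (\<integral>\<theta>. ln (cmod (c + of_real \<rho> * cis \<theta> - g s)) * u s \<partial>period_measure) \<partial>period_measure)"
        using int by (intro period_pair.Fubini_integral[symmetric]) (simp add: case_prod_unfold)
      also have "\<dots> = (\<integral>s. 2 * pi * (ln (cmod (c - g s)) * u s) \<partial>period_measure)"
        by (simp only: integral_mult_left_zero circle_mean_ln[OF c(1) far] mult.assoc)
      finally show ?thesis by (simp only: integral_mult_right_zero logpot_def real_scaleR_def)
    qed
    have bound: "\<bar>?V z0\<bar> \<le> C * (\<integral>s. f s \<partial>period_measure) + \<eta>" if "0 < \<eta>" for \<eta>
    proof -
      have "uniformly_continuous_on {0..2 * pi} f"
        by (intro compact_uniformly_continuous continuous_on_subset[OF contf]) auto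
      then obtain \<delta> where \<delta>: "0 < \<delta>" "\<And>s t. s \<in> {0..2 * pi} \<Longrightarrow> t \<in> {0..2 * pi} \<Longrightarrow> \<bar>s - t\<bar> < \<delta> \<Longrightarrow> \<bar>f s - f t\<bar> < \<eta>"
        unfolding uniformly_continuous_on_def dist_real_def using \<open>0 < \<eta>\<close> by metis
      \<comment> \<open>Below \<delta> the function \<open>f\<close> varies by less than \<eta> on
        the arc; below \<open>r\<close> the poles stay inside the tangent discs; d/2 keeps them away
        from \<open>z0\<close>.\<close>
      define \<epsilon> where "\<epsilon> = Min {\<delta> / 2, 1, r / 2, d / 2}"
      have \<epsilon>: "0 < \<epsilon>" "\<epsilon> < \<delta>" "\<epsilon> \<le> 1" "\<epsilon> < r" "\<epsilon> \<le> d / 2"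
      proof -
        show "0 < \<epsilon>" using \<delta>(1) r(1) d(1) by (simp add: \<epsilon>_def)
        have "\<epsilon> \<le> \<delta> / 2" "\<epsilon> \<le> 1" "\<epsilon> \<le> r / 2" "\<epsilon> \<le> d / 2" by (auto simp: \<epsilon>_def)
        then show "\<epsilon> < \<delta>" "\<epsilon> \<le> 1" "\<epsilon> < r" "\<epsilon> \<le> d / 2" using \<delta>(1) r(1) by auto
      qed
      define p where "p = (\<lambda>s. g s + of_real \<epsilon> * n s)"
      define P where "P = (\<lambda>s x. 1 - 2 * (r - \<epsilon>) * Re (n s * inverse (x - p s)))"
      define H where "H = (\<lambda>x. \<integral>s. f s * P s x \<partial>period_measure)"
      have contp: "continuous_on A (\<lambda>t. p (h t))" if "continuous_on A h" for A and h :: "'z::topological_space \<Rightarrow> real"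
        unfolding p_def using that by (intro continuous_intros)
      have q: "r \<le> cmod (x - (g s + of_real r * n s))" if "x \<in> closure \<Omega>" for x s
      proof -
        have "ball (g s + of_real r * n s) r \<inter> closure \<Omega> = {}"
          using r(2)[of s] open_Int_closure_eq_empty[of "ball (g s + of_real r * n s) r" \<Omega>] by simp
        then show ?thesis using that by (force simp: dist_norm norm_minus_commute)
      qed
      have pq: "p s - (g s + of_real r * n s) = - of_real (r - \<epsilon>) * n s" for s
        by (simp add: p_def algebra_simps)
      have xp: "\<epsilon> \<le> cmod (x - p s)" if "x \<in> closure \<Omega>" for x s
      proof -
        have "cmod (p s - (g s + of_real r * n s)) = r - \<epsilon>"
          unfolding pq using n(2) \<epsilon>(4) by (simp add: norm_mult del: of_real_diff)
        moreover have "cmod (x - (g s + of_real r * n s)) \<le> cmod (x - p s) + cmod (p s - (g s + of_real r * n s))"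
        proof -
          have "x - (g s + of_real r * n s) = (x - p s) + (p s - (g s + of_real r * n s))" by simp
          then show ?thesis by (metis norm_triangle_ineq)
        qed
        ultimately show ?thesis using q[OF that, of s] by linarith
      qed
      have p_notin: "p s \<notin> \<Omega>" for s using xp[of "p s" s] closure_subset \<epsilon>(1) by fastforce
      \<comment> \<open>The closed form of the Poisson kernel: the pole lies on the circle of radius
        r - \<epsilon> about the centre of the tangent disc. Points of the closure keep distance
        \<open>r\<close> from that centre, so the right side is nonnegative and even at least r
        \<epsilon>.\<close>
      have P_eq: "P s x * (cmod (x - p s))\<^sup>2 = (cmod (x - (g s + of_real r * n s)))\<^sup>2 - (r - \<epsilon>)\<^sup>2" if "x \<noteq> p s" for s x
      proof -
        have norm_square: "(cmod (w - of_real k * m))\<^sup>2 = (cmod w)\<^sup>2 - 2 * k * Re (m * cnj w) + k\<^sup>2 * (cmod m)\<^sup>2" for w m k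
          by (simp add: cmod_power2 power2_diff power_mult_distrib algebra_simps)
        define w where "w = x - p s"
        have w: "w \<noteq> 0" using that by (simp add: w_def)
        have "x - (g s + of_real r * n s) = w - of_real (r - \<epsilon>) * n s"
          using pq[of s] by (simp add: w_def algebra_simps)
        then have "(cmod (x - (g s + of_real r * n s)))\<^sup>2 = (cmod w)\<^sup>2 - 2 * (r - \<epsilon>) * Re (n s * cnj w) + (r - \<epsilon>)\<^sup>2 * (cmod (n s))\<^sup>2"
          by (simp only: norm_square)
        moreover have "Re (n s * inverse w) * (cmod w)\<^sup>2 = Re (n s * cnj w)"
        proof -
          have "Re (n s * inverse w) * (cmod w)\<^sup>2 = Re (n s * inverse w * of_real ((cmod w)\<^sup>2))"
            by (simp del: of_real_power)
          also have "n s * inverse w * of_real ((cmod w)\<^sup>2) = n s * cnj w"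
            unfolding complex_norm_square using w by simp
          finally show ?thesis .
        qed
        moreover have "P s x * (cmod w)\<^sup>2 = (cmod w)\<^sup>2 - 2 * (r - \<epsilon>) * (Re (n s * inverse w) * (cmod w)\<^sup>2)"
          unfolding P_def w_def[symmetric] by (simp only: left_diff_distrib mult_1_left mult.assoc)
        ultimately show ?thesis
          unfolding w_def[symmetric] by (simp only: n(2) power_one mult_1_right add_diff_cancel_right')
      qed
      have P0: "0 \<le> P s x" if "x \<in> closure \<Omega>" for s x
      proof -
        have pos: "0 < (cmod (x - p s))\<^sup>2"
          using order_less_le_trans[OF \<epsilon>(1) xp[OF that, of s]] by (rule zero_less_power)
        have "(r - \<epsilon>)\<^sup>2 \<le> (cmod (x - (g s + of_real r * n s)))\<^sup>2"
          using q[OF that, of s] \<epsilon> by (intro power_mono) auto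
        then have "0 \<le> P s x * (cmod (x - p s))\<^sup>2" using P_eq[of x s] pos by auto
        then show ?thesis using pos by (simp add: zero_le_mult_iff)
      qed
      have contP: "continuous_on A (\<lambda>y. P (h y) (k y))"
        if "continuous_on A h" "continuous_on A k" "\<And>y. y \<in> A \<Longrightarrow> k y \<noteq> p (h y)"
        for A and h :: "'z::topological_space \<Rightarrow> real" and k
        unfolding P_def using that by (intro continuous_intros contp) auto
      have neq: "x \<noteq> p s" if "x \<in> closure \<Omega>" for x s using xp[OF that, of s] \<epsilon>(1) by auto
      have intH: "integrable period_measure (\<lambda>s. f s * P s x)" if "x \<in> closure \<Omega>" for x
        by (intro integrable_period_continuous continuous_intros contP) (use neq[OF that] in auto)
      have contH: "continuous_on (closure \<Omega>) H"
      proof -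
        have K: "compact (closure \<Omega>)" using \<Omega>(2) by simp
        have "continuous_on (closure \<Omega>) (\<lambda>x. integral {0..2 * pi} (\<lambda>s. f s * P s x))"
          unfolding cbox_interval[symmetric]
          by (intro integral_continuous_on_param)
            (auto simp: case_prod_unfold intro!: continuous_intros contP dest: neq)
        moreover have "integral {0..2 * pi} (\<lambda>s. f s * P s x) = H x" if "x \<in> closure \<Omega>" for x
          using set_borel_integral_eq_integral(2)[of "{0..2 * pi}" "\<lambda>s. f s * P s x"] intH[OF that]
          by (simp add: H_def integral_period_eq integrable_period_iff)
        ultimately show ?thesis by (simp cong: continuous_on_cong)
      qed
      \<comment> \<open>Each kernel is 1 minus the real part of a multiple of 1/(. - pole) with the
        pole outside \<Omega>, so \<open>circle_mean_inverse\<close> gives its mean value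
        property.\<close>
      have meanH: "(\<integral>\<theta>. H (c + of_real \<rho> * cis \<theta>) \<partial>period_measure) = 2 * pi * H c"
        if c: "0 < \<rho>" "cball c \<rho> \<subseteq> \<Omega>" for c \<rho>
      proof -
        have far: "\<rho> < cmod (c - p s)" for s using c(2) p_notin[of s] by (force simp: dist_norm)
        have in\<Omega>: "c + of_real \<rho> * cis \<theta> \<in> \<Omega>" for \<theta>
          using c by (intro subsetD[OF c(2)]) (auto simp: dist_norm norm_mult)
        have in_cl: "c + of_real \<rho> * cis \<theta> \<in> closure \<Omega>" for \<theta>
          using in\<Omega> closure_subset by blast
        have int: "integrable period_square (\<lambda>y. f (snd y) * P (snd y) (c + of_real \<rho> * cis (fst y)))"
          by (intro integrable_period_square_continuous continuous_intros contP) (use neq[OF in_cl] in auto)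
        have mP: "(\<integral>\<theta>. P s (c + of_real \<rho> * cis \<theta>) \<partial>period_measure) = 2 * pi * P s c" for s
        proof -
          have i: "integrable period_measure (\<lambda>\<theta>. inverse (c + of_real \<rho> * cis \<theta> - p s))"
            by (intro integrable_period_continuous continuous_intros) (use neq[OF in_cl, of _ s] in auto)
          have lin: "(\<integral>\<theta>. 1 - k * Re (F \<theta>) \<partial>period_measure) = 2 * pi - k * Re (\<integral>\<theta>. F \<theta> \<partial>period_measure)"
            if "integrable period_measure F" for F :: "real \<Rightarrow> complex" and k
            using that by simp
          have m_eq: "(\<integral>\<theta>. n s * inverse (c + of_real \<rho> * cis \<theta> - p s) \<partial>period_measure) = n s * (2 * pi * inverse (c - p s))"
            using circle_mean_inverse[OF c(1) far] by (simp only: integral_mult_right_zero)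
          have "(\<integral>\<theta>. P s (c + of_real \<rho> * cis \<theta>) \<partial>period_measure) =
              2 * pi - 2 * (r - \<epsilon>) * Re (n s * (2 * pi * inverse (c - p s)))"
            unfolding P_def lin[OF integrable_mult_right[OF i], of "2 * (r - \<epsilon>)" "n s"] m_eq ..
          also have "n s * (2 * pi * inverse (c - p s)) = of_real (2 * pi) * (n s * inverse (c - p s))"
            by simp
          also have "2 * pi - 2 * (r - \<epsilon>) * Re (of_real (2 * pi) * (n s * inverse (c - p s))) = 2 * pi * P s c"
            unfolding P_def scaleR_conv_of_real[symmetric] scaleR_complex.sel by (simp only: right_diff_distrib mult_1_right mult_ac)
          finally show ?thesis .
        qed
        have "(\<integral>\<theta>. H (c + of_real \<rho> * cis \<theta>) \<partial>period_measure) =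
            (\<integral>s. (\<integral>\<theta>. f s * P s (c + of_real \<rho> * cis \<theta>) \<partial>period_measure) \<partial>period_measure)"
          unfolding H_def using int by (intro period_pair.Fubini_integral[symmetric]) (simp add: case_prod_unfold)
        also have "\<dots> = (\<integral>s. 2 * pi * (f s * P s c) \<partial>period_measure)"
          by (simp only: integral_mult_right_zero mP mult.left_commute)
        finally show ?thesis unfolding H_def by (simp only: integral_mult_right_zero)
      qed
      \<comment> \<open>The loss of \<eta> pays for replacing \<open>f s\<close> by
        \<open>f t\<close> on the arc; when f t < \<eta>, nonnegativity of the kernels
        suffices.\<close>
      have H_boundary: "c1 * (f t - \<eta>) \<le> H (g t)" if t: "t \<in> {0..2 * pi}" for t
      proof (cases "\<eta> \<le> f t")
        case False
        have "g t \<in> closure \<Omega>" using \<Omega>(3) by (auto simp: frontier_def)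
        then have "0 \<le> H (g t)" unfolding H_def using f0 P0 by (intro integral_nonneg_AE AE_I2) simp
        moreover have "c1 * (f t - \<eta>) \<le> 0" using c1 False by (simp add: mult_le_0_iff)
        ultimately show ?thesis by linarith
      next
        case True
        have gt: "g t \<in> closure \<Omega>" using \<Omega>(3) by (auto simp: frontier_def)
        have \<epsilon>_pi: "\<epsilon> \<le> pi" using \<epsilon>(3) pi_gt3 by linarith
        define J where "J = (if t \<le> pi then {t..t + \<epsilon>} else {t - \<epsilon>..t})"
        have J: "J \<subseteq> {0..2 * pi}" "\<And>s. s \<in> J \<Longrightarrow> \<bar>s - t\<bar> \<le> \<epsilon>"
          using t \<epsilon>(1) \<epsilon>_pi by (auto simp: J_def split: if_splits)
        have [measurable]: "J \<in> sets borel" by (auto simp: J_def)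
        have mJ: "measure lborel J = \<epsilon>" "emeasure lborel J < \<infinity>" using \<epsilon>(1) by (auto simp: J_def)
        have le: "indicator J s * ((f t - \<eta>) * (c1 / \<epsilon>)) \<le> f s * P s (g t)" for s
        proof (cases "s \<in> J")
          case s: True
          then have s2: "s \<in> {0..2 * pi}" using J by blast
          have "\<bar>f s - f t\<bar> < \<eta>" using \<delta>(2)[OF s2 t] J(2)[OF s] \<epsilon>(2) by simp
          then have 1: "f t - \<eta> \<le> f s" by simp
          have near: "cmod (g t - p s) \<le> (L + 1) * \<epsilon>"
          proof -
            have "cmod (g t - p s) \<le> cmod (g t - g s) + cmod (of_real \<epsilon> * n s)"
              using norm_triangle_ineq4[of "g t - g s" "of_real \<epsilon> * n s"] by (simp add: p_def algebra_simps)
            also have "\<dots> \<le> L * \<bar>t - s\<bar> + \<epsilon>"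
              using L[OF t s2] n(2) \<epsilon>(1) by (simp add: norm_mult)
            also have "\<dots> \<le> L * \<epsilon> + \<epsilon>"
              using J(2)[OF s] L0 by (intro add_right_mono mult_left_mono) (auto simp: abs_minus_commute)
            finally show ?thesis by (simp add: algebra_simps)
          qed
          have pos: "0 < (cmod (g t - p s))\<^sup>2" using neq[OF gt, of s] by simp
          have "r * \<epsilon> \<le> r\<^sup>2 - (r - \<epsilon>)\<^sup>2"
          proof -
            have "r\<^sup>2 - (r - \<epsilon>)\<^sup>2 = r * \<epsilon> + \<epsilon> * (r - \<epsilon>)" by (simp add: power2_eq_square algebra_simps)
            then show ?thesis using \<epsilon> by simp
          qed
          also have "\<dots> \<le> P s (g t) * (cmod (g t - p s))\<^sup>2"
            using q[OF gt, of s] r(1) by (simp add: P_eq[OF neq[OF gt]] power_mono)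
          also have "\<dots> \<le> P s (g t) * ((L + 1) * \<epsilon>)\<^sup>2"
            using near P0[OF gt] by (intro mult_left_mono power_mono) auto
          finally have "r * \<epsilon> / ((L + 1) * \<epsilon>)\<^sup>2 \<le> P s (g t)"
            using L0 \<epsilon>(1) by (subst pos_divide_le_eq) auto
          moreover have "r * \<epsilon> / ((L + 1) * \<epsilon>)\<^sup>2 = c1 / \<epsilon>"
            using \<epsilon>(1) by (simp add: c1_def power2_eq_square)
          ultimately have 2: "c1 / \<epsilon> \<le> P s (g t)" by simp
          show ?thesis using s mult_mono[OF 1 2 f0] c1 \<epsilon>(1) by simp
        qed (use f0 P0[OF gt] in simp)
        have "c1 * (f t - \<eta>) = (\<integral>s. indicator J s * ((f t - \<eta>) * (c1 / \<epsilon>)) \<partial>lborel)"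
          using mJ \<epsilon>(1) by simp
        also have "\<dots> = (\<integral>s. indicator J s * ((f t - \<eta>) * (c1 / \<epsilon>)) \<partial>period_measure)"
          using J by (auto simp: integral_restrict_space indicator_def intro!: Bochner_Integration.integral_cong)
        also have "\<dots> \<le> H (g t)"
          unfolding H_def
        proof (rule integral_mono)
          show "integrable period_measure (\<lambda>s. indicator J s * ((f t - \<eta>) * (c1 / \<epsilon>)))"
            by (rule period.integrable_bounded[where B = "\<bar>(f t - \<eta>) * (c1 / \<epsilon>)\<bar>"])
              (rule borel_measurable_period, measurable, auto simp: indicator_def)
        qed (use intH[OF gt] le in auto)
        finally show ?thesis .
      qed
      have H_z0: "H z0 \<le> (1 + 4 * r / d) * (\<integral>s. f s \<partial>period_measure)"
      proof -
        have z0: "z0 \<in> closure \<Omega>" using \<Omega>(4) closure_subset by blast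
        have le: "f s * P s z0 \<le> f s * (1 + 4 * r / d)" for s
        proof (rule mult_left_mono)
          have "cmod (z0 - g s) \<le> cmod (z0 - p s) + cmod (of_real \<epsilon> * n s)"
            using norm_triangle_ineq[of "z0 - p s" "of_real \<epsilon> * n s"] by (simp add: p_def)
          then have "d / 2 \<le> cmod (z0 - p s)"
            using d(2)[of s] n(2)[of s] \<epsilon>(1,5) by (simp add: norm_mult)
          then have "inverse (cmod (z0 - p s)) \<le> inverse (d / 2)"
            using d(1) by (intro le_imp_inverse_le) auto
          then have "cmod (n s * inverse (z0 - p s)) \<le> 2 / d"
            using n(2)[of s] by (simp only: norm_mult norm_inverse mult_1_left) simp
          then have "- Re (n s * inverse (z0 - p s)) \<le> 2 / d"
            using abs_Re_le_cmod[of "n s * inverse (z0 - p s)"] by linarith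
          then have "2 * (r - \<epsilon>) * (- Re (n s * inverse (z0 - p s))) \<le> 2 * r * (2 / d)"
            using \<epsilon> r d by (intro order_trans[OF mult_left_mono mult_right_mono]) auto
          moreover have "2 * r * (2 / d) = 4 * r / d" by simp
          ultimately show "P s z0 \<le> 1 + 4 * r / d"
            unfolding P_def mult_minus_right by linarith
        qed (rule f0)
        have "H z0 \<le> (\<integral>s. f s * (1 + 4 * r / d) \<partial>period_measure)"
          unfolding H_def using le intH[OF z0]
          by (intro integral_mono) (auto intro!: integrable_period_continuous continuous_on_subset[OF contf])
        then show ?thesis by (simp add: mult.commute)
      qed
      \<comment> \<open>The maximum principle is applied to \<tau> V - H/c1 - \<eta>; the two signs
        of \<tau> together bound the absolute value.\<close>
      have one_side: "\<tau> * ?V z0 \<le> C * (\<integral>s. f s \<partial>period_measure) + \<eta>" if "\<bar>\<tau>\<bar> = 1" for \<tau> :: real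
      proof -
        let ?W = "\<lambda>x. \<tau> * ?V x - H x / c1 - \<eta>"
        have "?W z0 \<le> 0"
        proof (rule mean_value_maximum_principle[OF \<Omega>(1,2) _ _ _ \<Omega>(4)])
          show "continuous_on (closure \<Omega>) ?W"
            using c1 by (intro continuous_intros contH) auto
          fix c assume "c \<in> \<Omega>"
          then obtain \<rho> where \<rho>: "0 < \<rho>" "cball c \<rho> \<subseteq> \<Omega>"
            using \<Omega>(1) open_contains_cball by blast
          have in_cl: "c + of_real \<rho> * cis \<theta> \<in> closure \<Omega>" for \<theta>
            using \<rho> by (intro subsetD[OF closure_subset] subsetD[OF \<rho>(2)]) (auto simp: dist_norm norm_mult)
          have i: "integrable period_measure (\<lambda>\<theta>. ?V (c + of_real \<rho> * cis \<theta>))"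
            "integrable period_measure (\<lambda>\<theta>. H (c + of_real \<rho> * cis \<theta>))"
            by (intro integrable_period_continuous continuous_intros)
              (intro integrable_period_continuous continuous_on_compose2[OF contH] continuous_intros, use in_cl in auto)
          show "\<exists>r>0. cball c r \<subseteq> \<Omega> \<and> (\<integral>\<theta>. ?W (c + of_real r * cis \<theta>) \<partial>period_measure) = 2 * pi * ?W c"
          proof (intro exI conjI)
            show "(\<integral>\<theta>. ?W (c + of_real \<rho> * cis \<theta>) \<partial>period_measure) = 2 * pi * ?W c"
              using i meanV[OF \<rho>] meanH[OF \<rho>] by (simp add: right_diff_distrib)
          qed (fact \<rho>)+
        next
          fix x assume "x \<in> frontier \<Omega>"
          then obtain s where s: "x = g s" using \<Omega>(3) by auto
          obtain t where t: "t \<in> {0..<2 * pi}" "g t = g s" by (rule reduce_period)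
          have "c1 * (f t - \<eta>) \<le> H x" using H_boundary[of t] t s by simp
          then have "f t - \<eta> \<le> H x / c1" using c1 by (simp add: pos_le_divide_eq mult.commute)
          moreover have "\<tau> * ?V x \<le> f t"
            using that t(2) s abs_ge_self[of "\<tau> * ?V x"] by (simp add: f_def abs_mult)
          ultimately show "?W x \<le> 0" by linarith
        qed
        moreover have "H z0 / c1 \<le> C * (\<integral>s. f s \<partial>period_measure)"
          using divide_right_mono[OF H_z0, of c1] c1 by (simp add: C_def)
        ultimately show ?thesis by linarith
      qed
      show ?thesis using one_side[of 1] one_side[of "- 1"] by (simp add: abs_le_iff)
    qed
    have "\<bar>?V z0\<bar> \<le> C * (\<integral>s. f s \<partial>period_measure)"
      by (rule field_le_epsilon) (use bound in auto)
    then show "\<bar>logpot u z0\<bar> \<le> C * (\<integral>s. \<bar>logpot u (g s)\<bar> \<partial>period_measure)"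
      by (simp add: f_def)
  qed
qed

end

section \<open>Tangent discs\<close>

lemma has_vector_derivative_bound:
  fixes f :: "real \<Rightarrow> 'b::real_normed_vector"
  assumes "convex S" "\<And>x. x \<in> S \<Longrightarrow> (f has_vector_derivative f' x) (at x)"
    and "\<And>x. x \<in> S \<Longrightarrow> norm (f' x) \<le> B" "x \<in> S" "y \<in> S"
  shows "norm (f x - f y) \<le> B * \<bar>x - y\<bar>"
proof -
  have "norm (f x - f y) \<le> B * norm (x - y)"
  proof (rule differentiable_bound[OF assms(1) _ _ assms(4,5)])
    fix z assume z: "z \<in> S"
    show "(f has_derivative (\<lambda>h. h *\<^sub>R f' z)) (at z within S)"
      using assms(2)[OF z] by (simp add: has_vector_derivative_def has_derivative_at_withinI)
    show "onorm (\<lambda>h. h *\<^sub>R f' z) \<le> B"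
      using assms(3)[OF z]
      by (intro onorm_le) (metis abs_ge_zero mult.commute mult_right_mono norm_scaleR real_norm_def)
  qed
  then show ?thesis by simp
qed

section \<open>Geometry of a regular loop with continuous second derivative\<close>

locale C2_loop =
  fixes g g1 g2 :: "real \<Rightarrow> complex"
  assumes periodic: "g (s + 2 * pi) = g s"
    and injective: "inj_on g {0..<2 * pi}"
    and deriv: "(g has_vector_derivative g1 s) (at s)"
    and deriv2: "(g1 has_vector_derivative g2 s) (at s)"
    and cont_deriv2: "continuous_on UNIV g2"
    and regular: "g1 s \<noteq> 0"
begin

lemma cont_g: "continuous_on A g"
  using deriv by (intro continuous_at_imp_continuous_on) (auto intro: has_vector_derivative_continuous)

lemma cont_g1: "continuous_on A g1"
  using deriv2 by (intro continuous_at_imp_continuous_on) (auto intro: has_vector_derivative_continuous)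

lemma periodic_deriv: "g1 (s + 2 * pi) = g1 s"
proof -
  have "((g \<circ> (\<lambda>x. x + 2 * pi)) has_vector_derivative 1 *\<^sub>R g1 (s + 2 * pi)) (at s)"
    by (rule vector_diff_chain_at) (auto intro!: derivative_eq_intros deriv)
  moreover have "g \<circ> (\<lambda>x. x + 2 * pi) = g" by (auto simp: periodic)
  ultimately show ?thesis using vector_derivative_unique_at[OF deriv] by simp
qed

lemma near_parameter: obtains h where "\<bar>h\<bar> \<le> pi" "g t = g (s + h)"
proof -
  obtain k where k: "t - s + 2 * pi * of_int k \<in> {- pi..<- pi + 2 * pi}" by (rule shift_into_period)
  show ?thesis
  proof
    show "\<bar>t - s + 2 * pi * of_int k\<bar> \<le> pi" using k by auto
    show "g t = g (s + (t - s + 2 * pi * of_int k))"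
      using periodic_int[of g t k, OF periodic] by (simp add: algebra_simps)
  qed
qed

text \<open>The mean value inequality for k \<mapsto> g (s + k) - k g1 s, whose derivative is at
  most C |h| by a first application to \<open>g1\<close>. The interval [-pi, 3 pi] contains every s
  + k that occurs.\<close>

lemma taylor_bound:
  obtains C where "0 < C"
    "\<And>s h. s \<in> {0..2 * pi} \<Longrightarrow> \<bar>h\<bar> \<le> pi \<Longrightarrow> cmod (g (s + h) - g s - of_real h * g1 s) \<le> C * h\<^sup>2"
proof -
  let ?I = "{- pi..3 * pi}"
  have "compact (g2 ` ?I)"
    by (intro compact_continuous_image continuous_on_subset[OF cont_deriv2]) auto
  then obtain C where C: "0 < C" "\<forall>x \<in> g2 ` ?I. cmod x \<le> C"
    using compact_imp_bounded bounded_pos by blast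
  show ?thesis
  proof
    fix s h :: real assume s: "s \<in> {0..2 * pi}" and h: "\<bar>h\<bar> \<le> pi"
    have g1: "cmod (g1 (s + k) - g1 s) \<le> C * \<bar>h\<bar>" if "k \<in> {- \<bar>h\<bar>..\<bar>h\<bar>}" for k
    proof -
      have "cmod (g1 (s + k) - g1 s) \<le> C * \<bar>s + k - s\<bar>"
        using C s h that by (intro has_vector_derivative_bound[where S = ?I and f' = g2]) (auto intro: deriv2)
      also have "\<dots> \<le> C * \<bar>h\<bar>" using that C(1) by (intro mult_left_mono) auto
      finally show ?thesis .
    qed
    have "cmod ((g (s + h) - of_real h * g1 s) - (g (s + 0) - of_real 0 * g1 s)) \<le> C * \<bar>h\<bar> * \<bar>h - 0\<bar>"
    proof (rule has_vector_derivative_bound[where S = "{- \<bar>h\<bar>..\<bar>h\<bar>}" and f' = "\<lambda>k. g1 (s + k) - g1 s"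
          and f = "\<lambda>k. g (s + k) - of_real k * g1 s"])
      fix k
      have "((g \<circ> (\<lambda>k. s + k)) has_vector_derivative 1 *\<^sub>R g1 (s + k)) (at k)"
        by (rule vector_diff_chain_at) (auto intro!: derivative_eq_intros deriv)
      then have 1: "((\<lambda>k. g (s + k)) has_vector_derivative g1 (s + k)) (at k)" by (simp add: o_def)
      have 2: "((\<lambda>k. of_real k * g1 s) has_vector_derivative g1 s) (at k)"
        using has_vector_derivative_scaleR[of "\<lambda>k. k" 1 k UNIV "\<lambda>_. g1 s" 0]
        by (simp add: scaleR_conv_of_real)
      show "((\<lambda>k. g (s + k) - of_real k * g1 s) has_vector_derivative g1 (s + k) - g1 s) (at k)"
        by (rule has_vector_derivative_diff[OF 1 2])
    qed (use g1 in auto)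
    then show "cmod (g (s + h) - g s - of_real h * g1 s) \<le> C * h\<^sup>2"
      by (simp add: power2_eq_square algebra_simps)
  qed (rule C(1))
qed

lemma lipschitz_on_period:
  obtains L where "0 \<le> L"
    "\<And>t s. t \<in> {0..2 * pi} \<Longrightarrow> s \<in> {0..2 * pi} \<Longrightarrow> cmod (g t - g s) \<le> L * \<bar>t - s\<bar>"
proof -
  have "compact (g1 ` {0..2 * pi})"
    by (intro compact_continuous_image cont_g1) auto
  then obtain L where L: "0 < L" "\<forall>x \<in> g1 ` {0..2 * pi}. cmod x \<le> L"
    using compact_imp_bounded bounded_pos by blast
  have "cmod (g t - g s) \<le> L * \<bar>t - s\<bar>" if "t \<in> {0..2 * pi}" "s \<in> {0..2 * pi}" for t s
    using L that by (intro has_vector_derivative_bound[where S = "{0..2 * pi}" and f' = g1]) (auto intro: deriv)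
  then show ?thesis using that L(1) less_imp_le by blast
qed

text \<open>Near the diagonal the tangent vector dominates the quadratic remainder. Away from it the
  chord has a positive minimum by compactness, since a vanishing chord would need an offset that is
  a nonzero multiple of 2 pi, while offsets are at most pi.\<close>

lemma bilipschitz: obtains l where "bilipschitz_loop g l"
proof -
  obtain C where C: "0 < C"
    "\<And>s h. s \<in> {0..2 * pi} \<Longrightarrow> \<bar>h\<bar> \<le> pi \<Longrightarrow> cmod (g (s + h) - g s - of_real h * g1 s) \<le> C * h\<^sup>2"
    by (rule taylor_bound) (rule that)
  obtain s0 where s0: "s0 \<in> {0..2 * pi}" "\<And>s. s \<in> {0..2 * pi} \<Longrightarrow> cmod (g1 s0) \<le> cmod (g1 s)"
    using continuous_attains_inf[of "{0..2 * pi}" "\<lambda>s. cmod (g1 s)"] continuous_on_norm[OF cont_g1] by auto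
  define \<mu> where "\<mu> = cmod (g1 s0)"
  have \<mu>: "0 < \<mu>" using regular by (simp add: \<mu>_def)
  define h0 where "h0 = min pi (\<mu> / (2 * C))"
  have h0: "0 < h0" "h0 \<le> pi" "C * h0 \<le> \<mu> / 2"
  proof -
    show "0 < h0" "h0 \<le> pi" using \<mu> C(1) by (auto simp: h0_def)
    have "C * h0 \<le> C * (\<mu> / (2 * C))" using C(1) by (intro mult_left_mono) (auto simp: h0_def)
    then show "C * h0 \<le> \<mu> / 2" using C(1) by simp
  qed
  have near: "\<mu> / 2 * \<bar>h\<bar> \<le> cmod (g (s + h) - g s)" if "s \<in> {0..2 * pi}" "\<bar>h\<bar> \<le> h0" for s h
  proof -
    have "cmod (of_real h * g1 s) \<le> cmod (g (s + h) - g s) + cmod (g (s + h) - g s - of_real h * g1 s)"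
      using norm_triangle_ineq4[of "g (s + h) - g s" "g (s + h) - g s - of_real h * g1 s"] by simp
    moreover have "\<mu> * \<bar>h\<bar> \<le> cmod (of_real h * g1 s)"
      using s0(2)[OF that(1)] by (simp add: norm_mult \<mu>_def mult.commute mult_left_mono)
    moreover have "C * h\<^sup>2 \<le> \<mu> / 2 * \<bar>h\<bar>"
    proof -
      have "C * \<bar>h\<bar> \<le> \<mu> / 2"
        using that(2) C(1) h0(3) by (intro order_trans[OF mult_left_mono h0(3)]) auto
      then have "C * \<bar>h\<bar> * \<bar>h\<bar> \<le> \<mu> / 2 * \<bar>h\<bar>" by (rule mult_right_mono) simp
      then show ?thesis by (simp add: power2_eq_square mult.assoc abs_mult_self_eq)
    qed
    moreover have "cmod (g (s + h) - g s - of_real h * g1 s) \<le> C * h\<^sup>2" using C(2) that h0(2) by simp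
    ultimately show ?thesis by (simp add: field_simps)
  qed
  define F where "F = {0..2 * pi} \<times> ({- pi..- h0} \<union> {h0..pi})"
  have "compact F" unfolding F_def by (intro compact_Times compact_Un) auto
  moreover have "(0, pi) \<in> F" using h0 by (auto simp: F_def)
  moreover have "continuous_on F (\<lambda>p. cmod (g (fst p + snd p) - g (fst p)))"
    by (intro continuous_intros continuous_on_compose2[OF cont_g[of UNIV]]) auto
  ultimately obtain p0 where p0: "p0 \<in> F"
    "\<And>p. p \<in> F \<Longrightarrow> cmod (g (fst p0 + snd p0) - g (fst p0)) \<le> cmod (g (fst p + snd p) - g (fst p))"
    using continuous_attains_inf[of F "\<lambda>p. cmod (g (fst p + snd p) - g (fst p))"] by blast
  define \<nu> where "\<nu> = cmod (g (fst p0 + snd p0) - g (fst p0))"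
  have \<nu>: "0 < \<nu>"
  proof (rule ccontr)
    assume "\<not> 0 < \<nu>"
    then have eq: "g (fst p0 + snd p0) = g (fst p0)" by (simp add: \<nu>_def)
    obtain k where k: "fst p0 + snd p0 + 2 * pi * of_int k \<in> {0..<0 + 2 * pi}" by (rule shift_into_period)
    obtain j where j: "fst p0 + 2 * pi * of_int j \<in> {0..<0 + 2 * pi}" by (rule shift_into_period)
    have "g (fst p0 + snd p0 + 2 * pi * of_int k) = g (fst p0 + 2 * pi * of_int j)"
      using eq by (simp add: periodic_int[of g, OF periodic])
    then have "fst p0 + snd p0 + 2 * pi * of_int k = fst p0 + 2 * pi * of_int j"
      using injective k j by (auto dest: inj_onD)
    then have "snd p0 = 2 * pi * of_int (j - k)" by (simp add: algebra_simps)
    moreover have "0 < \<bar>snd p0\<bar>" "\<bar>snd p0\<bar> \<le> pi" using p0(1) h0 by (auto simp: F_def)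
    ultimately have "0 < \<bar>of_int (j - k) :: real\<bar>" "2 * pi * \<bar>of_int (j - k) :: real\<bar> \<le> pi" by (auto simp: abs_mult)
    moreover have "1 \<le> \<bar>of_int (j - k) :: real\<bar>"
    proof -
      have "j - k \<noteq> 0" using calculation(1) by auto
      then have "1 \<le> \<bar>j - k\<bar>" by linarith
      then show ?thesis by (metis of_int_1_le_iff of_int_abs)
    qed
    ultimately have "2 * pi * 1 \<le> 2 * pi * \<bar>of_int (j - k) :: real\<bar>" "2 * pi * \<bar>of_int (j - k) :: real\<bar> \<le> pi"
      by (auto intro!: mult_left_mono)
    then show False using pi_gt_zero by linarith
  qed
  \<comment> \<open>Division by pi turns the constant lower bound \<nu> into a linear one, as |h|
    \<le> pi.\<close>
  define l where "l = min (\<mu> / 2) (\<nu> / pi)"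
  have l_le: "l \<le> \<mu> / 2" "l \<le> \<nu> / pi" unfolding l_def by (rule min.cobounded1, rule min.cobounded2)
  have "bilipschitz_loop g l"
  proof
    show "g (s + 2 * pi) = g s" for s by (rule periodic)
    show "continuous_on UNIV g" by (rule cont_g)
    show "0 < l" using \<mu> \<nu> by (simp add: l_def)
    fix s h :: real assume s: "s \<in> {0..2 * pi}" and h: "\<bar>h\<bar> \<le> pi"
    show "l * \<bar>h\<bar> \<le> cmod (g (s + h) - g s)"
    proof (cases "\<bar>h\<bar> \<le> h0")
      case True
      have "l * \<bar>h\<bar> \<le> \<mu> / 2 * \<bar>h\<bar>" by (rule mult_right_mono[OF l_le(1) abs_ge_zero])
      then show ?thesis using near[OF s True] by linarith
    next
      case False
      then have "(s, h) \<in> F" using s h by (auto simp: F_def)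
      then have "\<nu> \<le> cmod (g (s + h) - g s)" using p0(2)[of "(s, h)"] by (simp add: \<nu>_def)
      moreover have "l * \<bar>h\<bar> \<le> \<nu> / pi * pi" using h \<nu> by (intro mult_mono l_le(2)) auto
      ultimately show ?thesis by simp
    qed
  qed
  then show ?thesis by (rule that)
qed

text \<open>The unit normal to the left of the direction of travel; the orientation of the loop
  decides whether it points inwards, so both signs are carried below.\<close>

definition normal :: "real \<Rightarrow> complex" where
  "normal s = \<i> * g1 s / of_real (cmod (g1 s))"

lemma cmod_normal: "cmod (normal s) = 1"
  using regular by (simp add: normal_def norm_divide norm_mult)

text \<open>The normal component of a chord is at most C h^2, as the tangential term drops out,
  while the squared chord is at least l^2 h^2. With 2 r C = l^2 this keeps the end point out of the
  open disc of radius \<open>r\<close> touching the curve at \<open>g s\<close>.\<close>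

lemma tangent_discs:
  obtains r where "0 < r" "\<And>\<sigma> s t. \<bar>\<sigma>\<bar> = 1 \<Longrightarrow> r \<le> cmod (g t - (g s + of_real (\<sigma> * r) * normal s))"
proof -
  obtain C where C: "0 < C"
    "\<And>s h. s \<in> {0..2 * pi} \<Longrightarrow> \<bar>h\<bar> \<le> pi \<Longrightarrow> cmod (g (s + h) - g s - of_real h * g1 s) \<le> C * h\<^sup>2"
    by (rule taylor_bound) (rule that)
  obtain l where l: "bilipschitz_loop g l" by (rule bilipschitz)
  interpret bilipschitz_loop g l by (rule l)
  define r where "r = l\<^sup>2 / (2 * C)"
  have r: "0 < r" "2 * r * C = l\<^sup>2" using C(1) l_pos by (auto simp: r_def)
  have base: "r \<le> cmod (g t - (g s + of_real (\<sigma> * r) * normal s))"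
    if \<sigma>: "\<bar>\<sigma>\<bar> = 1" and s: "s \<in> {0..2 * pi}" for \<sigma> s t
  proof -
    obtain h where h: "\<bar>h\<bar> \<le> pi" "g t = g (s + h)" by (rule near_parameter)
    define D where "D = g (s + h) - g s"
    define R where "R = D - of_real h * g1 s"
    have R: "cmod R \<le> C * h\<^sup>2" using C(2)[OF s h(1)] by (simp add: R_def D_def)
    have D: "l\<^sup>2 * h\<^sup>2 \<le> (cmod D)\<^sup>2"
      using power_mono[OF low[OF s h(1)], of 2] l_pos by (simp add: D_def power_mult_distrib)
    have "Re (g1 s * cnj (normal s)) = 0" by (simp add: normal_def)
    then have "Re (D * cnj (normal s)) = Re (R * cnj (normal s))"
      by (simp add: R_def algebra_simps)
    moreover have "\<bar>Re (R * cnj (normal s))\<bar> \<le> cmod R"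
      using abs_Re_le_cmod[of "R * cnj (normal s)"] by (simp add: norm_mult cmod_normal)
    ultimately have "\<bar>\<sigma> * Re (D * cnj (normal s))\<bar> \<le> C * h\<^sup>2" using \<sigma> R by (simp add: abs_mult)
    then have "2 * r * (\<sigma> * Re (D * cnj (normal s))) \<le> 2 * r * (C * h\<^sup>2)"
      using r(1) by (intro mult_left_mono) (auto simp: abs_le_iff)
    also have "\<dots> = l\<^sup>2 * h\<^sup>2" using r(2) by (simp add: mult.assoc[symmetric])
    finally have "2 * r * (\<sigma> * Re (D * cnj (normal s))) \<le> (cmod D)\<^sup>2" using D by linarith
    moreover have "(cmod (D - of_real (\<sigma> * r) * normal s))\<^sup>2 =
        (cmod D)\<^sup>2 - 2 * r * (\<sigma> * Re (D * cnj (normal s))) + (\<sigma> * r)\<^sup>2 * (cmod (normal s))\<^sup>2"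
    proof -
      have "(cmod (w - of_real k * m))\<^sup>2 = (cmod w)\<^sup>2 - 2 * k * Re (w * cnj m) + k\<^sup>2 * (cmod m)\<^sup>2" for w m k
        by (simp add: cmod_power2 power2_diff power_mult_distrib algebra_simps)
      from this[of D "\<sigma> * r" "normal s"] show ?thesis by (simp only: mult_ac)
    qed
    moreover have "(\<sigma> * r)\<^sup>2 = r\<^sup>2" using \<sigma> by (metis power2_abs abs_mult mult_1 abs_abs)
    ultimately have "r\<^sup>2 \<le> (cmod (D - of_real (\<sigma> * r) * normal s))\<^sup>2" by (simp only: cmod_normal) simp
    then have "r \<le> cmod (D - of_real (\<sigma> * r) * normal s)" by (rule power2_le_imp_le) simp
    then show ?thesis by (simp add: h(2) D_def algebra_simps)
  qed
  have "r \<le> cmod (g t - (g s + of_real (\<sigma> * r) * normal s))" if "\<bar>\<sigma>\<bar> = 1" for \<sigma> s t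
  proof -
    obtain k where k: "s + 2 * pi * of_int k \<in> {0..<0 + 2 * pi}" by (rule shift_into_period)
    have "normal (s + 2 * pi) = normal s" for s by (simp add: normal_def periodic_deriv)
    then have "normal (s + 2 * pi * of_int k) = normal s" by (rule periodic_int)
    moreover have "g (s + 2 * pi * of_int k) = g s" using periodic by (rule periodic_int)
    ultimately show ?thesis using base[OF that, of "s + 2 * pi * of_int k" t] k by simp
  qed
  then show ?thesis using that r(1) by blast
qed

text \<open>
  The centres \<open>g s \<plusminus> r normal s\<close> of the tangent discs on one side trace a connected set off the curve,
  so they lie all inside or all outside \<open>\<Omega>\<close>; at a boundary point farthest from the origin one
  of the two centres is outside.
\<close>

lemma exterior_tangent_discs:
  assumes \<Omega>: "open \<Omega>" "bounded \<Omega>" "\<Omega> \<noteq> {}" "frontier \<Omega> = range g"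
  obtains r n where "0 < r" "continuous_on UNIV n" "\<And>s. cmod (n s) = 1"
    "\<And>s. ball (g s + of_real r * n s) r \<inter> \<Omega> = {}"
proof -
  obtain r where r: "0 < r" "\<And>\<sigma> s t. \<bar>\<sigma>\<bar> = 1 \<Longrightarrow> r \<le> cmod (g t - (g s + of_real (\<sigma> * r) * normal s))"
    by (rule tangent_discs) (rule that)
  have cont_normal: "continuous_on UNIV normal"
    unfolding normal_def by (intro continuous_intros cont_g1) (use regular in auto)
  have K: "compact (closure \<Omega>)" using \<Omega>(2) by simp
  obtain q where q: "q \<in> closure \<Omega>" "\<And>p. p \<in> closure \<Omega> \<Longrightarrow> cmod p \<le> cmod q"
    using continuous_attains_sup[OF K _ continuous_on_norm[OF continuous_on_id]] \<Omega>(3) by auto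
  \<comment> \<open>Radial displacement of \<open>q\<close> increases the modulus; at q = 0 the
    direction 1 is used.\<close>
  have outward: "q + of_real e * (if q = 0 then 1 else q / of_real (cmod q)) \<notin> closure \<Omega>" if "0 < e" for e
  proof -
    have "cmod (q + of_real e * (if q = 0 then 1 else q / of_real (cmod q))) = cmod q + e"
    proof (cases "q = 0")
      case False
      have "q + of_real e * (q / of_real (cmod q)) = of_real (1 + e / cmod q) * q"
        by (simp add: distrib_right)
      then have "cmod (q + of_real e * (q / of_real (cmod q))) = (1 + e / cmod q) * cmod q"
        using that by (simp only: norm_mult norm_of_real) simp
      then show ?thesis using False by (simp add: distrib_right)
    qed (use that in simp)
    then show ?thesis using q(2) that by force
  qed
  have "q \<notin> \<Omega>"
  proof
    assume "q \<in> \<Omega>"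
    then obtain e where e: "0 < e" "ball q e \<subseteq> \<Omega>" using \<Omega>(1) openE by blast
    have "cmod (of_real (e / 2) * (if q = 0 then 1 else q / of_real (cmod q))) = e / 2"
      using e(1) by (auto simp: norm_mult norm_divide)
    moreover have "cmod X = e / 2 \<Longrightarrow> q + X \<in> ball q e" for X
      using e(1) by (simp add: dist_norm)
    ultimately have "q + of_real (e / 2) * (if q = 0 then 1 else q / of_real (cmod q)) \<in> ball q e" by blast
    then have "q + of_real (e / 2) * (if q = 0 then 1 else q / of_real (cmod q)) \<in> closure \<Omega>"
      using e(2) closure_subset by (meson subsetD)
    moreover have "0 < e / 2" using e(1) by simp
    ultimately show False using outward by blast
  qed
  then have "q \<in> frontier \<Omega>" using q(1) \<Omega>(1) by (simp add: frontier_def interior_open)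
  then obtain s0 where s0: "q = g s0" using \<Omega>(4) by auto
  have q0: "q \<noteq> 0"
  proof
    assume "q = 0"
    then have "closure \<Omega> \<subseteq> {0}" using q(2) by auto
    then have "\<Omega> \<subseteq> {0}" using closure_subset by blast
    then show False using \<Omega>(1,3) not_open_singleton[of "0::complex"] by (metis subset_singletonD)
  qed
  \<comment> \<open>The squared modulus of \<open>g\<close> is maximal at \<open>s0\<close>, so its
    derivative vanishes there and the position vector is parallel to the normal.\<close>
  have tangent: "Re (g s0 * cnj (g1 s0)) = 0"
  proof -
    have "((\<lambda>s. g s \<bullet> g s) has_real_derivative g s0 \<bullet> g1 s0 + g1 s0 \<bullet> g s0) (at s0)"
      unfolding has_real_derivative_iff_has_vector_derivative
      using bounded_bilinear.has_vector_derivative[OF bounded_bilinear_inner deriv deriv] by simp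
    moreover have "g s \<bullet> g s \<le> g s0 \<bullet> g s0" for s
    proof -
      have "g s \<in> closure \<Omega>" using \<Omega>(4) by (auto simp: frontier_def)
      then have "(cmod (g s))\<^sup>2 \<le> (cmod (g s0))\<^sup>2" using q(2) s0 by (intro power_mono) auto
      then show ?thesis by (simp add: power2_norm_eq_inner)
    qed
    ultimately have "g s0 \<bullet> g1 s0 + g1 s0 \<bullet> g s0 = 0"
      by (intro DERIV_local_max[of _ _ s0 1]) auto
    then show ?thesis by (simp add: inner_complex_def)
  qed
  define \<kappa> where "\<kappa> = Im (g s0 * cnj (g1 s0)) / cmod (g1 s0)"
  have g_normal: "g s0 = of_real \<kappa> * normal s0"
  proof -
    have nz: "of_real (cmod (g1 s0)) \<noteq> (0::complex)" using regular by simp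
    have "g s0 * (cnj (g1 s0) * g1 s0) = \<i> * of_real (Im (g s0 * cnj (g1 s0))) * g1 s0"
    proof -
      have "g s0 * cnj (g1 s0) = \<i> * of_real (Im (g s0 * cnj (g1 s0)))"
        using tangent by (simp add: complex_eq_iff)
      then show ?thesis by (metis mult.assoc)
    qed
    moreover have "cnj (g1 s0) * g1 s0 = of_real (cmod (g1 s0)) * of_real (cmod (g1 s0))"
      using complex_norm_square[of "g1 s0"] by (simp add: power2_eq_square mult.commute)
    ultimately have "g s0 * (of_real (cmod (g1 s0)) * of_real (cmod (g1 s0))) = \<i> * of_real (Im (g s0 * cnj (g1 s0))) * g1 s0"
      by (simp only:)
    then show ?thesis using nz by (simp add: \<kappa>_def normal_def divide_simps mult_ac)
  qed
  \<comment> \<open>The sign that points away from the origin: the centre belonging to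
    \<open>s0\<close> then has modulus |\<kappa>| + r, larger than any in the closure of
    \<Omega>.\<close>
  define \<sigma> where "\<sigma> = (if 0 \<le> \<kappa> then 1 else - 1 :: real)"
  have \<sigma>: "\<bar>\<sigma>\<bar> = 1" by (simp add: \<sigma>_def)
  define n where "n = (\<lambda>s. of_real \<sigma> * normal s)"
  have n: "continuous_on UNIV n" "\<And>s. cmod (n s) = 1"
    using cont_normal \<sigma> by (auto simp: n_def norm_mult cmod_normal intro!: continuous_intros)
  define Q where "Q = (\<lambda>s. g s + of_real r * n s)"
  have Q_far: "r \<le> cmod (g t - Q s)" for s t
    using r(2)[OF \<sigma>, of t s] by (simp add: Q_def n_def mult_ac)
  have "Q s0 \<notin> \<Omega>"
  proof -
    have "Q s0 = of_real (\<kappa> + \<sigma> * r) * normal s0" unfolding Q_def n_def by (subst g_normal) (simp add: algebra_simps)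
    then have "cmod (Q s0) = \<bar>\<kappa> + \<sigma> * r\<bar>" by (simp only: norm_mult norm_of_real cmod_normal mult_1_right)
    also have "\<dots> = \<bar>\<kappa>\<bar> + r" using r(1) by (auto simp: \<sigma>_def)
    also have "\<bar>\<kappa>\<bar> = cmod q" unfolding s0 by (subst g_normal) (simp add: norm_mult cmod_normal)
    finally show ?thesis using q(2)[of "Q s0"] r(1) closure_subset by fastforce
  qed
  moreover have "connected (range Q)"
    unfolding Q_def by (intro connected_continuous_image continuous_intros cont_g n(1)) simp
  moreover have "range Q \<inter> frontier \<Omega> = {}"
  proof -
    have "Q s \<noteq> g t" for s t using Q_far[of t s] r(1) by auto
    then show ?thesis unfolding \<Omega>(4) by blast
  qed
  ultimately have Q_notin: "Q s \<notin> \<Omega>" for s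
    using connected_Int_frontier[of "range Q" \<Omega>] by blast
  have "ball (Q s) r \<inter> \<Omega> = {}" for s
  proof (rule ccontr)
    assume "ball (Q s) r \<inter> \<Omega> \<noteq> {}"
    moreover have "ball (Q s) r - \<Omega> \<noteq> {}"
      using Q_notin[of s] centre_in_ball[of "Q s" r] r(1) by blast
    ultimately have "ball (Q s) r \<inter> frontier \<Omega> \<noteq> {}"
      by (intro connected_Int_frontier) simp_all
    then obtain t where "cmod (Q s - g t) < r" unfolding \<Omega>(4) by (auto simp: dist_norm)
    then show False using Q_far[of t s] by (simp add: norm_minus_commute)
  qed
  then show ?thesis using that r(1) n unfolding Q_def by blast
qed

end

section \<open>Symm's operator on trigonometric polynomials\<close>

lemma square_integrable_rep [simp]: "square_integrable (rep_L2 x)"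
  using Quotient3_rep_reflp[OF Quotient3_L2, of x] by (simp add: L2_rel_def)

lemma abs_rep_L2 [simp]: "abs_L2 (rep_L2 x) = x"
  by (rule Quotient3_abs_rep[OF Quotient3_L2])

lemma L2_rel_refl: "square_integrable f \<Longrightarrow> L2_rel f f"
  by (simp add: L2_rel_def)

lemma rep_abs_L2:
  assumes "square_integrable f"
  shows "AE t in period_measure. rep_L2 (abs_L2 f) t = f t"
proof -
  have "L2_rel (rep_L2 (abs_L2 f)) f"
    using Quotient3_rel[OF Quotient3_L2, of "rep_L2 (abs_L2 f)" f] L2_rel_refl assms by simp
  then show ?thesis by (simp add: L2_rel_def)
qed

lemma square_integrable_continuous:
  assumes "continuous_on {0..2 * pi} f"
  shows "square_integrable f"
  unfolding square_integrable_def
proof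
  show "f \<in> borel_measurable period_measure"
    using integrable_period_continuous[OF assms] by (rule borel_measurable_integrable)
  show "integrable period_measure (\<lambda>x. (cmod (f x))\<^sup>2)"
    by (intro integrable_period_continuous continuous_intros assms)
qed

section \<open>Symm's operator on functions\<close>

context bilipschitz_loop
begin

definition symm_fun :: "(real \<Rightarrow> complex) \<Rightarrow> real \<Rightarrow> complex" where
  "symm_fun \<psi> t = - (1 / of_real pi) * logpot \<psi> (g t)"

lemma square_integrable_symm_fun:
  assumes "square_integrable \<psi>"
  shows "square_integrable (symm_fun \<psi>)"
proof (rule square_integrable_continuous)
  have "continuous_on UNIV (logpot \<psi>)"
    using assms by (intro continuous_logpot) (auto simp: square_integrable_def)
  then have "continuous_on {0..2 * pi} (\<lambda>t. logpot \<psi> (g t))"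
    by (rule continuous_on_compose2) (auto intro: continuous_on_subset[OF cont])
  then show "continuous_on {0..2 * pi} (symm_fun \<psi>)"
    unfolding symm_fun_def by (intro continuous_intros)
qed

lemma logpot_cong_AE:
  assumes "square_integrable \<psi>" "square_integrable \<phi>" "AE s in period_measure. \<psi> s = \<phi> s"
  shows "logpot \<psi> x = logpot \<phi> x"
  unfolding logpot_def
proof (rule integral_cong_AE)
  show "AE s in period_measure. ln (cmod (x - g s)) *\<^sub>R \<psi> s = ln (cmod (x - g s)) *\<^sub>R \<phi> s"
    using assms(3) by eventually_elim simp
qed (use assms(1,2) in \<open>auto simp: square_integrable_def intro!: borel_measurable_integrable integrable_logpot\<close>)

lemma logpot_add:
  assumes "square_integrable \<psi>" "square_integrable \<phi>"
  shows "logpot (\<lambda>s. \<psi> s + \<phi> s) x = logpot \<psi> x + logpot \<phi> x"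
  unfolding logpot_def using assms integrable_logpot[of \<psi> x] integrable_logpot[of \<phi> x]
  by (simp add: scaleR_add_right square_integrable_def)

lemma logpot_mult: "logpot (\<lambda>s. c * \<psi> s) x = c * logpot \<psi> x" for c :: complex
proof -
  have "logpot (\<lambda>s. c * \<psi> s) x = (\<integral>s. c * (ln (cmod (x - g s)) *\<^sub>R \<psi> s) \<partial>period_measure)"
    unfolding logpot_def by simp
  also have "\<dots> = c * logpot \<psi> x" unfolding logpot_def by (rule integral_mult_right_zero)
  finally show ?thesis .
qed

text \<open>The kernel is symmetric and square integrable over the square of the period. The middle
  claim writes the quadratic form as a double integral, the shape in which \<open>log_energy\<close>
  contains it.\<close>

lemma symm_fun_self_adjoint:
  assumes "square_integrable \<psi>" "square_integrable \<phi>"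
  shows "integrable period_square (\<lambda>p. ln (cmod (g (fst p) - g (snd p))) *\<^sub>R (\<psi> (snd p) * cnj (\<phi> (fst p))))"
    and "(\<integral>t. symm_fun \<psi> t * cnj (\<phi> t) \<partial>period_measure) =
      - (1 / of_real pi) * (\<integral>p. ln (cmod (g (fst p) - g (snd p))) *\<^sub>R (\<psi> (snd p) * cnj (\<phi> (fst p))) \<partial>period_square)"
    and "(\<integral>t. symm_fun \<psi> t * cnj (\<phi> t) \<partial>period_measure) = (\<integral>s. \<psi> s * cnj (symm_fun \<phi> s) \<partial>period_measure)"
proof -
  obtain R where R: "0 < R" "\<And>s. cmod (g s) \<le> R" by (rule g_bounded) blast
  have m: "\<psi> \<in> borel_measurable period_measure" "\<phi> \<in> borel_measurable period_measure"
    using assms by (simp_all add: square_integrable_def)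
  let ?k = "\<lambda>t s. ln (cmod (g t - g s))"
  show int: "integrable period_square (\<lambda>p. ?k (fst p) (snd p) *\<^sub>R (\<psi> (snd p) * cnj (\<phi> (fst p))))"
  proof (rule square_integrable_scaleR)
    show "(\<lambda>p. ?k (fst p) (snd p)) \<in> borel_measurable period_square"
      by (rule borel_measurable_period_square) measurable
    show "integrable period_square (\<lambda>p. (?k (fst p) (snd p))\<^sup>2)"
      by (rule integrable_log_kernel(2)[OF g_measurable R(2)])
    have "(\<lambda>p. \<psi> (snd p)) \<in> borel_measurable period_square" "(\<lambda>p. \<phi> (fst p)) \<in> borel_measurable period_square"
      using m by (auto intro: measurable_compose[OF measurable_snd] measurable_compose[OF measurable_fst])
    moreover from this(2) have "(\<lambda>p. cnj (\<phi> (fst p))) \<in> borel_measurable period_square"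
      by (rule borel_measurable_continuous_on[where f = cnj, rotated]) (intro continuous_intros)
    ultimately show "(\<lambda>p. \<psi> (snd p) * cnj (\<phi> (fst p))) \<in> borel_measurable period_square"
      by (intro borel_measurable_times)
    have "integrable period_square (\<lambda>p. (cmod (\<phi> (fst p)))\<^sup>2 * (cmod (\<psi> (snd p)))\<^sup>2)"
      using assms by (intro integral_period_square_mult) (simp_all add: square_integrable_def)
    then show "integrable period_square (\<lambda>p. (cmod (\<psi> (snd p) * cnj (\<phi> (fst p))))\<^sup>2)"
      by (simp add: norm_mult power_mult_distrib mult.commute)
  qed
  have inner1: "symm_fun \<psi> t * cnj (\<phi> t) = - (1 / of_real pi) * (\<integral>s. ?k t s *\<^sub>R (\<psi> s * cnj (\<phi> t)) \<partial>period_measure)" for t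
  proof -
    have "(\<integral>s. ?k t s *\<^sub>R (\<psi> s * cnj (\<phi> t)) \<partial>period_measure) = (\<integral>s. (?k t s *\<^sub>R \<psi> s) * cnj (\<phi> t) \<partial>period_measure)"
      by simp
    also have "\<dots> = logpot \<psi> (g t) * cnj (\<phi> t)"
      unfolding logpot_def by (rule integral_mult_left_zero)
    finally show ?thesis by (simp only: symm_fun_def mult.assoc)
  qed
  have inner2: "\<psi> s * cnj (symm_fun \<phi> s) = - (1 / of_real pi) * (\<integral>t. ?k t s *\<^sub>R (\<psi> s * cnj (\<phi> t)) \<partial>period_measure)" for s
  proof -
    have "(\<integral>t. ?k t s *\<^sub>R (\<psi> s * cnj (\<phi> t)) \<partial>period_measure) = (\<integral>t. \<psi> s * cnj (?k s t *\<^sub>R \<phi> t) \<partial>period_measure)"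
      by (intro Bochner_Integration.integral_cong) (simp_all add: norm_minus_commute)
    also have "\<dots> = \<psi> s * cnj (logpot \<phi> (g s))"
      unfolding logpot_def by (simp only: integral_mult_right_zero Bochner_Integration.integral_cnj)
    finally show ?thesis by (simp add: symm_fun_def)
  qed
  show eq: "(\<integral>t. symm_fun \<psi> t * cnj (\<phi> t) \<partial>period_measure) =
      - (1 / of_real pi) * (\<integral>p. ?k (fst p) (snd p) *\<^sub>R (\<psi> (snd p) * cnj (\<phi> (fst p))) \<partial>period_square)"
    using period_pair.integral_fst'[OF int] by (simp only: inner1 integral_mult_right_zero fst_conv snd_conv)
  have "(\<integral>s. \<psi> s * cnj (symm_fun \<phi> s) \<partial>period_measure) =
      - (1 / of_real pi) * (\<integral>s. (\<integral>t. ?k t s *\<^sub>R (\<psi> s * cnj (\<phi> t)) \<partial>period_measure) \<partial>period_measure)"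
    by (simp only: inner2 integral_mult_right_zero)
  also have "(\<integral>s. (\<integral>t. ?k t s *\<^sub>R (\<psi> s * cnj (\<phi> t)) \<partial>period_measure) \<partial>period_measure) =
      (\<integral>p. ?k (fst p) (snd p) *\<^sub>R (\<psi> (snd p) * cnj (\<phi> (fst p))) \<partial>period_square)"
    using period_pair.integral_snd[of "\<lambda>t s. ?k t s *\<^sub>R (\<psi> s * cnj (\<phi> t))"] int by (simp add: case_prod_unfold)
  finally show "(\<integral>t. symm_fun \<psi> t * cnj (\<phi> t) \<partial>period_measure) = (\<integral>s. \<psi> s * cnj (symm_fun \<phi> s) \<partial>period_measure)"
    using eq by simp
qed

end

section \<open>Trigonometric polynomials and Parseval's identity\<close>

definition trig_poly :: "nat \<Rightarrow> (int \<Rightarrow> complex) \<Rightarrow> real \<Rightarrow> complex" where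
  "trig_poly n a t = (\<Sum>k \<in> {- int n..int n}. a k * cis (of_int k * t))"

lemma continuous_trig_poly: "continuous_on A (trig_poly n a)"
  unfolding trig_poly_def by (intro continuous_intros)

lemma trig_poly_periodic: "trig_poly n a (t + 2 * pi) = trig_poly n a t"
proof -
  have "cis (of_int k * (t + 2 * pi)) = cis (of_int k * t)" for k
    using periodic_int[of cis "of_int k * t" k] circle.per by (simp add: algebra_simps)
  then show ?thesis by (simp add: trig_poly_def)
qed

lemma bounded_trig_poly: "bounded (range (trig_poly n a))"
  unfolding bounded_iff
proof (intro exI ballI)
  fix z assume "z \<in> range (trig_poly n a)"
  then obtain t where "z = trig_poly n a t" by blast
  then show "cmod z \<le> (\<Sum>k \<in> {- int n..int n}. cmod (a k))"
    unfolding trig_poly_def by (auto intro!: sum_norm_le simp: norm_mult)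
qed

text \<open>For m different from 0 a shift by pi/m changes the sign of the integrand.\<close>

lemma integral_cis_int: "(\<integral>t. cis (of_int m * t) \<partial>period_measure) = (if m = 0 then 2 * pi else 0)"
proof (cases "m = 0")
  case True
  then show ?thesis by (simp add: scaleR_conv_of_real)
next
  case False
  let ?f = "\<lambda>t. cis (of_int m * t)"
  have per: "?f (t + 2 * pi) = ?f t" for t
    using periodic_int[of cis "of_int m * t" m] circle.per by (simp add: algebra_simps)
  have int: "integrable period_measure ?f"
    by (intro integrable_period_continuous continuous_intros)
  have "?f (pi / of_int m + t) = - ?f t" for t
  proof -
    have "of_int m * (pi / of_int m + t) = pi + of_int m * t" using False by (simp add: field_simps)
    then show ?thesis by (simp only: cis_mult[symmetric] cis_pi) simp
  qed
  then have "(\<integral>t. ?f t \<partial>period_measure) = - (\<integral>t. ?f t \<partial>period_measure)"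
    using periodic_shift(2)[of ?f "pi / of_int m", OF per int] by simp
  then show ?thesis using False by simp
qed

lemma parseval_trig_poly:
  "(\<integral>t. (cmod (trig_poly n a t))\<^sup>2 \<partial>period_measure) = 2 * pi * (\<Sum>k \<in> {- int n..int n}. (cmod (a k))\<^sup>2)"
proof -
  let ?K = "{- int n..int n}"
  have "complex_of_real (\<integral>t. (cmod (trig_poly n a t))\<^sup>2 \<partial>period_measure) =
      (\<integral>t. of_real ((cmod (trig_poly n a t))\<^sup>2) \<partial>period_measure)"
    by (simp only: integral_complex_of_real)
  also have "\<dots> = (\<integral>t. (\<Sum>j\<in>?K. \<Sum>k\<in>?K. a j * cnj (a k) * cis (of_int (j - k) * t)) \<partial>period_measure)"
  proof (rule Bochner_Integration.integral_cong[OF refl])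
    fix t
    have "a j * cis (of_int j * t) * (cnj (a k) * cnj (cis (of_int k * t))) = a j * cnj (a k) * cis (of_int (j - k) * t)" for j k
    proof -
      have "cis (of_int j * t) * cnj (cis (of_int k * t)) = cis (of_int (j - k) * t)"
        by (simp add: cis_cnj cis_mult left_diff_distrib)
      then show ?thesis by (metis (no_types) mult.assoc mult.left_commute)
    qed
    then show "of_real ((cmod (trig_poly n a t))\<^sup>2) = (\<Sum>j\<in>?K. \<Sum>k\<in>?K. a j * cnj (a k) * cis (of_int (j - k) * t))"
      by (simp only: complex_norm_square trig_poly_def cnj_sum complex_cnj_mult sum_product)
  qed
  also have "\<dots> = (\<Sum>j\<in>?K. \<Sum>k\<in>?K. a j * cnj (a k) * (\<integral>t. cis (of_int (j - k) * t) \<partial>period_measure))"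
  proof -
    have "integrable period_measure (\<lambda>t. a j * cnj (a k) * cis (of_int (j - k) * t))" for j k
      by (intro integrable_period_continuous continuous_intros)
    then show ?thesis by (subst Bochner_Integration.integral_sum, simp)+ simp
  qed
  also have "\<dots> = (\<Sum>j\<in>?K. \<Sum>k\<in>?K. if k = j then 2 * pi * (a j * cnj (a j)) else 0)"
    unfolding integral_cis_int by (intro sum.cong) auto
  also have "\<dots> = (\<Sum>j\<in>?K. of_real (2 * pi * (cmod (a j))\<^sup>2))"
    by (intro sum.cong) (simp_all add: sum.delta complex_norm_square[symmetric])
  also have "\<dots> = of_real (2 * pi * (\<Sum>k \<in> ?K. (cmod (a k))\<^sup>2))"
    by (simp only: of_real_sum sum_distrib_left)
  finally show ?thesis by (simp only: of_real_eq_iff)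
qed

text \<open>A shift by \<open>h\<close> multiplies the k-th coefficient by cis (k h), and |cis (k h)
  - 1| \<le> |k h| \<le> n |h|; Parseval turns this into the integral bound.\<close>

lemma trig_poly_shift_difference:
  "(\<integral>t. (cmod (trig_poly n a (t + h) - trig_poly n a t))\<^sup>2 \<partial>period_measure)
    \<le> (real n)\<^sup>2 * h\<^sup>2 * (\<integral>t. (cmod (trig_poly n a t))\<^sup>2 \<partial>period_measure)"
proof -
  let ?b = "\<lambda>k. a k * (cis (of_int k * h) - 1)"
  have "trig_poly n a (t + h) - trig_poly n a t = trig_poly n ?b t" for t
    unfolding trig_poly_def sum_subtractf[symmetric]
    by (intro sum.cong refl) (simp add: distrib_left cis_mult[symmetric] algebra_simps)
  moreover have "(cmod (?b k))\<^sup>2 \<le> (real n)\<^sup>2 * h\<^sup>2 * (cmod (a k))\<^sup>2" if "k \<in> {- int n..int n}" for k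
  proof -
    have k: "\<bar>of_int k\<bar> \<le> real n" using that by auto
    have "cmod (cis (of_int k * h) - cis 0) = 2 * \<bar>sin (of_int k * h / 2)\<bar>"
      using cmod_cis_diff[of "of_int k * h" 0] by simp
    also have "\<dots> \<le> 2 * \<bar>of_int k * h / 2\<bar>" using abs_sin_x_le_abs_x[of "of_int k * h / 2"] by simp
    also have "\<dots> \<le> real n * \<bar>h\<bar>" using k by (simp add: abs_mult mult_right_mono)
    finally have "cmod (cis (of_int k * h) - 1) \<le> real n * \<bar>h\<bar>" by simp
    then have "(cmod (cis (of_int k * h) - 1))\<^sup>2 \<le> (real n * \<bar>h\<bar>)\<^sup>2" by (intro power_mono) auto
    from mult_left_mono[OF this, of "(cmod (a k))\<^sup>2"] show ?thesis
      by (simp add: norm_mult power_mult_distrib mult_ac)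
  qed
  then have "(\<Sum>k \<in> {- int n..int n}. (cmod (?b k))\<^sup>2) \<le> (\<Sum>k \<in> {- int n..int n}. (real n)\<^sup>2 * h\<^sup>2 * (cmod (a k))\<^sup>2)"
    by (rule sum_mono)
  ultimately show ?thesis
    by (simp only: parseval_trig_poly) (simp add: sum_distrib_left[symmetric] mult_ac)
qed

lemma low_frequency_trig_poly: "low_frequency (real n) (trig_poly n a)"
  unfolding low_frequency_def
  using continuous_trig_poly trig_poly_periodic bounded_trig_poly trig_poly_shift_difference by blast

lemma Y_DLS_trig_poly:
  assumes "y \<in> Y_DLS n"
  obtains a where "y = abs_L2 (trig_poly n a)"
proof -
  have sq: "square_integrable (trig_poly n a)" for a
    by (intro square_integrable_continuous continuous_trig_poly)
  have "Y_DLS n \<subseteq> range (\<lambda>a. abs_L2 (trig_poly n a))"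
    unfolding Y_DLS_def
  proof (rule L2_complex.span_minimal)
    show "fourier_basis ` {- int n..int n} \<subseteq> range (\<lambda>a. abs_L2 (trig_poly n a))"
    proof
      fix x assume "x \<in> fourier_basis ` {- int n..int n}"
      then obtain k where k: "k \<in> {- int n..int n}" "x = fourier_basis k" by blast
      have "trig_poly n (\<lambda>j. if j = k then 1 else 0) = (\<lambda>t. exp (\<i> * of_int k * complex_of_real t))"
        using k(1) by (simp add: fun_eq_iff trig_poly_def if_distrib[of "\<lambda>c. c * _"] sum.delta cis_conv_exp mult_ac cong: if_cong)
      then show "x \<in> range (\<lambda>a. abs_L2 (trig_poly n a))"
        unfolding k(2) fourier_basis_def by (metis rangeI)
    qed
    have zero: "trig_poly n (\<lambda>_. 0) = (\<lambda>_. 0)" by (simp add: fun_eq_iff trig_poly_def)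
    have add: "abs_L2 (trig_poly n a) + abs_L2 (trig_poly n b) = abs_L2 (trig_poly n (\<lambda>k. a k + b k))" for a b
    proof -
      have "trig_poly n (\<lambda>k. a k + b k) = (\<lambda>t. trig_poly n a t + trig_poly n b t)"
        by (simp add: fun_eq_iff trig_poly_def distrib_right sum.distrib)
      then show ?thesis using plus_L2.abs_eq[OF L2_rel_refl[OF sq] L2_rel_refl[OF sq], of a b] by simp
    qed
    have scale: "scaleC c (abs_L2 (trig_poly n a)) = abs_L2 (trig_poly n (\<lambda>k. c * a k))" for c a
    proof -
      have "trig_poly n (\<lambda>k. c * a k) = (\<lambda>t. c * trig_poly n a t)"
        by (simp add: fun_eq_iff trig_poly_def sum_distrib_left mult.assoc)
      then show ?thesis using scaleC.abs_eq[OF L2_rel_refl[OF sq], of c a] by simp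
    qed
    have "(0::L2) = abs_L2 (trig_poly n (\<lambda>_. 0))" unfolding zero by (simp only: zero_L2_def)
    then show "L2_complex.subspace (range (\<lambda>a. abs_L2 (trig_poly n a)))"
      unfolding L2_complex.subspace_def using add scale by (auto intro: range_eqI)
  qed
  then show ?thesis using assms that by blast
qed

section \<open>Symm's operator on classes and its stability\<close>

locale symm_curve = bilipschitz_loop g l for g l +
  fixes \<gamma> :: "real \<Rightarrow> real \<times> real"
  assumes g_def: "g = (\<lambda>t. Complex (fst (\<gamma> t)) (snd (\<gamma> t)))"
begin

lemma symm_op_abs:
  assumes \<psi>: "square_integrable \<psi>"
  shows "symm_op \<gamma> (abs_L2 \<psi>) = abs_L2 (symm_fun \<psi>)"
proof -
  have "norm (\<gamma> t - \<gamma> s) = cmod (g t - g s)" for t s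
    by (simp add: g_def norm_prod_def cmod_def)
  then have "symm_op \<gamma> (abs_L2 \<psi>) = abs_L2 (symm_fun (rep_L2 (abs_L2 \<psi>)))"
    unfolding symm_op_def symm_fun_def[abs_def] logpot_def
    by (simp only: scaleR_conv_of_real mult.commute)
  also have "symm_fun (rep_L2 (abs_L2 \<psi>)) = symm_fun \<psi>"
    unfolding symm_fun_def[abs_def] using logpot_cong_AE[OF square_integrable_rep \<psi> rep_abs_L2[OF \<psi>]] by simp
  finally show ?thesis .
qed

lemma symm_op_linear: "module_hom scaleC scaleC (symm_op \<gamma>)"
proof
  fix x y :: L2 and c :: complex
  define f where "f = rep_L2 x"
  define h where "h = rep_L2 y"
  have f: "square_integrable f" "x = abs_L2 f" by (simp_all add: f_def)
  have h: "square_integrable h" "y = abs_L2 h" by (simp_all add: h_def)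
  note refl = L2_rel_refl[OF f(1)] L2_rel_refl[OF h(1)]
    L2_rel_refl[OF square_integrable_symm_fun[OF f(1)]] L2_rel_refl[OF square_integrable_symm_fun[OF h(1)]]
  have "symm_fun (\<lambda>t. f t + h t) = (\<lambda>t. symm_fun f t + symm_fun h t)"
    using logpot_add[OF f(1) h(1)] by (simp add: symm_fun_def[abs_def] fun_eq_iff add_divide_distrib)
  then show "symm_op \<gamma> (x + y) = symm_op \<gamma> x + symm_op \<gamma> y"
    using symm_op_abs[OF square_integrable_add[OF f(1) h(1)]]
    by (simp add: f(2) h(2) plus_L2.abs_eq[OF refl(1,2)] plus_L2.abs_eq[OF refl(3,4)]
        symm_op_abs[OF f(1)] symm_op_abs[OF h(1)])
  have "symm_fun (\<lambda>t. c * f t) = (\<lambda>t. c * symm_fun f t)"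
    by (simp add: symm_fun_def[abs_def] logpot_mult)
  then show "symm_op \<gamma> (scaleC c x) = scaleC c (symm_op \<gamma> x)"
    using symm_op_abs[OF square_integrable_mult[OF f(1)], of c]
    by (simp add: f(2) scaleC.abs_eq[OF refl(1)] scaleC.abs_eq[OF refl(3)] symm_op_abs[OF f(1)])
qed

lemma cinner_abs_L2:
  assumes "square_integrable f" "square_integrable h"
  shows "cinner (abs_L2 f) (abs_L2 h) = (\<integral>t. f t * cnj (h t) \<partial>period_measure)"
  using assms by (intro cinner.abs_eq L2_rel_refl)

lemma symm_op_self_adjoint: "cinner (symm_op \<gamma> x) y = cinner x (symm_op \<gamma> y)"
proof -
  define f where "f = rep_L2 x"
  define h where "h = rep_L2 y"
  have f: "square_integrable f" "x = abs_L2 f" by (simp_all add: f_def)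
  have h: "square_integrable h" "y = abs_L2 h" by (simp_all add: h_def)
  show ?thesis
    unfolding f(2) h(2) symm_op_abs[OF f(1)] symm_op_abs[OF h(1)]
    by (simp only: cinner_abs_L2 square_integrable_symm_fun f(1) h(1) symm_fun_self_adjoint(3)[OF f(1) h(1)])
qed

text \<open>The hypothesis with \<open>C\<close> hides the position of the curve relative to the
  circle. It bounds the correction in \<open>log_energy\<close> by a multiple of
  \<parallel>y\<parallel> \<parallel>K y\<parallel>, as Cauchy-Schwarz does for \<langle>K y,
  y\<rangle>, and one factor \<parallel>y\<parallel> is then divided out of the coercivity
  estimate.\<close>

lemma symm_op_stable_on_trig_poly:
  assumes L: "\<And>t s. t \<in> {0..2 * pi} \<Longrightarrow> s \<in> {0..2 * pi} \<Longrightarrow> cmod (g t - g s) \<le> L * \<bar>t - s\<bar>"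
    and L0: "0 \<le> L" and d: "0 < d" "\<And>t. d \<le> \<bar>cmod (g t - z0) - 1\<bar>"
    and C: "0 \<le> C" "\<And>u::real \<Rightarrow> real. continuous_on UNIV u \<Longrightarrow>
      \<bar>\<integral>t. max 0 (ln (cmod (g t - z0))) * u t \<partial>period_measure\<bar> \<le> C * (\<integral>s. \<bar>logpot u (g s)\<bar> \<partial>period_measure)"
  obtains c where "0 < c" "\<And>n y. 1 \<le> n \<Longrightarrow> y \<in> Y_DLS n \<Longrightarrow> norm y \<le> c * real n * norm (symm_op \<gamma> y)"
proof -
  obtain c0 where c0: "0 < c0"
    "\<And>y N. 1 \<le> N \<Longrightarrow> low_frequency N y \<Longrightarrow>
      c0 / N * (\<integral>t. (cmod (y t))\<^sup>2 \<partial>period_measure) \<le> log_energy z0 (\<lambda>t. Re (y t)) + log_energy z0 (\<lambda>t. Im (y t))"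
    by (rule log_energy_coercive[OF L L0 d], assumption, assumption) (rule that)
  \<comment> \<open>The summand pi comes from pi \<langle>K y, y\<rangle>, and 4 pi^2 C from the
    correction, once for the real and once for the imaginary part.\<close>
  define A where "A = pi + 8 * pi\<^sup>2 * C"
  have A: "0 < A" using C(1) by (simp add: A_def add_pos_nonneg)
  have main: "norm y \<le> A / c0 * real n * norm (symm_op \<gamma> y)" if n: "1 \<le> n" and y: "y \<in> Y_DLS n" for n y
  proof -
    obtain a where a: "y = abs_L2 (trig_poly n a)" using y by (rule Y_DLS_trig_poly)
    define p where "p = trig_poly n a"
    define F where "F = symm_fun p"
    have contp: "continuous_on A p" for A unfolding p_def by (rule continuous_trig_poly)
    have p: "square_integrable p" by (rule square_integrable_continuous[OF contp])
    have F: "square_integrable F" unfolding F_def by (rule square_integrable_symm_fun[OF p])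
    have Ky: "symm_op \<gamma> y = abs_L2 F" unfolding a p_def[symmetric] F_def by (rule symm_op_abs[OF p])
    define S where "S = (\<integral>t. (cmod (p t))\<^sup>2 \<partial>period_measure)"
    have S: "S = (norm y)\<^sup>2"
      unfolding a p_def[symmetric] S_def norm_abs_L2[OF p] by simp
    have l1: "(\<integral>t. \<bar>f t\<bar> \<partial>period_measure) \<le> sqrt (2 * pi) * norm (abs_L2 h)"
      if "continuous_on {0..2 * pi} f" "square_integrable h" "\<And>t. \<bar>f t\<bar> \<le> cmod (h t)" for f :: "real \<Rightarrow> real" and h
    proof -
      have int: "integrable period_measure (\<lambda>t. (f t)\<^sup>2)"
        by (intro integrable_period_continuous continuous_intros that(1))
      have "(\<integral>t. \<bar>f t\<bar> \<partial>period_measure)\<^sup>2 \<le> 2 * pi * (\<integral>t. (f t)\<^sup>2 \<partial>period_measure)"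
        by (intro cauchy_schwarz_period int borel_measurable_integrable[OF integrable_period_continuous[OF that(1)]])
      also have "\<dots> \<le> 2 * pi * (\<integral>t. (cmod (h t))\<^sup>2 \<partial>period_measure)"
      proof (intro mult_left_mono integral_mono int)
        show "(f t)\<^sup>2 \<le> (cmod (h t))\<^sup>2" for t using that(3)[of t] by (metis abs_ge_zero power2_abs power_mono)
      qed (use that(2) in \<open>auto simp: square_integrable_def\<close>)
      also have "\<dots> = (sqrt (2 * pi) * norm (abs_L2 h))\<^sup>2"
        unfolding norm_abs_L2[OF that(2)] by (simp add: power_mult_distrib)
      finally show ?thesis by (rule power2_le_imp_le) simp
    qed
    \<comment> \<open>The mass of \<open>u\<close> is controlled by \<parallel>y\<parallel> and the
      other factor, through \<open>C\<close>, by \<parallel>K y\<parallel>; each passage from the L1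
      to the L2 norm costs sqrt (2 pi).\<close>
    have part: "\<bar>2 * (\<integral>t. u t \<partial>period_measure) * (\<integral>t. max 0 (ln (cmod (g t - z0))) * u t \<partial>period_measure)\<bar>
        \<le> 4 * pi\<^sup>2 * C * (norm y * norm (symm_op \<gamma> y))"
      if u: "continuous_on UNIV u" "\<And>t. \<bar>u t\<bar> \<le> cmod (p t)" "\<And>s. \<bar>logpot u (g s)\<bar> \<le> pi * cmod (F s)" for u :: "real \<Rightarrow> real"
    proof -
      have "\<bar>\<integral>t. u t \<partial>period_measure\<bar> \<le> (\<integral>t. \<bar>u t\<bar> \<partial>period_measure)"
        using integral_norm_bound[of period_measure u] by simp
      also have "\<dots> \<le> sqrt (2 * pi) * norm y"
        unfolding a p_def[symmetric] by (rule l1[OF continuous_on_subset[OF u(1)] p u(2)]) simp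
      finally have 1: "\<bar>\<integral>t. u t \<partial>period_measure\<bar> \<le> sqrt (2 * pi) * norm y" .
      have sq_u: "u \<in> borel_measurable period_measure" "integrable period_measure (\<lambda>s. (norm (u s))\<^sup>2)"
        by (auto intro!: borel_measurable_period borel_measurable_continuous_onI u(1)
            integrable_period_continuous continuous_intros continuous_on_subset[OF u(1)])
      have contV: "continuous_on {0..2 * pi} (\<lambda>s. logpot u (g s) / pi)"
        by (intro continuous_intros continuous_on_compose2[OF continuous_logpot[OF sq_u]] continuous_on_subset[OF cont]) auto
      have "(\<integral>s. \<bar>logpot u (g s) / pi\<bar> \<partial>period_measure) \<le> sqrt (2 * pi) * norm (symm_op \<gamma> y)"
        unfolding Ky using u(3) by (intro l1[OF contV F]) (simp add: pos_divide_le_eq mult.commute)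
      then have "C * (\<integral>s. \<bar>logpot u (g s)\<bar> \<partial>period_measure) \<le> C * (pi * (sqrt (2 * pi) * norm (symm_op \<gamma> y)))"
        using C(1) by (intro mult_left_mono) (simp_all add: pos_divide_le_eq mult.commute)
      with C(2)[OF u(1)] have 2: "\<bar>\<integral>t. max 0 (ln (cmod (g t - z0))) * u t \<partial>period_measure\<bar> \<le> C * (pi * (sqrt (2 * pi) * norm (symm_op \<gamma> y)))"
        by linarith
      have "\<bar>2 * (\<integral>t. u t \<partial>period_measure) * (\<integral>t. max 0 (ln (cmod (g t - z0))) * u t \<partial>period_measure)\<bar>
        \<le> 2 * (sqrt (2 * pi) * norm y) * (C * (pi * (sqrt (2 * pi) * norm (symm_op \<gamma> y))))"
        unfolding abs_mult using 1 2 by (intro mult_mono) auto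
      also have "\<dots> = 2 * (sqrt (2 * pi) * sqrt (2 * pi)) * pi * C * (norm y * norm (symm_op \<gamma> y))"
        by (simp only: mult_ac)
      also have "\<dots> = 4 * pi\<^sup>2 * C * (norm y * norm (symm_op \<gamma> y))"
        by (simp add: power2_eq_square)
      finally show ?thesis .
    qed
    let ?u = "\<lambda>t. Re (p t)" and ?v = "\<lambda>t. Im (p t)"
    let ?k = "\<lambda>q. ln (cmod (g (fst q) - g (snd q)))"
    have pm: "p \<in> borel_measurable period_measure" "integrable period_measure (\<lambda>s. (norm (p s))\<^sup>2)"
      using p by (simp_all add: square_integrable_def)
    note ip = integrable_logpot[OF pm]
    \<comment> \<open>The energies are real quadratic forms, so a complex density is split; the
      potentials of its parts are dominated by that of the whole.\<close>
    have lu: "logpot ?u x = Re (logpot p x)" and lv: "logpot ?v x = Im (logpot p x)" for x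
      unfolding logpot_def Bochner_Integration.integral_Re[symmetric, OF ip] Bochner_Integration.integral_Im[symmetric, OF ip]
      by simp_all
    have F_eq: "pi * cmod (F s) = cmod (logpot p (g s))" for s
      by (simp add: F_def symm_fun_def norm_mult norm_divide)
    have bu: "\<bar>2 * (\<integral>t. ?u t \<partial>period_measure) * (\<integral>t. max 0 (ln (cmod (g t - z0))) * ?u t \<partial>period_measure)\<bar>
        \<le> 4 * pi\<^sup>2 * C * (norm y * norm (symm_op \<gamma> y))"
      using contp by (intro part continuous_intros) (simp_all only: lu F_eq abs_Re_le_cmod)
    have bv: "\<bar>2 * (\<integral>t. ?v t \<partial>period_measure) * (\<integral>t. max 0 (ln (cmod (g t - z0))) * ?v t \<partial>period_measure)\<bar>
        \<le> 4 * pi\<^sup>2 * C * (norm y * norm (symm_op \<gamma> y))"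
      using contp by (intro part continuous_intros) (simp_all only: lv F_eq abs_Im_le_cmod)
    have int_real: "integrable period_square (\<lambda>q. ?k q * (w (fst q) * w (snd q)))"
      if "continuous_on UNIV w" for w :: "real \<Rightarrow> real"
    proof -
      have "square_integrable (\<lambda>t. of_real (w t))"
        by (intro square_integrable_continuous continuous_intros continuous_on_subset[OF that]) simp
      from integrable_Re[OF symm_fun_self_adjoint(1)[OF this this]]
      show ?thesis by (simp add: mult.commute)
    qed
    have "cinner (symm_op \<gamma> y) y = - (1 / of_real pi) * (\<integral>q. ?k q *\<^sub>R (p (snd q) * cnj (p (fst q))) \<partial>period_square)"
    proof -
      have "cinner (symm_op \<gamma> y) y = cinner (abs_L2 F) (abs_L2 p)"
        unfolding Ky by (simp only: a p_def)
      then show ?thesis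
        unfolding cinner_abs_L2[OF F p] unfolding F_def by (simp only: symm_fun_self_adjoint(2)[OF p p])
    qed
    then have "pi * Re (cinner (symm_op \<gamma> y) y) = - Re (\<integral>q. ?k q *\<^sub>R (p (snd q) * cnj (p (fst q))) \<partial>period_square)"
      by simp
    also have "Re (\<integral>q. ?k q *\<^sub>R (p (snd q) * cnj (p (fst q))) \<partial>period_square) =
        (\<integral>q. Re (?k q *\<^sub>R (p (snd q) * cnj (p (fst q)))) \<partial>period_square)"
      by (rule Bochner_Integration.integral_Re[symmetric, OF symm_fun_self_adjoint(1)[OF p p]])
    also have "\<dots> = (\<integral>q. ?k q * (?u (fst q) * ?u (snd q)) + ?k q * (?v (fst q) * ?v (snd q)) \<partial>period_square)"
      by (intro Bochner_Integration.integral_cong refl) (simp add: algebra_simps)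
    also have "\<dots> = (\<integral>q. ?k q * (?u (fst q) * ?u (snd q)) \<partial>period_square) + (\<integral>q. ?k q * (?v (fst q) * ?v (snd q)) \<partial>period_square)"
      by (intro Bochner_Integration.integral_add int_real continuous_intros contp)
    finally have form: "pi * Re (cinner (symm_op \<gamma> y) y) =
        - (\<integral>q. ?k q * (?u (fst q) * ?u (snd q)) \<partial>period_square) - (\<integral>q. ?k q * (?v (fst q) * ?v (snd q)) \<partial>period_square)"
      by simp
    have "Re (cinner (symm_op \<gamma> y) y) \<le> norm (symm_op \<gamma> y) * norm y"
      using norm_cauchy_schwarz[of "symm_op \<gamma> y" y] by (simp add: inner_L2_def)
    then have cs: "pi * Re (cinner (symm_op \<gamma> y) y) \<le> pi * (norm y * norm (symm_op \<gamma> y))"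
      by (intro mult_left_mono) (simp_all add: mult.commute)
    have "c0 / real n * S \<le> log_energy z0 ?u + log_energy z0 ?v"
      unfolding S_def
    proof (rule c0(2))
      show "1 \<le> real n" using n by simp
      show "low_frequency (real n) p"
        unfolding p_def by (rule low_frequency_trig_poly)
    qed
    also have "\<dots> \<le> A * (norm y * norm (symm_op \<gamma> y))"
      using bu bv cs unfolding form log_energy_def A_def abs_le_iff distrib_right by linarith
    finally have "c0 / real n * (norm y * norm y) \<le> A * (norm y * norm (symm_op \<gamma> y))"
      unfolding S by (simp only: power2_eq_square)
    then have "norm y * (c0 / real n * norm y) \<le> norm y * (A * norm (symm_op \<gamma> y))"
      by (simp only: mult_ac)
    then have "c0 / real n * norm y \<le> A * norm (symm_op \<gamma> y)" if "norm y \<noteq> 0"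
      by (rule mult_left_le_imp_le) (use that in simp)
    then have "norm y \<le> A * norm (symm_op \<gamma> y) * real n / c0" if "norm y \<noteq> 0"
      using that c0(1) n by (simp add: field_simps)
    then show ?thesis using A c0(1) by (cases "norm y = 0") (simp_all add: mult_ac)
  qed
  show ?thesis
  proof
    show "0 < A / c0" using A c0(1) by simp
  qed (rule main)
qed

end

lemma C3_closed_curve_C2_loop:
  assumes "C3_closed_curve \<gamma>"
  obtains g1 g2 where "C2_loop (\<lambda>t. Complex (fst (\<gamma> t)) (snd (\<gamma> t))) g1 g2"
proof -
  define \<phi> :: "real \<times> real \<Rightarrow> complex" where "\<phi> = (\<lambda>p. Complex (fst p) (snd p))"
  have \<phi>: "bounded_linear \<phi>"
    unfolding \<phi>_def
    by (rule bounded_linear_intro[where K = 1]) (auto simp: complex_eq_iff norm_prod_def cmod_def)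
  have inj: "inj \<phi>" by (auto simp: inj_def \<phi>_def prod_eq_iff)
  obtain \<gamma>1 \<gamma>2 \<gamma>3 where \<gamma>: "\<And>s. \<gamma> (s + 2 * pi) = \<gamma> s" "inj_on \<gamma> {0..<2 * pi}"
    "\<And>s. (\<gamma> has_vector_derivative \<gamma>1 s) (at s)" "\<And>s. (\<gamma>1 has_vector_derivative \<gamma>2 s) (at s)"
    "\<And>s. (\<gamma>2 has_vector_derivative \<gamma>3 s) (at s)" "\<And>s. norm (\<gamma>1 s) > 0"
    using assms unfolding C3_closed_curve_def by blast
  have "C2_loop (\<lambda>t. \<phi> (\<gamma> t)) (\<lambda>t. \<phi> (\<gamma>1 t)) (\<lambda>t. \<phi> (\<gamma>2 t))"
  proof
    show "inj_on (\<lambda>t. \<phi> (\<gamma> t)) {0..<2 * pi}"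
      by (rule inj_onI) (auto dest!: injD[OF inj] inj_onD[OF \<gamma>(2)])
    have "continuous_on UNIV \<gamma>2"
      using \<gamma>(5) by (intro continuous_at_imp_continuous_on) (auto intro: has_vector_derivative_continuous)
    then show "continuous_on UNIV (\<lambda>t. \<phi> (\<gamma>2 t))"
      by (rule bounded_linear.continuous_on[OF \<phi>])
    fix s
    show "\<phi> (\<gamma> (s + 2 * pi)) = \<phi> (\<gamma> s)" by (simp add: \<gamma>(1))
    show "((\<lambda>t. \<phi> (\<gamma> t)) has_vector_derivative \<phi> (\<gamma>1 s)) (at s)"
      "((\<lambda>t. \<phi> (\<gamma>1 t)) has_vector_derivative \<phi> (\<gamma>2 s)) (at s)"
      using \<gamma>(3,4) by (auto intro: bounded_linear.has_vector_derivative[OF \<phi>])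
    show "\<phi> (\<gamma>1 s) \<noteq> 0" using \<gamma>(6)[of s] by (auto simp: \<phi>_def complex_eq_iff prod_eq_iff)
  qed
  then show ?thesis using that unfolding \<phi>_def by blast
qed

section \<open>The dual least squares method\<close>

lemma cinner_zero_left [simp]: "cinner 0 g = 0"
  using cinner_add_left[of 0 0 g] by simp

lemma cinner_diff_left: "cinner (f - g) h = cinner f h - cinner g h"
  using cinner_add_left[of "f - g" g h] by simp

lemma cinner_add_right: "cinner h (f + g) = cinner h f + cinner h g"
  by (subst (1 2 3) cinner_cnj) (simp add: cinner_add_left)

lemma cinner_zero_right [simp]: "cinner g 0 = 0"
  by (subst cinner_cnj) simp

lemma cinner_scaleC_right: "cinner h (scaleC c f) = cnj c * cinner h f"
  by (subst (1 2) cinner_cnj) (simp add: cinner_scaleC_left)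

lemma cinner_self_eq_norm: "cinner f f = of_real ((norm f)\<^sup>2)"
  using cinner_self(1,2)[of f] by (simp add: norm_L2_def complex_eq_iff)

lemma cinner_eq_zero_iff: "cinner f f = 0 \<longleftrightarrow> f = 0"
  by (simp add: cinner_self_eq_norm)

lemma Re_cinner_le_norm: "Re (cinner f g) \<le> norm f * norm g"
  using norm_cauchy_schwarz[of f g] by (simp add: inner_L2_def)

text \<open>Gram-Schmidt: the new vector is replaced by its component \<open>a'\<close> orthogonal
  to the old span, and the projection gains one coordinate.\<close>

lemma ex_orth_proj_span:
  assumes "finite B"
  shows "\<exists>g \<in> cspan B. \<forall>h \<in> cspan B. cinner (f - g) h = 0"
  using assms
proof (induction B arbitrary: f)
  case empty
  then show ?case by simp
next
  case (insert a B)
  obtain p where p: "p \<in> cspan B" "\<And>h. h \<in> cspan B \<Longrightarrow> cinner (a - p) h = 0"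
    using insert.IH by blast
  obtain q where q: "q \<in> cspan B" "\<And>h. h \<in> cspan B \<Longrightarrow> cinner (f - q) h = 0"
    using insert.IH by blast
  define a' where "a' = a - p"
  \<comment> \<open>If \<open>a'\<close> is 0 the quotient is 0 by convention, the right coordinate
    for a dependent vector.\<close>
  define c where "c = cinner f a' / cinner a' a'"
  have a': "cinner h a' = 0" if "h \<in> cspan B" for h
    using p(2)[OF that] by (subst cinner_cnj) (simp add: a'_def)
  have mono: "cspan B \<subseteq> cspan (insert a B)" by (intro L2_complex.span_mono) auto
  have "q + scaleC c a' \<in> cspan (insert a B)"
    unfolding a'_def using p(1) q(1) mono
    by (intro L2_complex.span_add L2_complex.span_scale L2_complex.span_diff) (auto intro: L2_complex.span_base)
  moreover have "cinner (f - (q + scaleC c a')) h = 0" if h: "h \<in> cspan (insert a B)" for h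
  proof -
    obtain k where k: "h - scaleC k a \<in> cspan B" using h by (auto simp: L2_complex.span_breakdown_eq)
    define b where "b = (h - scaleC k a) + scaleC k p"
    have b: "b \<in> cspan B"
      unfolding b_def using k p(1) by (intro L2_complex.span_add L2_complex.span_scale)
    have h_eq: "h = scaleC k a' + b"
      by (simp add: b_def a'_def L2_complex.scale_right_diff_distrib)
    have "cinner (f - (q + scaleC c a')) b = 0"
      using q(2)[OF b] p(2)[OF b] by (simp add: cinner_diff_left cinner_add_left cinner_scaleC_left a'_def)
    moreover have "cinner (f - (q + scaleC c a')) a' = 0"
      using a'[OF q(1)] by (cases "a' = 0")
        (simp_all add: cinner_diff_left cinner_add_left cinner_scaleC_left c_def cinner_eq_zero_iff)
    ultimately show ?thesis by (simp add: h_eq cinner_add_right cinner_scaleC_right)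
  qed
  ultimately show ?case by blast
qed

lemma orth_proj_unique:
  assumes "g \<in> cspan B" "\<And>h. h \<in> cspan B \<Longrightarrow> cinner (f - g) h = 0"
  shows "orth_proj (cspan B) f = g"
  unfolding orth_proj_def
proof (rule the_equality)
  fix g' assume g': "g' \<in> cspan B \<and> (\<forall>h \<in> cspan B. cinner (f - g') h = 0)"
  then have "g - g' \<in> cspan B" using assms(1) by (intro L2_complex.span_diff) auto
  then have "cinner (f - g') (g - g') - cinner (f - g) (g - g') = 0" using g' assms(2) by simp
  then have "cinner (g - g') (g - g') = 0" by (simp add: cinner_diff_left)
  then show "g' = g" by (simp add: cinner_eq_zero_iff)
qed (use assms in auto)

lemma orth_proj_span:
  assumes "finite B"
  shows "orth_proj (cspan B) f \<in> cspan B"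
    and "h \<in> cspan B \<Longrightarrow> cinner (f - orth_proj (cspan B) f) h = 0"
proof -
  obtain g where g: "g \<in> cspan B" "\<And>h. h \<in> cspan B \<Longrightarrow> cinner (f - g) h = 0"
    using ex_orth_proj_span[OF assms] by blast
  have "orth_proj (cspan B) f = g" using g by (rule orth_proj_unique)
  with g show "orth_proj (cspan B) f \<in> cspan B"
    "h \<in> cspan B \<Longrightarrow> cinner (f - orth_proj (cspan B) f) h = 0" by auto
qed

lemma orth_proj_ident: "f \<in> cspan B \<Longrightarrow> orth_proj (cspan B) f = f"
  by (rule orth_proj_unique) auto

lemma orth_proj_linear:
  assumes "finite B"
  shows "module_hom scaleC scaleC (orth_proj (cspan B))"
proof
  fix f g c
  show "orth_proj (cspan B) (f + g) = orth_proj (cspan B) f + orth_proj (cspan B) g"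
  proof (rule orth_proj_unique)
    show "orth_proj (cspan B) f + orth_proj (cspan B) g \<in> cspan B"
      using orth_proj_span(1)[OF assms] by (intro L2_complex.span_add)
    show "cinner (f + g - (orth_proj (cspan B) f + orth_proj (cspan B) g)) h = 0" if "h \<in> cspan B" for h
      using orth_proj_span(2)[OF assms that, of f] orth_proj_span(2)[OF assms that, of g]
      by (simp add: cinner_diff_left cinner_add_left)
  qed
  show "orth_proj (cspan B) (scaleC c f) = scaleC c (orth_proj (cspan B) f)"
  proof (rule orth_proj_unique)
    show "scaleC c (orth_proj (cspan B) f) \<in> cspan B"
      using orth_proj_span(1)[OF assms] by (intro L2_complex.span_scale)
    show "cinner (scaleC c f - scaleC c (orth_proj (cspan B) f)) h = 0" if "h \<in> cspan B" for h
      using orth_proj_span(2)[OF assms that, of f]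
      by (simp add: cinner_diff_left cinner_scaleC_left)
  qed
qed

lemma image_cspan:
  assumes "module_hom scaleC scaleC T"
  shows "T ` cspan B = cspan (T ` B)"
  unfolding cspan_def by (rule module_hom.span_image[OF assms, symmetric])

lemma norm_diff_orth_proj_le:
  assumes "finite B" "w \<in> cspan B"
  shows "norm (f - orth_proj (cspan B) f) \<le> norm (f - w)"
proof -
  let ?z = "orth_proj (cspan B) f"
  have "?z - w \<in> cspan B" using orth_proj_span(1)[OF assms(1)] assms(2) by (intro L2_complex.span_diff)
  then have "inner (f - ?z) (?z - w) = 0"
    using orth_proj_span(2)[OF assms(1)] by (simp add: inner_L2_def)
  then have "(norm ((f - ?z) + (?z - w)))\<^sup>2 = (norm (f - ?z))\<^sup>2 + (norm (?z - w))\<^sup>2"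
    by (intro norm_add_Pythagorean) (simp add: orthogonal_def)
  then have "(norm (f - ?z))\<^sup>2 \<le> (norm (f - w))\<^sup>2" by simp
  then show ?thesis by (rule power2_le_imp_le) simp
qed

text \<open>The computed \<xi> satisfies the Galerkin conditions \<langle>T \<xi>, y\<rangle> =
  \<langle>b, y\<rangle> on the span. Its difference from the best approximation z has the form T y,
  and testing with this very y gives \<parallel>T y\<parallel>^2 = Re \<langle>b - T x, y\<rangle>,
  because x - z is orthogonal to \<open>X\<close>. Stability then bounds \<parallel>T y\<parallel>
  by \<sigma> \<delta>.\<close>

lemma dual_least_squares_estimate:
  fixes T :: "L2 \<Rightarrow> L2" and B :: "L2 set" and \<sigma> \<delta> :: real
  assumes T: "module_hom scaleC scaleC T"
    and self_adjoint: "\<And>f g. cinner (T f) g = cinner f (T g)"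
    and B: "finite B"
    and stable: "\<And>y. y \<in> cspan B \<Longrightarrow> norm y \<le> \<sigma> * norm (T y)" and \<sigma>: "0 \<le> \<sigma>"
  defines "X \<equiv> T ` cspan B"
  defines "A \<equiv> \<lambda>f. orth_proj (cspan B) (T (orth_proj X f))"
  assumes noise: "norm (b - T x) \<le> \<delta>"
  shows "is_arg_min (\<lambda>z. norm (x - z)) (\<lambda>z. z \<in> X) (orth_proj X x)"
    and "norm (x - inv_into X A (orth_proj (cspan B) b)) \<le> \<sigma> * \<delta> + 2 * norm (x - orth_proj X x)"
proof -
  interpret T: module_hom scaleC scaleC T by (rule T)
  have X: "X = cspan (T ` B)" unfolding X_def by (rule image_cspan[OF T])
  have finX: "finite (T ` B)" using B by simp
  let ?P = "orth_proj (cspan B)" and ?z = "orth_proj X x"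
  interpret P: module_hom scaleC scaleC ?P by (rule orth_proj_linear[OF B])
  note P = orth_proj_span[OF B]
  have z: "?z \<in> X" "\<And>h. h \<in> X \<Longrightarrow> cinner (x - ?z) h = 0"
    unfolding X by (rule orth_proj_span(1)[OF finX], rule orth_proj_span(2)[OF finX])
  show "is_arg_min (\<lambda>z. norm (x - z)) (\<lambda>z. z \<in> X) ?z"
    unfolding is_arg_min_def using z(1) norm_diff_orth_proj_le[OF finX] unfolding X
    by (auto simp: not_less)
  \<comment> \<open>An element \<open>w\<close> of the span orthogonal to the range of P T T
    satisfies \<langle>T w, T w\<rangle> = 0 by self-adjointness and is 0 by stability, so P T T
    maps the span onto itself. Then \<open>inv_into\<close> returns a genuine preimage under
    \<open>A\<close>.\<close>
  have surj: "v \<in> A ` X" if v: "v \<in> cspan B" for v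
  proof -
    let ?S = "\<lambda>f. ?P (T (T f))"
    interpret S: module_hom scaleC scaleC ?S
    proof
      show "?S (f + g) = ?S f + ?S g" for f g by (simp only: T.add P.add)
      show "?S (scaleC c f) = scaleC c (?S f)" for c f by (simp only: T.scale P.scale)
    qed
    have S: "?S ` cspan B = cspan (?S ` B)" by (rule image_cspan[OF S.module_hom_axioms])
    have finS: "finite (?S ` B)" using B by simp
    define w where "w = v - orth_proj (cspan (?S ` B)) v"
    have "cspan (?S ` B) \<subseteq> cspan B" unfolding S[symmetric] using P(1) by auto
    then have w: "w \<in> cspan B"
      unfolding w_def using v orth_proj_span(1)[OF finS] by (intro L2_complex.span_diff) auto
    have "?S w \<in> cspan (?S ` B)" using w unfolding S[symmetric] by blast
    then have "cinner w (?S w) = 0" unfolding w_def using orth_proj_span(2)[OF finS] by blast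
    moreover have "cinner (T (T w) - ?S w) w = 0" by (rule P(2)[OF w])
    then have "cinner w (T (T w)) = cinner w (?S w)"
      by (subst (1 2) cinner_cnj) (simp add: cinner_diff_left)
    ultimately have "cinner (T w) (T w) = 0" by (simp add: self_adjoint)
    then have "norm w \<le> 0" using stable[OF w] by (simp add: cinner_eq_zero_iff)
    then have "v = orth_proj (cspan (?S ` B)) v" by (simp add: w_def)
    then have "v \<in> ?S ` cspan B" unfolding S using orth_proj_span(1)[OF finS] by metis
    then obtain y where y: "y \<in> cspan B" "v = ?S y" by blast
    have "T y \<in> X" using y(1) by (simp add: X_def)
    moreover from this have "A (T y) = v" unfolding A_def X y(2) by (simp only: orth_proj_ident)
    ultimately show ?thesis by blast
  qed
  define \<xi> where "\<xi> = inv_into X A (?P b)"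
  have \<xi>: "\<xi> \<in> X" "A \<xi> = ?P b"
    unfolding \<xi>_def using surj[OF P(1)] by (auto intro: inv_into_into f_inv_into_f)
  have "A \<xi> = ?P (T \<xi>)" using \<xi>(1) unfolding A_def X by (simp only: orth_proj_ident)
  then have P\<xi>: "?P (T \<xi>) = ?P b" using \<xi>(2) by simp
  have test: "cinner (T \<xi>) y = cinner b y" if "y \<in> cspan B" for y
    using P(2)[OF that, of "T \<xi>"] P(2)[OF that, of b] P\<xi> by (simp add: cinner_diff_left)
  have "\<xi> - ?z \<in> X" using \<xi>(1) z(1) unfolding X by (rule L2_complex.span_diff)
  then obtain y where y: "y \<in> cspan B" "\<xi> - ?z = T y" unfolding X_def by blast
  have "cinner (T y) (T y) = cinner (\<xi> - x) (T y) + cinner (x - ?z) (T y)"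
    unfolding y(2)[symmetric] by (simp add: cinner_diff_left)
  also have "cinner (x - ?z) (T y) = 0" using y(1) by (intro z(2)) (simp add: X_def)
  also have "cinner (\<xi> - x) (T y) = cinner (b - T x) y"
    using test[OF y(1)] by (simp add: cinner_diff_left self_adjoint[symmetric] T.diff)
  finally have "(norm (T y))\<^sup>2 = Re (cinner (b - T x) y)"
    by (simp add: cinner_self_eq_norm complex_eq_iff)
  also have "\<dots> \<le> norm (b - T x) * norm y" by (rule Re_cinner_le_norm)
  also have "\<dots> \<le> \<delta> * (\<sigma> * norm (T y))"
    using noise stable[OF y(1)] by (intro mult_mono) (auto intro: order_trans[OF norm_ge_zero])
  finally have "norm (T y) * norm (T y) \<le> (\<sigma> * \<delta>) * norm (T y)"
    by (simp add: power2_eq_square mult_ac)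
  moreover have "0 \<le> \<sigma> * \<delta>" using \<sigma> noise norm_ge_zero[of "b - T x"] by (intro mult_nonneg_nonneg) linarith+
  ultimately have "norm (T y) \<le> \<sigma> * \<delta>"
    by (cases "norm (T y) = 0") (auto simp: mult_le_cancel_right)
  moreover have "norm (x - \<xi>) \<le> norm (x - ?z) + norm (\<xi> - ?z)"
    using norm_triangle_ineq4[of "x - ?z" "\<xi> - ?z"] by simp
  ultimately have "norm (x - \<xi>) \<le> \<sigma> * \<delta> + norm (x - ?z)" unfolding y(2) by simp
  \<comment> \<open>The distance has entered once so far; a nonnegative term is added to reach the
    factor 2.\<close>
  then show "norm (x - inv_into X A (?P b)) \<le> \<sigma> * \<delta> + 2 * norm (x - ?z)"
    unfolding \<xi>_def using norm_ge_zero[of "x - ?z"] by linarith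
qed

text \<open>Identifies the plane with the complex numbers and extracts from the domain the data of
  the preceding estimates. Linearity and self-adjointness are returned too because the
  interpretation of \<open>symm_curve\<close> is local to this proof.\<close>

lemma symm_op_stable_on_Y_DLS:
  fixes \<Omega> :: "(real \<times> real) set" and \<gamma> :: "real \<Rightarrow> real \<times> real" and z0 :: "real \<times> real"
  assumes \<Omega>: "open \<Omega>" "bounded \<Omega>" "frontier \<Omega> = \<gamma> ` {0..2 * pi}" "z0 \<in> \<Omega>"
    and \<gamma>: "C3_closed_curve \<gamma>"
    and z0: "\<forall>x\<in>frontier \<Omega>. norm (x - z0) \<noteq> 1"
  obtains c where "0 < c" "\<And>n y. 1 \<le> n \<Longrightarrow> y \<in> Y_DLS n \<Longrightarrow> norm y \<le> c * real n * norm (symm_op \<gamma> y)"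
    "module_hom scaleC scaleC (symm_op \<gamma>)"
    "\<And>x y. cinner (symm_op \<gamma> x) y = cinner x (symm_op \<gamma> y)"
proof -
  define \<phi> :: "real \<times> real \<Rightarrow> complex" where "\<phi> = (\<lambda>p. Complex (fst p) (snd p))"
  have \<phi>: "linear \<phi>" by (rule linearI) (simp_all add: \<phi>_def complex_eq_iff)
  have inj: "inj \<phi>" by (auto simp: inj_def \<phi>_def prod_eq_iff)
  have norm_\<phi>: "cmod (\<phi> p - \<phi> q) = norm (p - q)" for p q
    by (simp add: \<phi>_def norm_prod_def cmod_def)
  define g where "g = (\<lambda>t. Complex (fst (\<gamma> t)) (snd (\<gamma> t)))"
  have g: "g t = \<phi> (\<gamma> t)" for t by (simp add: g_def \<phi>_def)
  obtain g1 g2 where loop: "C2_loop g g1 g2"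
    unfolding g_def by (rule C3_closed_curve_C2_loop[OF \<gamma>])
  obtain l where bil: "bilipschitz_loop g l" by (rule C2_loop.bilipschitz[OF loop])
  interpret symm_curve g l \<gamma>
    using bil by (rule symm_curve.intro) (simp add: symm_curve_axioms_def g_def)
  define D where "D = \<phi> ` \<Omega>"
  define w where "w = \<phi> z0"
  have "D = (\<lambda>z. (Re z, Im z)) -` \<Omega>"
    by (force simp: D_def \<phi>_def image_iff complex_eq_iff)
  then have D_open: "open D"
    using \<Omega>(1) by (auto intro!: open_vimage continuous_intros)
  have D_bounded: "bounded D"
    unfolding D_def using \<Omega>(2) \<phi> by (intro bounded_linear_image) (simp_all add: linear_conv_bounded_linear)
  have range_g: "g ` {0..2 * pi} = range g"
  proof
    show "range g \<subseteq> g ` {0..2 * pi}"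
    proof
      fix x assume "x \<in> range g"
      then obtain t where "x = g t" by blast
      moreover obtain s where "s \<in> {0..<2 * pi}" "g s = g t" by (rule reduce_period)
      ultimately have "x = g s" "s \<in> {0..2 * pi}" by auto
      then show "x \<in> g ` {0..2 * pi}" by blast
    qed
  qed auto
  have "frontier D = \<phi> ` closure \<Omega> - \<phi> ` \<Omega>"
    using D_open closure_injective_linear_image[OF \<phi> inj, of \<Omega>]
    by (simp add: frontier_def interior_open D_def)
  also have "\<dots> = \<phi> ` frontier \<Omega>"
    using \<Omega>(1) by (simp add: image_set_diff[OF inj] frontier_def interior_open)
  also have "\<dots> = g ` {0..2 * pi}" unfolding \<Omega>(3) by (simp add: image_image g)
  finally have frontier: "frontier D = range g" using range_g by simp
  have wD: "w \<in> D" using \<Omega>(4) by (simp add: w_def D_def)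
  have ne1: "cmod (g t - w) \<noteq> 1" for t
  proof -
    have "g t \<in> g ` {0..2 * pi}" using range_g by blast
    then obtain s where s: "s \<in> {0..2 * pi}" "g t = g s" by blast
    have "norm (\<gamma> s - z0) \<noteq> 1" using z0 s(1) unfolding \<Omega>(3) by blast
    then have "cmod (g s - w) \<noteq> 1" unfolding g w_def norm_\<phi> .
    then show ?thesis using s(2) by simp
  qed
  obtain d where d: "0 < d" "\<And>t. d \<le> \<bar>cmod (g t - w) - 1\<bar>"
  proof -
    have "continuous_on {0..2 * pi} (\<lambda>t. \<bar>cmod (g t - w) - 1\<bar>)"
      by (intro continuous_intros continuous_on_subset[OF cont]) simp
    then obtain t0 where t0: "\<forall>t \<in> {0..2 * pi}. \<bar>cmod (g t0 - w) - 1\<bar> \<le> \<bar>cmod (g t - w) - 1\<bar>"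
      using continuous_attains_inf[of "{0..2 * pi}" "\<lambda>t. \<bar>cmod (g t - w) - 1\<bar>"] by auto
    have "\<bar>cmod (g t0 - w) - 1\<bar> \<le> \<bar>cmod (g t - w) - 1\<bar>" for t
    proof -
      obtain s where "s \<in> {0..<2 * pi}" "g s = g t" by (rule reduce_period)
      then show ?thesis using t0[rule_format, of s] by simp
    qed
    moreover have "0 < \<bar>cmod (g t0 - w) - 1\<bar>" using ne1[of t0] by simp
    ultimately show ?thesis using that by blast
  qed
  obtain L where L: "0 \<le> L"
    "\<And>t s. t \<in> {0..2 * pi} \<Longrightarrow> s \<in> {0..2 * pi} \<Longrightarrow> cmod (g t - g s) \<le> L * \<bar>t - s\<bar>"
    by (rule C2_loop.lipschitz_on_period[OF loop]) (rule that)
  \<comment> \<open>The distances to \<open>w\<close> form a connected set that omits 1.\<close>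
  have side: "(\<forall>t. cmod (g t - w) < 1) \<or> (\<forall>t. 1 < cmod (g t - w))"
  proof (rule ccontr)
    assume "\<not> ?thesis"
    then obtain t s where "1 \<le> cmod (g t - w)" "cmod (g s - w) \<le> 1" by (auto simp: not_less)
    moreover have "connected (range (\<lambda>t. cmod (g t - w)))"
      by (intro connected_continuous_image continuous_intros cont) simp
    ultimately have "1 \<in> range (\<lambda>t. cmod (g t - w))"
      using connected_contains_Icc[of "range (\<lambda>t. cmod (g t - w))" "cmod (g s - w)" "cmod (g t - w)"]
      by auto
    then show False using ne1 by auto
  qed
  \<comment> \<open>Inside the circle the positive part of the logarithm vanishes and C = 0 works;
    outside, the integral is \<open>logpot u w\<close>, which \<open>logpot_interior_bound\<close>
    controls.\<close>
  obtain C where C: "0 \<le> C" "\<And>u::real \<Rightarrow> real. continuous_on UNIV u \<Longrightarrow>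
      \<bar>\<integral>t. max 0 (ln (cmod (g t - w))) * u t \<partial>period_measure\<bar> \<le> C * (\<integral>s. \<bar>logpot u (g s)\<bar> \<partial>period_measure)"
    using side
  proof
    assume inside: "\<forall>t. cmod (g t - w) < 1"
    have "max 0 (ln (cmod (g t - w))) = 0" for t
      using inside[rule_format, of t] by (cases "cmod (g t - w) = 0") (auto simp: max_def ln_ge_zero_iff)
    then show ?thesis using that[of 0] by simp
  next
    assume outside: "\<forall>t. 1 < cmod (g t - w)"
    obtain r n where n: "0 < r" "continuous_on UNIV n" "\<And>s. cmod (n s) = 1"
      "\<And>s. ball (g s + of_real r * n s) r \<inter> D = {}"
      using C2_loop.exterior_tangent_discs[OF loop D_open D_bounded _ frontier] wD by blast
    obtain C where C: "0 \<le> C" "\<And>u::real \<Rightarrow> real. continuous_on UNIV u \<Longrightarrow>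
      \<bar>logpot u w\<bar> \<le> C * (\<integral>s. \<bar>logpot u (g s)\<bar> \<partial>period_measure)"
      by (rule logpot_interior_bound[OF D_open D_bounded frontier wD L(2,1) n(2,3,1,4)], assumption, assumption) (rule that)
    have "max 0 (ln (cmod (g t - w))) = ln (cmod (w - g t))" for t
      using outside[rule_format, of t] by (simp add: norm_minus_commute max_def)
    then show ?thesis using that[OF C(1)] C(2) by (simp add: logpot_def)
  qed
  obtain c where "0 < c" "\<And>n y. 1 \<le> n \<Longrightarrow> y \<in> Y_DLS n \<Longrightarrow> norm y \<le> c * real n * norm (symm_op \<gamma> y)"
    by (rule symm_op_stable_on_trig_poly[OF L(2,1) d C], assumption, assumption, assumption) (rule that)
  then show ?thesis using that symm_op_linear symm_op_self_adjoint by blast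
qed

theorem mainTheorem3:
  fixes \<Omega> :: "(real \<times> real) set" and \<gamma> :: "real \<Rightarrow> real \<times> real" and z0 :: "real \<times> real"
  assumes "open \<Omega>" and "connected \<Omega>" and "bounded \<Omega>" and "simply_connected \<Omega>"
    and "C3_closed_curve \<gamma>"
    and "frontier \<Omega> = \<gamma> ` {0..2 * pi}"
    and "z0 \<in> \<Omega>"
    and "\<forall>x\<in>frontier \<Omega>. norm (x - z0) \<noteq> 1"
  shows "\<exists>c>0. \<forall>n\<ge>1. \<forall>\<delta>\<ge>0. \<forall>b\<in>range (symm_op \<gamma>). \<forall>b\<^sub>\<delta>.
    norm (b\<^sub>\<delta> - b) \<le> \<delta> \<longrightarrow>
    (\<exists>z. is_arg_min (\<lambda>z. norm (inv (symm_op \<gamma>) b - z)) (\<lambda>z. z \<in> symm_op \<gamma> ` Y_DLS n) z \<and>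
       norm (inv (symm_op \<gamma>) b
             - inv_into (X_DLS \<gamma> n) (K_DLS \<gamma> n) (orth_proj (Y_DLS n) b\<^sub>\<delta>))
       \<le> c * real n * \<delta> + 2 * norm (inv (symm_op \<gamma>) b - z))"
proof -
  obtain c where c: "0 < c"
    "\<And>n y. 1 \<le> n \<Longrightarrow> y \<in> Y_DLS n \<Longrightarrow> norm y \<le> c * real n * norm (symm_op \<gamma> y)"
    and hom: "module_hom scaleC scaleC (symm_op \<gamma>)"
    and sym: "\<And>x y. cinner (symm_op \<gamma> x) y = cinner x (symm_op \<gamma> y)"
    by (rule symm_op_stable_on_Y_DLS[OF assms(1,3,6,7,5,8)]) blast
  show ?thesis
  proof (intro exI[of _ c] conjI c(1) allI impI ballI)
    fix n :: nat and \<delta> :: real and b b\<^sub>\<delta> :: L2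
    assume n: "1 \<le> n" and b: "b \<in> range (symm_op \<gamma>)" and noise: "norm (b\<^sub>\<delta> - b) \<le> \<delta>"
    let ?B = "fourier_basis ` {- int n..int n}" and ?x = "inv (symm_op \<gamma>) b"
    \<comment> \<open>As \<open>b\<close> lies in the range, \<open>inv\<close> gives an actual
      preimage, so the noise bound measures the data against K x.\<close>
    have x: "symm_op \<gamma> ?x = b" using b by (rule f_inv_into_f)
    have fin: "finite ?B" by simp
    have \<sigma>: "0 \<le> c * real n" using c(1) by simp
    have stable: "norm y \<le> c * real n * norm (symm_op \<gamma> y)" if "y \<in> cspan ?B" for y
      using c(2)[OF n] that by (simp add: Y_DLS_def)
    have noise': "norm (b\<^sub>\<delta> - symm_op \<gamma> ?x) \<le> \<delta>" using noise x by simp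
    note estimate = dual_least_squares_estimate[OF hom sym fin stable \<sigma> noise']
    \<comment> \<open>The witness for the minimiser is the orthogonal projection of the solution
      onto \<open>X_DLS \<gamma> n\<close>.\<close>
    show "\<exists>z. is_arg_min (\<lambda>z. norm (?x - z)) (\<lambda>z. z \<in> symm_op \<gamma> ` Y_DLS n) z \<and>
        norm (?x - inv_into (X_DLS \<gamma> n) (K_DLS \<gamma> n) (orth_proj (Y_DLS n) b\<^sub>\<delta>))
        \<le> c * real n * \<delta> + 2 * norm (?x - z)"
      using estimate unfolding K_DLS_def[abs_def] X_DLS_def Y_DLS_def by blast
  qed
qed

end
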